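(* Let $\alpha=(\alpha_1,\ldots,\alpha_d)\in[-1/2,\infty)^d$. If $\alpha\in\big(\{-1/2\}\cup[1/2,\infty)\big)^d$, then $\{T_t^{\alpha,\varphi}\}_{t\ge0}$ is a submarkovian (but not Markovian) symmetric diffusion semigroup on $(\mathbb{R}_+^d,dx)$ satisfying, for $1\le p\le\infty$, $$\|T_t^{\alpha,\varphi}\|_{p\to p}\le(\cosh 2t)^{-d/2},\qquad t>0.$$ If $\alpha_i\in(-1/2,1/2)$ for some $i=1,\ldots,d$, then $\{T_t^{\alpha,\varphi}\}_{t\ge0}$ is not an $L^p$-contractive semigroup, but there exists a constant $c=c(\alpha)>1$ such that, for $1\le p\le\infty$, $$\|T_t^{\alpha,\varphi}\|_{p\to p}\le c\,(\cosh 2t)^{-d/2},\qquad t>0.$$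
   Context: Notation: $d\ge 1$, $\mathbb{R}_+=(0,\infty)$, $L^p=L^p(\mathbb{R}_+^d,dx)$, $\|\cdot\|_{p\to p}$ is the operator norm on $L^p$, $\|x\|$ is the Euclidean norm, $\mathbf 1$ is the constant function $1$, $|\alpha|=\alpha_1+\ldots+\alpha_d$, and $I_\nu$ is the modified Bessel function of the first kind of order $\nu$. The semigroup. For $k\in\mathbb{N}^d$, $\mathbb N=\{0,1,2,\ldots\}$, the Laguerre functions of Hermite type are $\varphi_k^\alpha(x)=\prod_{i=1}^d\sqrt2\big(\frac{\Gamma(k_i+1)}{\Gamma(k_i+\alpha_i+1)}\big)^{1/2}L_{k_i}^{\alpha_i}(x_i^2)x_i^{\alpha_i+1/2}e^{-x_i^2/2}$, where $L_n^{a}$ is the Laguerre polynomial of degree $n$ and order $a$; they form an orthonormal basis of $L^2(\mathbb{R}_+^d,dx)$ and are eigenfunctions, with eigenvalues $4|k|+2|\alpha|+2d$ ($|k|=k_1+\ldots+k_d$), of $L_\alpha^\varphi=-\Delta+\|x\|^2+\sum_{i=1}^d x_i^{-2}(\alpha_i^2-\frac14)$. Using the same symbol for the self-adjoint extension of this operator whose spectral decomposition is given by the $\varphi_k^\alpha$, one puts $T_t^{\alpha,\varphi}=\exp(-tL_\alpha^\varphi)$ on $L^2$. For $t>0$ this has the integral representation $$T_t^{\alpha,\varphi}f(x)=\int_{\mathbb{R}_+^d}G_t^{\alpha,\varphi}(x,y)f(y)\,dy,\quad x\in\mathbb{R}_+^d,$$ $$G_t^{\alpha,\varphi}(x,y)=(\sinh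 2t)^{-d}\exp\Big(-\tfrac12\coth(2t)\big(\|x\|^2+\|y\|^2\big)\Big)\prod_{i=1}^d\sqrt{x_iy_i}\,I_{\alpha_i}\Big(\frac{x_iy_i}{\sinh 2t}\Big),$$ and for $\alpha\in[-1/2,\infty)^d$ this formula defines $T_t^{\alpha,\varphi}$ on $L^1+L^\infty$; $T_0^{\alpha,\varphi}=\mathrm{Id}$. Definitions. On a $\sigma$-finite measure space $(X,\mu)$, a symmetric diffusion semigroup is a family of linear operators $\{T_t\}_{t\ge0}$, $T_0=\mathrm{Id}$, mapping a linear subspace of the measurable functions that contains all $L^p(X,\mu)$, $1\le p\le\infty$ (e.g. $L^1+L^\infty$) into measurable functions, such that: (i) for each $1\le p\le\infty$ every $T_t$ is a contraction on $L^p$ and $\{T_t\}_{t\ge0}$ is a semigroup there; (ii) each $T_t$ is self-adjoint on $L^2$; (iii) $\lim_{t\to0^+}T_tf=f$ in $L^2$ for each $f\in L^2$. It is Markovian if in addition (iv) $T_tf\ge0$ whenever $f\ge0$, for all $t$, and (v) $T_t\mathbf 1=\mathbf 1$ for all $t$. It is submarkovian if (i)-(iv) hold and (v') $T_t\mathbf 1\le\mathbf 1$ for all $t$. A semigroup $\{T_t\}_{t\ge 0}=\{\exp(-tL)\}_{t\ge0}$ generated by a positive self-adjoint operator $L$ on $L^2(X,\mu)$ is called $L^p$-contractive if $\|T_tf\|_p\le\|f\|_p$ for all $1\le p\le\infty$, all $t\ge0$ and all $f\in L^2\cap L^p(X,\mu)$. *)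

theory Defs
  imports "HOL-Probability.Probability"
begin

text \<open>
  Functions are representatives of almost-everywhere classes, so all identities and inequalities
  between functions are required almost everywhere. Exponents \<open>1 \<le> p \<le> \<infinity>\<close> live in
  \<^typ>\<open>ennreal\<close>. A non-measurable function has norm \<open>\<infinity>\<close>; hence every finite bound on a norm below
  also asserts measurability.
\<close>

definition Lp_norm :: "ennreal \<Rightarrow> 'a measure \<Rightarrow> ('a \<Rightarrow> real) \<Rightarrow> ennreal" where
  "Lp_norm p M f =
    (if f \<notin> borel_measurable M then \<infinity>
     else if p = \<infinity> then esssup M (\<lambda>x. ennreal \<bar>f x\<bar>)
     else (let r = enn2real p; J = (\<integral>\<^sup>+x. ennreal (\<bar>f x\<bar> powr r) \<partial>M)
           in if J = \<infinity> then \<infinity> else ennreal (enn2real J powr (1 / r))))"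

definition Lp_space :: "ennreal \<Rightarrow> 'a measure \<Rightarrow> ('a \<Rightarrow> real) set" where
  "Lp_space p M = {f \<in> borel_measurable M. Lp_norm p M f < \<infinity>}"

definition L1_plus_Linf :: "'a measure \<Rightarrow> ('a \<Rightarrow> real) set" where
  "L1_plus_Linf M = {f. \<exists>g\<in>Lp_space 1 M. \<exists>h\<in>Lp_space \<infinity> M. f = (\<lambda>x. g x + h x)}"

definition Lp_opnorm :: "ennreal \<Rightarrow> 'a measure \<Rightarrow> (('a \<Rightarrow> real) \<Rightarrow> 'a \<Rightarrow> real) \<Rightarrow> ennreal" where
  "Lp_opnorm p M A = (SUP f \<in> {f \<in> Lp_space p M. Lp_norm p M f \<le> 1}. Lp_norm p M (A f))"

text \<open>
  In the next definition \<open>D\<close> is the common domain of the operators. Compatibility of \<open>T t\<close> with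
  almost-everywhere equality need not be demanded: it follows from linearity and contractivity
  on \<open>L\<^sup>1\<close>. For the bounded operators at hand self-adjointness on \<open>L\<^sup>2\<close> is symmetry.
\<close>

definition symmetric_diffusion_semigroup ::
  "'a measure \<Rightarrow> ('a \<Rightarrow> real) set \<Rightarrow> (real \<Rightarrow> ('a \<Rightarrow> real) \<Rightarrow> 'a \<Rightarrow> real) \<Rightarrow> bool" where
  "symmetric_diffusion_semigroup M D T \<longleftrightarrow>
    sigma_finite_measure M \<and>
    \<comment> \<open>linear operators on a linear space of measurable functions containing every \<open>L\<^sup>p\<close>\<close>
    D \<subseteq> borel_measurable M \<and> (\<lambda>_. 0) \<in> D \<and>
    (\<forall>f\<in>D. \<forall>g\<in>D. \<forall>a b. (\<lambda>x. a * f x + b * g x) \<in> D) \<and>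
    (\<forall>p\<ge>1. Lp_space p M \<subseteq> D) \<and>
    (\<forall>t\<ge>0. \<forall>f\<in>D. T t f \<in> borel_measurable M) \<and>
    (\<forall>t\<ge>0. \<forall>f\<in>D. \<forall>g\<in>D. \<forall>a b.
       AE x in M. T t (\<lambda>y. a * f y + b * g y) x = a * T t f x + b * T t g x) \<and>
    (\<forall>f\<in>D. AE x in M. T 0 f x = f x) \<and>
    \<comment> \<open>contraction semigroup on every \<open>L\<^sup>p\<close>\<close>
    (\<forall>p\<ge>1. \<forall>t\<ge>0. \<forall>f\<in>Lp_space p M. Lp_norm p M (T t f) \<le> Lp_norm p M f) \<and>
    (\<forall>p\<ge>1. \<forall>s\<ge>0. \<forall>t\<ge>0. \<forall>f\<in>Lp_space p M. AE x in M. T (s + t) f x = T s (T t f) x) \<and>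
    \<comment> \<open>self-adjointness and strong continuity on \<open>L\<^sup>2\<close>\<close>
    (\<forall>t\<ge>0. \<forall>f\<in>Lp_space 2 M. \<forall>g\<in>Lp_space 2 M.
       (\<integral>x. T t f x * g x \<partial>M) = (\<integral>x. f x * T t g x \<partial>M)) \<and>
    (\<forall>f\<in>Lp_space 2 M. ((\<lambda>t. Lp_norm 2 M (\<lambda>x. T t f x - f x)) \<longlongrightarrow> 0) (at_right 0))"

definition positive_operators ::
  "'a measure \<Rightarrow> ('a \<Rightarrow> real) set \<Rightarrow> (real \<Rightarrow> ('a \<Rightarrow> real) \<Rightarrow> 'a \<Rightarrow> real) \<Rightarrow> bool" where
  "positive_operators M D T \<longleftrightarrow>
    (\<forall>t\<ge>0. \<forall>f\<in>D. (AE x in M. 0 \<le> f x) \<longrightarrow> (AE x in M. 0 \<le> T t f x))"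

definition markovian_semigroup ::
  "'a measure \<Rightarrow> ('a \<Rightarrow> real) set \<Rightarrow> (real \<Rightarrow> ('a \<Rightarrow> real) \<Rightarrow> 'a \<Rightarrow> real) \<Rightarrow> bool" where
  "markovian_semigroup M D T \<longleftrightarrow>
    symmetric_diffusion_semigroup M D T \<and> positive_operators M D T \<and>
    (\<forall>t\<ge>0. AE x in M. T t (\<lambda>_. 1) x = 1)"

definition submarkovian_semigroup ::
  "'a measure \<Rightarrow> ('a \<Rightarrow> real) set \<Rightarrow> (real \<Rightarrow> ('a \<Rightarrow> real) \<Rightarrow> 'a \<Rightarrow> real) \<Rightarrow> bool" where
  "submarkovian_semigroup M D T \<longleftrightarrow>
    symmetric_diffusion_semigroup M D T \<and> positive_operators M D T \<and>
    (\<forall>t\<ge>0. AE x in M. T t (\<lambda>_. 1) x \<le> 1)"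

text \<open>
  \<open>L\<^sup>p\<close>-contractivity is a property of semigroups \<open>exp (-t L)\<close> with \<open>L\<close> positive self-adjoint on
  \<open>L\<^sup>2\<close>. That \<open>T\<close> has this form is a presupposition and not a conjunct of the predicate, so the
  negation says exactly that one of the norm inequalities fails.
\<close>

definition Lp_contractive ::
  "'a measure \<Rightarrow> (real \<Rightarrow> ('a \<Rightarrow> real) \<Rightarrow> 'a \<Rightarrow> real) \<Rightarrow> bool" where
  "Lp_contractive M T \<longleftrightarrow>
    (\<forall>p\<ge>1. \<forall>t\<ge>0. \<forall>f \<in> Lp_space 2 M \<inter> Lp_space p M. Lp_norm p M (T t f) \<le> Lp_norm p M f)"

text \<open>
  The modified Bessel function of the first kind, for arguments \<open>z > 0\<close> only (\<open>powr\<close> vanishes at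
  base 0); \<^const>\<open>rGamma\<close> is the entire function \<open>1 / \<Gamma>\<close>.
\<close>

definition bessel_I :: "real \<Rightarrow> real \<Rightarrow> real" where
  "bessel_I \<nu> z = (\<Sum>k. (z / 2) powr (2 * real k + \<nu>) * rGamma (real k + \<nu> + 1) / fact k)"

definition pos_orthant :: "(real ^ 'n) measure" where
  "pos_orthant = restrict_space lborel {x. \<forall>i. 0 < x $ i}"

definition laguerre_kernel :: "real ^ 'n \<Rightarrow> real \<Rightarrow> real ^ 'n \<Rightarrow> real ^ 'n \<Rightarrow> real" where
  "laguerre_kernel \<alpha> t x y =
    1 / sinh (2 * t) ^ CARD('n)
    * exp (- (1 / 2) * (cosh (2 * t) / sinh (2 * t)) * ((norm x)\<^sup>2 + (norm y)\<^sup>2))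
    * (\<Prod>i\<in>UNIV. sqrt (x $ i * y $ i) * bessel_I (\<alpha> $ i) (x $ i * y $ i / sinh (2 * t)))"

text \<open>
  The semigroup on \<open>L\<^sup>1 + L\<^sup>\<infinity>\<close> of functions on the open orthant, \<open>t \<ge> 0\<close>. On \<open>L\<^sup>2\<close> it is
  \<open>exp (-t L)\<close> for the operator \<open>L\<close> diagonalised by the Laguerre functions of Hermite type
  (Hille-Hardy formula); the integral formula is what extends it to \<open>L\<^sup>1 + L\<^sup>\<infinity>\<close>.
\<close>

definition laguerre_semigroup ::
  "real ^ 'n \<Rightarrow> real \<Rightarrow> (real ^ 'n \<Rightarrow> real) \<Rightarrow> real ^ 'n \<Rightarrow> real" where
  "laguerre_semigroup \<alpha> t f x =
    (if t = 0 then f x else (\<integral>y. laguerre_kernel \<alpha> t x y * f y \<partial>pos_orthant))"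

end

(* In each variable the kernel is explicit enough to integrate: with u = x^2 / (2 sinh 2t cosh 2t) and
   b = (a + 1/2) / 2, termwise integration of the Bessel series gives
     int g_t(x,y) dy = (cosh 2t)^(-1/2) exp (- u sinh(2t)^2) Phi_b(u),
     Phi_b(u) = (1 / Gamma b) int_0^u e^(-v) v^(b-1) (1 - v/u)^(b-1/2) dv   (Phi_0 = 1).
   If b >= 1/2 the last factor is at most 1, hence Phi_b <= 1. If 0 < b < 1/2 it exceeds 1: Phi_b is
   still bounded, but Phi_b(u) = 1 + b (1/2 - b) / u + O(1/u^2) > 1 for large u, which destroys
   contractivity on L^infinity. Schur's test turns bounds for the mass of the symmetric kernel into bounds
   on every L^p. The semigroup law is Weber's second exponential integral. For strong continuity it
   suffices to treat indicators of open sets, and there the kernel concentrates because its integrals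
   against y^(a+1/2) exp (- l y^2) are explicit. *)

theory Submission
  imports Defs
begin

section \<open>Gamma integrals and the Bessel series\<close>

text \<open>The two exceptional orders are the zeros of the first-order correction b (1/2 - b): at b
  = 1/2 the factor (1 - v/u)^(b-1/2) is constant 1, and as b tends to 0 the gamma law of shape b
  collapses to the point 0. The mass is Phi_b(u) times the damping (cosh 2t)^(-1/2) exp (- u
  sinh(2t)^2). As x is free, u and t can be prescribed independently; so the damping can be made
  negligible while u is held fixed, and even a gain of order 1/u is enough to break contractivity.
  The semigroup is given by its kernel alone, so the semigroup law, symmetry and strong continuity
  are all read off the kernel. Calculations take place in the nonnegative extended reals, where sums
  and integrals commute without any convergence argument; signed functions enter by Fubini, once the
  absolute integrals are known to be finite. The price is that a negative term of an estimate has to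
  stand, with its sign changed, on the other side of the inequality.\<close>

lemma ennreal_indicator_times: "ennreal (indicator A x * c) = ennreal c * indicator A x"
  by (simp add: indicator_def)

text \<open>The substitution t = q y^2 leads to Euler's integral. Each term of a Bessel series,
  multiplied by a power and a Gaussian, is of this form.\<close>

lemma nn_integral_powr_exp_square:
  fixes s q :: real
  assumes s: "0 < s" and q: "0 < q"
  shows "(\<integral>\<^sup>+y. ennreal (y powr (2 * s - 1) * exp (- (q * y\<^sup>2))) * indicator {0<..} y \<partial>lborel)
    = ennreal (Gamma s / (2 * q powr s))"
proof -
  define f where "f = (\<lambda>t::real. t powr (s - 1) / exp t)"
  define g where "g = (\<lambda>y::real. q * y\<^sup>2)"
  have img: "g ` {0<..} = {0<..}"
  proof safe
    fix z :: real assume "z > 0"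
    then have "z = g (sqrt (z / q))" "sqrt (z / q) \<in> {0<..}" using q by (auto simp: g_def)
    then show "z \<in> g ` {0<..}" by blast
  qed (use q in \<open>auto simp: g_def\<close>)
  have "(f has_integral Gamma s) {0..}" unfolding f_def by (rule Gamma_integral_real[OF s])
  then have fi: "(f has_integral Gamma s) {0<..}"
    using has_integral_interior[of "{0::real..}" f "Gamma s"] by (simp add: frontier_real_atLeast)
  then have "f absolutely_integrable_on {0<..}"
    by (intro nonnegative_absolutely_integrable_1) (auto simp: f_def integrable_on_def)
  moreover have "integral {0<..} f = Gamma s" using fi by (rule integral_unique)
  moreover have "inj_on g {0<..}"
    using q by (auto simp: inj_on_def g_def power2_eq_iff)
  ultimately have "(\<lambda>y. \<bar>2 * q * y\<bar> * f (g y)) absolutely_integrable_on {0<..} \<and>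
      integral {0<..} (\<lambda>y. \<bar>2 * q * y\<bar> * f (g y)) = Gamma s"
    by (subst has_absolute_integral_change_of_variables_1'[where f = f and g = g])
       (auto simp: img[unfolded g_def] g_def intro!: derivative_eq_intros)
  then have "((\<lambda>y. \<bar>2 * q * y\<bar> * f (g y)) has_integral Gamma s) {0<..}"
    by (metis absolutely_integrable_on_def has_integral_integral)
  then have "((\<lambda>y. \<bar>2 * q * y\<bar> * f (g y) / (2 * q powr s)) has_integral Gamma s / (2 * q powr s)) {0<..}"
    by (rule has_integral_divide)
  then have "((\<lambda>y. y powr (2 * s - 1) * exp (- (q * y\<^sup>2))) has_integral Gamma s / (2 * q powr s)) {0<..}"
  proof (subst has_integral_cong)
    fix y :: real assume y: "y \<in> {0<..}"
    have e: "2 * q * y * ((q * y\<^sup>2) powr (s - 1)) = 2 * q powr s * y powr (2 * s - 1)"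
    proof -
      have "(q * y\<^sup>2) powr (s - 1) = q powr (s - 1) * y powr (2 * s - 2)"
        using q y powr_powr[of y 2 "s - 1"] by (simp add: powr_mult algebra_simps)
      moreover have "q * q powr (s - 1) = q powr s" "y * y powr (2 * s - 2) = y powr (2 * s - 1)"
        using q y by (simp_all add: powr_mult_base)
      moreover have "2 * q * y * ((q powr (s - 1)) * y powr (2 * s - 2))
        = 2 * (q * q powr (s - 1)) * (y * y powr (2 * s - 2))" by (simp only: mult_ac)
      ultimately show ?thesis by simp
    qed
    then show "y powr (2 * s - 1) * exp (- (q * y\<^sup>2)) = \<bar>2 * q * y\<bar> * f (g y) / (2 * q powr s)"
    proof -
      have "\<bar>2 * q * y\<bar> * f (g y) = 2 * q * y * (q * y\<^sup>2) powr (s - 1) * exp (- (q * y\<^sup>2))"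
        using q y by (simp add: f_def g_def exp_minus divide_inverse)
      then show ?thesis unfolding e using q by simp
    qed
  qed
  from nn_integral_has_integral_lebesgue[OF _ this] show ?thesis
    by (simp add: ennreal_indicator_times)
qed

lemma nn_integral_powr_exp:
  fixes s u :: real
  assumes s: "0 < s" and u: "0 < u"
  shows "(\<integral>\<^sup>+y. ennreal (y powr (s - 1) * exp (- (u * y))) * indicator {0<..} y \<partial>lborel)
    = ennreal (Gamma s / u powr s)"
proof -
  have [simp]: "indicator {0<..} (u * y) = (indicator {0<..} y :: ennreal)" for y
    using u by (simp add: indicator_def zero_less_mult_iff)
  have "Gamma s = (\<integral>\<^sup>+t. ennreal (indicator {0..} t * t powr (s - 1) / exp t) \<partial>lborel)"
    by (rule Gamma_conv_nn_integral_real[OF s])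
  also have "\<dots> = (\<integral>\<^sup>+t. ennreal (t powr (s - 1) * exp (- t)) * indicator {0<..} t \<partial>lborel)"
    by (intro nn_integral_cong) (auto simp: indicator_def exp_minus field_simps)
  also have "\<dots> = ennreal u * (\<integral>\<^sup>+t. ennreal ((u * t) powr (s - 1) * exp (- (u * t))) * indicator {0<..} t \<partial>lborel)"
    using u by (subst nn_integral_real_affine[of _ u 0]) auto
  also have "\<dots> = (\<integral>\<^sup>+t. ennreal (u powr s) * (ennreal (t powr (s - 1) * exp (- (u * t))) * indicator {0<..} t) \<partial>lborel)"
    using u by (subst nn_integral_cmult[symmetric])
      (auto intro!: nn_integral_cong simp: indicator_def powr_mult powr_diff mult_ac simp flip: ennreal_mult')
  also have "\<dots> = ennreal (u powr s) * (\<integral>\<^sup>+t. ennreal (t powr (s - 1) * exp (- (u * t))) * indicator {0<..} t \<partial>lborel)"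
    by (rule nn_integral_cmult) simp
  finally have "ennreal (1 / u powr s) * ennreal (Gamma s) = ennreal (1 / u powr s) * (ennreal (u powr s) * (\<integral>\<^sup>+t. ennreal (t powr (s - 1) * exp (- (u * t))) * indicator {0<..} t \<partial>lborel))"
    by simp
  moreover have "ennreal (1 / u powr s) * ennreal (u powr s) = 1"
    using u by (simp flip: ennreal_mult')
  ultimately show ?thesis
    using u by (simp flip: mult.assoc ennreal_mult')
qed

lemma nn_integral_Beta:
  fixes a b :: real
  assumes "0 < a" "0 < b"
  shows "(\<integral>\<^sup>+s. ennreal (s powr (a - 1) * (1 - s) powr (b - 1)) * indicator {0<..<1} s \<partial>lborel) = ennreal (Beta a b)"
proof -
  have "((\<lambda>t. t powr (a - 1) * (1 - t) powr (b - 1)) has_integral Beta a b) {0..1}"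
    by (rule has_integral_Beta_real[OF assms])
  then have "((\<lambda>t. t powr (a - 1) * (1 - t) powr (b - 1)) has_integral Beta a b) {0<..<1}"
    by (simp add: has_integral_Icc_iff_Ioo)
  from nn_integral_has_integral_lebesgue[OF _ this] show ?thesis
    by (simp add: ennreal_indicator_times)
qed

lemma rGamma_pos: "0 < x \<Longrightarrow> 0 < rGamma (x::real)"
  by (simp add: rGamma_inverse_Gamma Gamma_real_pos)

lemma rGamma_nonneg: "0 < x \<Longrightarrow> 0 \<le> rGamma (x::real)"
  by (simp add: rGamma_pos less_imp_le)

lemma rGamma_Gamma: "0 < x \<Longrightarrow> rGamma x * Gamma x = (1::real)"
  using Gamma_real_pos[of x] by (simp add: rGamma_inverse_Gamma del: Gamma_real_pos)

lemma summable_bessel_I: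
  fixes a z :: real
  assumes a: "- 1 < a"
  shows "summable (\<lambda>k. (z / 2) powr (2 * real k + a) * rGamma (real k + a + 1) / fact k)"
proof -
  \<comment> \<open>The quotient of consecutive terms is (z/2)^2 / ((n+1)(n+a+1)). Since
    (n+1)(n+a+1) \<ge> n (a+1), this N makes it at most 1/2 for n \<ge> N.\<close>
  obtain N :: nat where N: "(z / 2)\<^sup>2 * 2 / (a + 1) < real N" using reals_Archimedean2 by blast
  show ?thesis
  proof (rule summable_ratio_test[where c = "1 / 2" and N = N])
    fix n assume n: "n \<ge> N"
    let ?t = "\<lambda>k. (z / 2) powr (2 * real k + a) * rGamma (real k + a + 1) / fact k"
    have "?t (Suc n) * ((real n + 1) * (real n + a + 1)) = (z / 2)\<^sup>2 * ?t n"
    proof -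
      \<comment> \<open>Negative z is covered: real \<open>ln\<close> satisfies
        \<open>exp (ln x) = \<bar>x\<bar>\<close> for x \<noteq> 0, and the split-off exponent 2
        removes the sign.\<close>
      have e: "(z / 2) powr (2 * real (Suc n) + a) = (z / 2)\<^sup>2 * (z / 2) powr (2 * real n + a)"
      proof (cases "z = 0")
        case False
        then have "(z / 2) powr 2 = (z / 2)\<^sup>2"
          by (simp add: powr_def exp_double exp_ln_abs power_divide del: ln_divide_pos)
        moreover have "2 * real (Suc n) + a = 2 + (2 * real n + a)" by simp
        ultimately show ?thesis by (simp only: powr_add)
      qed simp
      have g: "rGamma (real n + a + 1) = (real n + a + 1) * rGamma (real (Suc n) + a + 1)"
        using rGamma_plus1[of "real n + a + 1"] by (simp add: algebra_simps)
      have "?t (Suc n) * ((real n + 1) * (real n + a + 1))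
        = (z / 2)\<^sup>2 * ((z / 2) powr (2 * real n + a) * ((real n + a + 1) * rGamma (real (Suc n) + a + 1))
          * ((real n + 1) / fact (Suc n)))"
        unfolding e by (simp only: mult_ac times_divide_eq_right times_divide_eq_left)
      also have "(real n + 1) / fact (Suc n) = 1 / fact n"
        by (simp add: field_simps del: of_nat_Suc) (simp add: algebra_simps)
      finally show ?thesis unfolding g by simp
    qed
    moreover have "(real n + 1) * (real n + a + 1) \<noteq> 0" using a by auto
    ultimately have "?t (Suc n) = (z / 2)\<^sup>2 * ?t n / ((real n + 1) * (real n + a + 1))"
      by (intro eq_divide_imp)
    then have eq: "?t (Suc n) = (z / 2)\<^sup>2 / ((real n + 1) * (real n + a + 1)) * ?t n" by simp
    have "(z / 2)\<^sup>2 * 2 / (a + 1) \<le> real n"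
      using N n by linarith
    then have "(z / 2)\<^sup>2 * 2 \<le> real n * (a + 1)"
      using a by (simp only: pos_divide_le_eq)
    also have "\<dots> \<le> (real n + 1) * (real n + a + 1)"
      using a by (intro mult_mono) auto
    finally have le: "(z / 2)\<^sup>2 * 2 \<le> (real n + 1) * (real n + a + 1)" .
    have "(z / 2)\<^sup>2 / ((real n + 1) * (real n + a + 1)) \<le> 1 / 2"
      using a le by (subst pos_divide_le_eq) (auto intro!: mult_pos_pos)
    then show "norm (?t (Suc n)) \<le> 1 / 2 * norm (?t n)"
      unfolding eq norm_mult using a by (intro mult_right_mono) auto
  qed simp
qed

lemma bessel_I_term_nonneg:
  fixes a z :: real
  assumes a: "- 1 < a"
  shows "0 \<le> (z / 2) powr (2 * real k + a) * rGamma (real k + a + 1) / fact k"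
  using rGamma_nonneg[of "real k + a + 1"] a by simp

lemma bessel_I_nonneg: "- 1 < a \<Longrightarrow> 0 \<le> bessel_I a z"
  unfolding bessel_I_def by (intro suminf_nonneg summable_bessel_I bessel_I_term_nonneg)

lemma ennreal_bessel_I:
  assumes a: "- 1 < a"
  shows "ennreal (bessel_I a z) = (\<Sum>k. ennreal ((z / 2) powr (2 * real k + a) * rGamma (real k + a + 1) / fact k))"
  unfolding bessel_I_def
  by (intro suminf_ennreal2[symmetric] summable_bessel_I bessel_I_term_nonneg a)

lemma borel_measurable_bessel_I [measurable]: "bessel_I a \<in> borel_measurable borel"
  unfolding bessel_I_def[abs_def] by measurable

text \<open>The common source of all explicit integrals below, hence the free exponent m: m = 1/2
  gives the mass of the kernel, m = a + 1 Weber's first integral, and m = 2j + a + 1 a term of the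
  second one. The condition on m is integrability at 0 of the term k = 0.\<close>

lemma nn_integral_powr_exp_bessel_I:
  fixes a b q m :: real
  assumes a: "- 1 < a" and b: "0 < b" and q: "0 < q" and m: "0 < m + a + 1"
  shows "(\<integral>\<^sup>+y. ennreal (y powr m * exp (- (q * y\<^sup>2)) * bessel_I a (b * y)) * indicator {0<..} y \<partial>lborel)
    = (\<Sum>k. ennreal ((b / 2) powr (2 * real k + a) * rGamma (real k + a + 1) / fact k
        * Gamma (real k + (m + a + 1) / 2) / (2 * q powr (real k + (m + a + 1) / 2))))"
proof -
  let ?c = "\<lambda>k::nat. (b / 2) powr (2 * real k + a) * rGamma (real k + a + 1) / fact k"
  let ?s = "\<lambda>k::nat. real k + (m + a + 1) / 2"
  have c: "0 \<le> ?c k" for k by (rule bessel_I_term_nonneg[OF a])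
  have "ennreal (y powr m * exp (- (q * y\<^sup>2)) * bessel_I a (b * y)) * indicator {0<..} y
    = (\<Sum>k. ennreal (?c k) * (ennreal (y powr (2 * ?s k - 1) * exp (- (q * y\<^sup>2))) * indicator {0<..} y))" for y
  proof (cases "y > 0")
    case True
    have "ennreal (y powr m * exp (- (q * y\<^sup>2)) * bessel_I a (b * y))
      = (\<Sum>k. ennreal (y powr m * exp (- (q * y\<^sup>2))) * ennreal ((b * y / 2) powr (2 * real k + a) * rGamma (real k + a + 1) / fact k))"
      by (subst ennreal_mult', simp, subst ennreal_bessel_I[OF a], rule ennreal_suminf_cmult[symmetric])
    also have "\<dots> = (\<Sum>k. ennreal (?c k) * ennreal (y powr (2 * ?s k - 1) * exp (- (q * y\<^sup>2))))"
    proof (rule arg_cong[of _ _ suminf], rule ext)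
      fix k :: nat
      have "(b * y / 2) powr (2 * real k + a) = (b / 2) powr (2 * real k + a) * y powr (2 * real k + a)"
        using b True by (simp flip: powr_mult)
      moreover have "y powr (2 * ?s k - 1) = y powr m * y powr (2 * real k + a)"
        using True by (simp add: add_divide_distrib algebra_simps flip: powr_add)
      ultimately show "ennreal (y powr m * exp (- (q * y\<^sup>2))) * ennreal ((b * y / 2) powr (2 * real k + a) * rGamma (real k + a + 1) / fact k)
        = ennreal (?c k) * ennreal (y powr (2 * ?s k - 1) * exp (- (q * y\<^sup>2)))"
        using c[of k] by (simp add: mult_ac flip: ennreal_mult')
    qed
    finally show ?thesis using True by simp
  qed simp
  note eq = this
  have "(\<integral>\<^sup>+y. ennreal (y powr m * exp (- (q * y\<^sup>2)) * bessel_I a (b * y)) * indicator {0<..} y \<partial>lborel)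
    = (\<Sum>k. \<integral>\<^sup>+y. ennreal (?c k) * (ennreal (y powr (2 * ?s k - 1) * exp (- (q * y\<^sup>2))) * indicator {0<..} y) \<partial>lborel)"
    unfolding eq by (rule nn_integral_suminf) measurable
  also have "\<dots> = (\<Sum>k. ennreal (?c k * Gamma (?s k) / (2 * q powr ?s k)))"
  proof (rule arg_cong[of _ _ suminf], rule ext)
    fix k :: nat
    have s: "0 < ?s k" using m by (intro add_nonneg_pos) auto
    show "(\<integral>\<^sup>+y. ennreal (?c k) * (ennreal (y powr (2 * ?s k - 1) * exp (- (q * y\<^sup>2))) * indicator {0<..} y) \<partial>lborel)
      = ennreal (?c k * Gamma (?s k) / (2 * q powr ?s k))"
      using c[of k] by (subst nn_integral_cmult, simp, subst nn_integral_powr_exp_square[OF s q],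
        subst ennreal_mult'[symmetric]) simp_all
  qed
  finally show ?thesis .
qed

section \<open>The mass of the one-dimensional kernel\<close>

lemma suminf_ennreal_exp: 
  fixes c v :: real
  assumes "0 \<le> c" "0 \<le> v"
  shows "(\<Sum>k. ennreal (c * v ^ k / fact k)) = ennreal (c * exp v)"
proof -
  have "(\<lambda>k. c * (v ^ k / fact k)) sums (c * exp v)"
    using exp_converges[of v] by (intro sums_mult) (simp add: divide_inverse mult.commute)
  then have s: "(\<lambda>k. c * v ^ k / fact k) sums (c * exp v)" by simp
  show ?thesis
    using assms s by (subst suminf_ennreal2) (auto simp: sums_iff)
qed

text \<open>For m = a + 1 the Gamma value from the integration cancels the reciprocal Gamma of the
  Bessel coefficient, and an exponential series remains.\<close>

lemma nn_integral_Weber: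
  fixes a b q :: real
  assumes a: "- 1 < a" and b: "0 < b" and q: "0 < q"
  shows "(\<integral>\<^sup>+y. ennreal (y powr (a + 1) * exp (- (q * y\<^sup>2)) * bessel_I a (b * y)) * indicator {0<..} y \<partial>lborel)
    = ennreal ((b / 2) powr a / (2 * q powr (a + 1)) * exp (b\<^sup>2 / (4 * q)))"
proof -
  have "(\<integral>\<^sup>+y. ennreal (y powr (a + 1) * exp (- (q * y\<^sup>2)) * bessel_I a (b * y)) * indicator {0<..} y \<partial>lborel)
    = (\<Sum>k. ennreal ((b / 2) powr (2 * real k + a) * rGamma (real k + a + 1) / fact k
        * Gamma (real k + (a + 1 + a + 1) / 2) / (2 * q powr (real k + (a + 1 + a + 1) / 2))))"
    using a by (intro nn_integral_powr_exp_bessel_I b q) auto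
  also have "\<dots> = (\<Sum>k. ennreal ((b / 2) powr a / (2 * q powr (a + 1)) * (b\<^sup>2 / (4 * q)) ^ k / fact k))"
  proof (rule arg_cong[of _ _ suminf], rule ext, rule arg_cong[of _ _ ennreal])
    fix k :: nat
    have 1: "real k + (a + 1 + a + 1) / 2 = real k + a + 1" by (simp add: field_simps)
    have 2: "rGamma (real k + a + 1) * Gamma (real k + a + 1) = 1"
      using a by (intro rGamma_Gamma) simp
    have 3: "(b / 2) powr (2 * real k + a) = (b\<^sup>2 / 4) ^ k * (b / 2) powr a"
      using b by (simp add: powr_add powr_powr[symmetric] powr_realpow power_divide power2_eq_square)
    have 4: "q powr (real k + a + 1) = q ^ k * q powr (a + 1)"
      using q by (simp add: powr_add powr_realpow add.assoc)
    have "(b / 2) powr (2 * real k + a) * rGamma (real k + a + 1) / fact k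
        * Gamma (real k + a + 1) / (2 * q powr (real k + a + 1))
       = (b / 2) powr (2 * real k + a) * (rGamma (real k + a + 1) * Gamma (real k + a + 1)) / fact k
         / (2 * q powr (real k + a + 1))" by simp
    also have "\<dots> = (b / 2) powr a / (2 * q powr (a + 1)) * (b\<^sup>2 / (4 * q)) ^ k / fact k"
      unfolding 2 3 4 using q by (simp add: field_simps power_mult_distrib power_divide)
    finally show "(b / 2) powr (2 * real k + a) * rGamma (real k + a + 1) / fact k
        * Gamma (real k + (a + 1 + a + 1) / 2) / (2 * q powr (real k + (a + 1 + a + 1) / 2))
       = (b / 2) powr a / (2 * q powr (a + 1)) * (b\<^sup>2 / (4 * q)) ^ k / fact k"
      unfolding 1 .
  qed
  also have "\<dots> = ennreal ((b / 2) powr a / (2 * q powr (a + 1)) * exp (b\<^sup>2 / (4 * q)))"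
    using q by (intro suminf_ennreal_exp) auto
  finally show ?thesis .
qed

section \<open>Reduction of the kernel mass to a series in u\<close>

definition laguerre_kernel1 :: "real \<Rightarrow> real \<Rightarrow> real \<Rightarrow> real \<Rightarrow> real" where
  "laguerre_kernel1 a t x y =
    1 / sinh (2 * t) * exp (- (1 / 2) * (cosh (2 * t) / sinh (2 * t)) * (x\<^sup>2 + y\<^sup>2))
    * (sqrt (x * y) * bessel_I a (x * y / sinh (2 * t)))"

text \<open>Up to an explicit factor, \<open>laguerre_mass \<beta> u\<close> is the integral of \<open>laguerre_kernel1 (2 * \<beta> - 1 / 2) t x\<close>, where
  \<open>u = x\<^sup>2 / (2 * sinh (2 * t) * cosh (2 * t))\<close>; the order \<open>- 1 / 2\<close> is \<open>\<beta> = 0\<close> and the order \<open>1 / 2\<close> is \<open>\<beta> = 1 / 2\<close>.\<close>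

definition laguerre_mass :: "real \<Rightarrow> real \<Rightarrow> ennreal" where
  "laguerre_mass \<beta> u = (\<Sum>k. ennreal (exp (- u) * u powr \<beta> * u ^ k / fact k
     * (Gamma (real k + \<beta> + 1 / 2) * rGamma (real k + 2 * \<beta> + 1 / 2))))"

lemma laguerre_kernel1_nonneg:
  "- 1 < a \<Longrightarrow> 0 < t \<Longrightarrow> 0 \<le> x \<Longrightarrow> 0 \<le> y \<Longrightarrow> 0 \<le> laguerre_kernel1 a t x y"
  unfolding laguerre_kernel1_def by (intro mult_nonneg_nonneg bessel_I_nonneg) auto

lemma laguerre_kernel1_commute: "laguerre_kernel1 a t x y = laguerre_kernel1 a t y x"
  unfolding laguerre_kernel1_def by (simp add: mult.commute add.commute)

lemma laguerre_kernel1_measurable [measurable]: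
  assumes [measurable]: "f \<in> borel_measurable M" "g \<in> borel_measurable M"
  shows "(\<lambda>z. laguerre_kernel1 a t (f z) (g z)) \<in> borel_measurable M"
  unfolding laguerre_kernel1_def by measurable

text \<open>Isolates the y-dependence in the shape that \<open>nn_integral_powr_exp_bessel_I\<close>
  integrates, with q = cosh / (2 sinh) and b = x / sinh.\<close>

lemma laguerre_kernel1_factor:
  assumes "0 < x" "0 < y"
  shows "laguerre_kernel1 a t x y = 1 / sinh (2 * t) * exp (- (cosh (2 * t) / (2 * sinh (2 * t)) * x\<^sup>2)) * sqrt x
     * (y powr (1 / 2) * exp (- (cosh (2 * t) / (2 * sinh (2 * t)) * y\<^sup>2)) * bessel_I a (x / sinh (2 * t) * y))"
proof -
  have "exp (- (1 / 2) * (cosh (2 * t) / sinh (2 * t)) * (x\<^sup>2 + y\<^sup>2)) = exp (- (cosh (2 * t) / (2 * sinh (2 * t)) * x\<^sup>2)) * exp (- (cosh (2 * t) / (2 * sinh (2 * t)) * y\<^sup>2))"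
    by (simp add: add_divide_distrib algebra_simps flip: exp_add)
  then show ?thesis
    using assms by (simp add: laguerre_kernel1_def real_sqrt_mult powr_half_sqrt)
qed

text \<open>The k-th integral carries the power (b/2)^2 / q = u, and q x^2 = u cosh^2 = u + u
  sinh^2. Hence the Gaussian in x splits into exp (-u), which normalises the series in
  \<open>laguerre_mass\<close>, and the damping exp (- u sinh^2).\<close>

lemma nn_integral_laguerre_kernel1:
  fixes \<beta> t x :: real
  assumes \<beta>: "0 \<le> \<beta>" and t: "0 < t" and x: "0 < x"
  defines "u \<equiv> x\<^sup>2 / (2 * sinh (2 * t) * cosh (2 * t))"
  shows "(\<integral>\<^sup>+y. ennreal (laguerre_kernel1 (2 * \<beta> - 1 / 2) t x y) * indicator {0<..} y \<partial>lborel)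
    = ennreal (cosh (2 * t) powr (- 1 / 2) * exp (- (u * (sinh (2 * t))\<^sup>2))) * laguerre_mass \<beta> u"
proof -
  define S C a q b where "S = sinh (2 * t)" and "C = cosh (2 * t)" and "a = 2 * \<beta> - 1 / 2"
    and "q = C / (2 * S)" and "b = x / S"
  define K where "K = 1 / S * exp (- (q * x\<^sup>2)) * sqrt x"
  have S: "0 < S" and C: "0 < C" using t by (auto simp: S_def C_def)
  have CS: "C\<^sup>2 = S\<^sup>2 + 1" unfolding C_def S_def by (rule cosh_square_eq)
  have q: "0 < q" and b: "0 < b" and K: "0 \<le> K" using S C x by (auto simp: q_def b_def K_def)
  have a: "- 1 < a" using \<beta> by (simp add: a_def)
  have u: "u = x\<^sup>2 / (2 * S * C)" "0 < u" using x S C by (auto simp: u_def S_def C_def)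
  have qx: "q * x\<^sup>2 = u + u * S\<^sup>2"
  proof -
    have "q * x\<^sup>2 = u * C\<^sup>2" using S C by (simp add: u q_def field_simps power2_eq_square)
    then show ?thesis by (simp add: CS algebra_simps)
  qed
  have bq: "(b / 2)\<^sup>2 / q = u" using S C by (simp add: b_def q_def u field_simps power2_eq_square)
  have k: "laguerre_kernel1 a t x y = K * (y powr (1 / 2) * exp (- (q * y\<^sup>2)) * bessel_I a (b * y))" if "0 < y" for y
    using laguerre_kernel1_factor[OF x that, of a t] by (simp add: K_def q_def b_def S_def C_def)
  have "(\<integral>\<^sup>+y. ennreal (laguerre_kernel1 a t x y) * indicator {0<..} y \<partial>lborel)
    = (\<integral>\<^sup>+y. ennreal K * (ennreal (y powr (1 / 2) * exp (- (q * y\<^sup>2)) * bessel_I a (b * y)) * indicator {0<..} y) \<partial>lborel)"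
    by (intro nn_integral_cong) (auto simp: indicator_def k ennreal_mult'[OF K])
  also have "\<dots> = ennreal K * (\<integral>\<^sup>+y. ennreal (y powr (1 / 2) * exp (- (q * y\<^sup>2)) * bessel_I a (b * y)) * indicator {0<..} y \<partial>lborel)"
    by (rule nn_integral_cmult) simp
  also have "\<dots> = ennreal K * (\<Sum>k. ennreal ((b / 2) powr (2 * real k + a) * rGamma (real k + a + 1) / fact k
        * Gamma (real k + (1 / 2 + a + 1) / 2) / (2 * q powr (real k + (1 / 2 + a + 1) / 2))))"
    using \<beta> by (subst nn_integral_powr_exp_bessel_I[OF a b q]) (auto simp: a_def)
  also have "\<dots> = (\<Sum>k. ennreal K * ennreal ((b / 2) powr (2 * real k + a) * rGamma (real k + a + 1) / fact k
        * Gamma (real k + (1 / 2 + a + 1) / 2) / (2 * q powr (real k + (1 / 2 + a + 1) / 2))))"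
    by (rule ennreal_suminf_cmult[symmetric])
  also have "\<dots> = (\<Sum>k. ennreal (C powr (- 1 / 2) * exp (- (u * S\<^sup>2))) * ennreal (exp (- u) * u powr \<beta> * u ^ k / fact k
     * (Gamma (real k + \<beta> + 1 / 2) * rGamma (real k + 2 * \<beta> + 1 / 2))))"
  proof (rule arg_cong[of _ _ suminf], rule ext)
    fix k :: nat
    have 1: "real k + (1 / 2 + a + 1) / 2 = real k + \<beta> + 1 / 2" "real k + a + 1 = real k + 2 * \<beta> + 1 / 2"
      by (simp_all add: a_def field_simps)
    have 3: "(b / 2) powr (2 * real k + a) = ((b / 2)\<^sup>2) ^ k * ((b / 2)\<^sup>2) powr \<beta> * (b / 2) powr (- 1 / 2)"
    proof -
      have "(b / 2) powr (2 * real k) = ((b / 2) powr 2) powr (real k)" by (simp only: powr_powr)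
      moreover have "(b / 2) powr (2 * \<beta>) = ((b / 2) powr 2) powr \<beta>" by (simp only: powr_powr)
      moreover have "(b / 2) powr 2 = (b / 2)\<^sup>2" using b by simp
      moreover have "(b / 2) powr (2 * real k + a) = (b / 2) powr (2 * real k) * (b / 2) powr (2 * \<beta>) * (b / 2) powr (- 1 / 2)"
      proof -
        have "2 * real k + a = 2 * real k + 2 * \<beta> + - 1 / 2" by (simp add: a_def)
        then show ?thesis by (simp only: powr_add)
      qed
      ultimately show ?thesis using b by (simp add: powr_realpow)
    qed
    have 4: "q powr (real k + \<beta> + 1 / 2) = q ^ k * q powr \<beta> * q powr (1 / 2)"
      using q by (simp add: powr_add powr_realpow)
    \<comment> \<open>The order a = 2\<beta> - 1/2 leaves (b/2)^(-1/2) over; it cancels the sqrt x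
      of the kernel, so that x survives only through u.\<close>
    have 5: "K * (b / 2) powr (- 1 / 2) / (2 * q powr (1 / 2)) = C powr (- 1 / 2) * exp (- (u * S\<^sup>2)) * exp (- u)"
    proof -
      have e1: "sqrt x * (b / 2) powr (- 1 / 2) = sqrt (2 * S)"
        using x S by (simp add: b_def powr_minus powr_half_sqrt real_sqrt_divide real_sqrt_mult field_simps)
      have e2: "q powr (1 / 2) = sqrt C / sqrt (2 * S)"
        using q by (simp add: q_def powr_half_sqrt real_sqrt_divide)
      have e3: "C powr (- 1 / 2) = 1 / sqrt C"
        using C by (simp add: powr_minus powr_half_sqrt field_simps)
      have e4: "exp (- (q * x\<^sup>2)) = exp (- (u * S\<^sup>2)) * exp (- u)" by (simp add: qx flip: exp_add)
      have "K * (b / 2) powr (- 1 / 2) / (2 * q powr (1 / 2))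
        = 1 / S * exp (- (q * x\<^sup>2)) * (sqrt x * (b / 2) powr (- 1 / 2)) / (2 * q powr (1 / 2))"
        by (simp add: K_def)
      also have "\<dots> = exp (- (q * x\<^sup>2)) * (sqrt (2 * S) * sqrt (2 * S)) / (2 * S * sqrt C)"
        unfolding e1 e2 by (simp add: mult.assoc)
      also have "sqrt (2 * S) * sqrt (2 * S) = 2 * S" using S by simp
      finally show ?thesis using S unfolding e3 e4 by simp
    qed
    have 6: "((b / 2)\<^sup>2) ^ k / q ^ k = u ^ k" "((b / 2)\<^sup>2) powr \<beta> / q powr \<beta> = u powr \<beta>"
      using q by (simp add: bq[symmetric] power_divide) (subst bq[symmetric], subst powr_divide, use q in auto)
    let ?G = "Gamma (real k + \<beta> + 1 / 2) * rGamma (real k + 2 * \<beta> + 1 / 2)"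
    have "K * ((b / 2) powr (2 * real k + a) * rGamma (real k + a + 1) / fact k
        * Gamma (real k + (1 / 2 + a + 1) / 2) / (2 * q powr (real k + (1 / 2 + a + 1) / 2)))
      = (K * (b / 2) powr (- 1 / 2) / (2 * q powr (1 / 2))) * (((b / 2)\<^sup>2) ^ k / q ^ k) * (((b / 2)\<^sup>2) powr \<beta> / q powr \<beta>) / fact k * ?G"
      unfolding 1 3 4 by (simp add: mult_ac)
    also have "\<dots> = (C powr (- 1 / 2) * exp (- (u * S\<^sup>2))) * (exp (- u) * u powr \<beta> * u ^ k / fact k * ?G)"
      unfolding 5 6 by (simp add: mult_ac)
    finally show "ennreal K * ennreal ((b / 2) powr (2 * real k + a) * rGamma (real k + a + 1) / fact k
        * Gamma (real k + (1 / 2 + a + 1) / 2) / (2 * q powr (real k + (1 / 2 + a + 1) / 2)))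
      = ennreal (C powr (- 1 / 2) * exp (- (u * S\<^sup>2))) * ennreal (exp (- u) * u powr \<beta> * u ^ k / fact k * ?G)"
      using K by (subst (1 2) ennreal_mult'[symmetric]) simp_all
  qed
  also have "\<dots> = ennreal (C powr (- 1 / 2) * exp (- (u * S\<^sup>2))) * laguerre_mass \<beta> u"
    unfolding laguerre_mass_def by (rule ennreal_suminf_cmult)
  finally show ?thesis by (simp add: a_def C_def S_def)
qed

text \<open>The Gamma quotient is 1 and the Poisson weights exp (-u) u^k / k! sum to 1.\<close>

lemma laguerre_mass_0: "0 < u \<Longrightarrow> laguerre_mass 0 u = 1"
proof -
  assume u: "0 < u"
  have "Gamma (real k + 1 / 2) * rGamma (real k + 1 / 2) = 1" for k
    using rGamma_Gamma[of "real k + 1/2"] by (simp add: mult.commute)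
  then have "exp (- u) * u powr 0 * u ^ k / fact k * (Gamma (real k + 0 + 1 / 2) * rGamma (real k + 2 * 0 + 1 / 2))
    = exp (- u) * u ^ k / fact k" for k
    using u by simp
  then have "laguerre_mass 0 u = ennreal (exp (- u) * exp u)"
    unfolding laguerre_mass_def using u by (simp only: suminf_ennreal_exp exp_ge_zero less_imp_le)
  also have "exp (- u) * exp u = 1" by (simp flip: exp_add)
  finally show ?thesis by simp
qed

text \<open>The Gamma quotient equals B(\<beta>, k + \<beta> + 1/2) / Gamma(\<beta>). Under the Beta
  integral the series in k sums to exp (u (1 - s)), and the prefactor exp (-u) reduces it to exp (-
  u s). The substitution v = u s gives the integral for Phi.\<close>

lemma laguerre_mass_eq_nn_integral:
  assumes \<beta>: "0 < \<beta>" and u: "0 < u"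
  shows "laguerre_mass \<beta> u = (\<integral>\<^sup>+s. ennreal (u powr \<beta> / Gamma \<beta> * (s powr (\<beta> - 1) * exp (- (u * s)) * (1 - s) powr (\<beta> - 1 / 2)))
      * indicator {0<..<1} s \<partial>lborel)"
proof -
  define A where "A = exp (- u) * u powr \<beta> / Gamma \<beta>"
  have A: "0 \<le> A" using \<beta> by (simp add: A_def)
  have "laguerre_mass \<beta> u = (\<Sum>k. \<integral>\<^sup>+s. ennreal (A * (u ^ k / fact k)) *
    (ennreal (s powr (\<beta> - 1) * (1 - s) powr (real k + \<beta> + 1 / 2 - 1)) * indicator {0<..<1} s) \<partial>lborel)"
    unfolding laguerre_mass_def
  proof (rule arg_cong[of _ _ suminf], rule ext)
    fix k :: nat
    have k: "0 < real k + \<beta> + 1 / 2" using \<beta> by simp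
    have "Beta \<beta> (real k + \<beta> + 1 / 2) = Gamma \<beta> * (Gamma (real k + \<beta> + 1 / 2) * rGamma (real k + 2 * \<beta> + 1 / 2))"
      by (simp add: Beta_altdef algebra_simps)
    then have "Gamma (real k + \<beta> + 1 / 2) * rGamma (real k + 2 * \<beta> + 1 / 2) = Beta \<beta> (real k + \<beta> + 1 / 2) / Gamma \<beta>"
      using Gamma_real_pos[OF \<beta>] by simp
    then have "ennreal (exp (- u) * u powr \<beta> * u ^ k / fact k * (Gamma (real k + \<beta> + 1 / 2) * rGamma (real k + 2 * \<beta> + 1 / 2)))
       = ennreal (A * (u ^ k / fact k)) * ennreal (Beta \<beta> (real k + \<beta> + 1 / 2))"
      using A u mult_nonneg_nonneg[OF A, of "u ^ k / fact k"]
      by (subst ennreal_mult'[symmetric]) (simp, simp add: A_def mult_ac)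
    also have "\<dots> = (\<integral>\<^sup>+s. ennreal (A * (u ^ k / fact k)) *
      (ennreal (s powr (\<beta> - 1) * (1 - s) powr (real k + \<beta> + 1 / 2 - 1)) * indicator {0<..<1} s) \<partial>lborel)"
      by (subst nn_integral_cmult, simp, subst nn_integral_Beta[OF \<beta> k]) simp
    finally show "ennreal (exp (- u) * u powr \<beta> * u ^ k / fact k * (Gamma (real k + \<beta> + 1 / 2) * rGamma (real k + 2 * \<beta> + 1 / 2))) = \<dots>" .
  qed
  also have "\<dots> = (\<integral>\<^sup>+s. (\<Sum>k. ennreal (A * (u ^ k / fact k)) *
    (ennreal (s powr (\<beta> - 1) * (1 - s) powr (real k + \<beta> + 1 / 2 - 1)) * indicator {0<..<1} s)) \<partial>lborel)"
    by (rule nn_integral_suminf[symmetric]) simp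
  also have "\<dots> = (\<integral>\<^sup>+s. ennreal (u powr \<beta> / Gamma \<beta> * (s powr (\<beta> - 1) * exp (- (u * s)) * (1 - s) powr (\<beta> - 1 / 2)))
      * indicator {0<..<1} s \<partial>lborel)"
  proof (rule nn_integral_cong)
    fix s :: real
    show "(\<Sum>k. ennreal (A * (u ^ k / fact k)) *
      (ennreal (s powr (\<beta> - 1) * (1 - s) powr (real k + \<beta> + 1 / 2 - 1)) * indicator {0<..<1} s))
      = ennreal (u powr \<beta> / Gamma \<beta> * (s powr (\<beta> - 1) * exp (- (u * s)) * (1 - s) powr (\<beta> - 1 / 2))) * indicator {0<..<1} s"
    proof (cases "s \<in> {0<..<1}")
      case True
      let ?B = "A * (s powr (\<beta> - 1) * (1 - s) powr (\<beta> - 1 / 2))"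
      have "(\<Sum>k. ennreal (A * (u ^ k / fact k)) * ennreal (s powr (\<beta> - 1) * (1 - s) powr (real k + \<beta> + 1 / 2 - 1)))
        = (\<Sum>k. ennreal (?B * (u * (1 - s)) ^ k / fact k))"
      proof (rule arg_cong[of _ _ suminf], rule ext)
        fix k :: nat
        have "(1 - s) powr (real k + \<beta> + 1 / 2 - 1) = (1 - s) ^ k * (1 - s) powr (\<beta> - 1 / 2)"
          using True by (simp add: powr_realpow[symmetric] algebra_simps flip: powr_add)
        then show "ennreal (A * (u ^ k / fact k)) * ennreal (s powr (\<beta> - 1) * (1 - s) powr (real k + \<beta> + 1 / 2 - 1))
          = ennreal (?B * (u * (1 - s)) ^ k / fact k)"
          using A u by (subst ennreal_mult'[symmetric]) (simp_all add: power_mult_distrib mult_ac)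
      qed
      also have "\<dots> = ennreal (?B * exp (u * (1 - s)))"
        using A True u by (intro suminf_ennreal_exp) auto
      also have "?B * exp (u * (1 - s)) = u powr \<beta> / Gamma \<beta> * (s powr (\<beta> - 1) * exp (- (u * s)) * (1 - s) powr (\<beta> - 1 / 2))"
        by (simp add: A_def right_diff_distrib exp_diff exp_minus field_simps)
      finally show ?thesis using True by simp
    qed simp
  qed
  finally show ?thesis .
qed

section \<open>The mass as an expectation under a gamma law: bounds and asymptotics\<close>

abbreviation gamma_density :: "real \<Rightarrow> real \<Rightarrow> real \<Rightarrow> ennreal" where
  "gamma_density \<beta> u s \<equiv> ennreal (u powr \<beta> / Gamma \<beta> * (s powr (\<beta> - 1) * exp (- (u * s)))) * indicator {0<..} s"

text \<open>The gamma law of shape \<beta> and rate u has mass 1 (n = 0) and mean \<beta>/u, so it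
  concentrates at s = 0 as u grows. The moments n = 1, 2 give the first-order term of the mass and
  its error.\<close>

lemma nn_integral_gamma_moment:
  fixes \<beta> u :: real
  assumes \<beta>: "0 < \<beta>" and u: "0 < u"
  shows "(\<integral>\<^sup>+s. gamma_density \<beta> u s * ennreal (s ^ n) \<partial>lborel)
    = ennreal (pochhammer \<beta> n / u ^ n)"
proof -
  have c: "0 \<le> u powr \<beta> / Gamma \<beta>" using \<beta> by simp
  have b: "0 < \<beta> + real n" using \<beta> by simp
  have "(\<integral>\<^sup>+s. gamma_density \<beta> u s * ennreal (s ^ n) \<partial>lborel)
    = (\<integral>\<^sup>+s. ennreal (u powr \<beta> / Gamma \<beta>) * (ennreal (s powr (\<beta> + real n - 1) * exp (- (u * s))) * indicator {0<..} s) \<partial>lborel)"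
  proof (rule nn_integral_cong)
    fix s :: real
    show "gamma_density \<beta> u s * ennreal (s ^ n)
      = ennreal (u powr \<beta> / Gamma \<beta>) * (ennreal (s powr (\<beta> + real n - 1) * exp (- (u * s))) * indicator {0<..} s)"
    proof (cases "0 < s")
      case True
      have "s powr (\<beta> + real n - 1) = s powr (\<beta> - 1) * s ^ n"
        using True by (simp add: powr_realpow[symmetric] algebra_simps flip: powr_add)
      then have e: "u powr \<beta> / Gamma \<beta> * (s powr (\<beta> - 1) * exp (- (u * s))) * s ^ n
        = u powr \<beta> / Gamma \<beta> * (s powr (\<beta> + real n - 1) * exp (- (u * s)))" by simp
      have "ennreal (u powr \<beta> / Gamma \<beta> * (s powr (\<beta> - 1) * exp (- (u * s)))) * ennreal (s ^ n)
        = ennreal (u powr \<beta> / Gamma \<beta>) * ennreal (s powr (\<beta> + real n - 1) * exp (- (u * s)))"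
        unfolding ennreal_mult'[OF c, symmetric] e[symmetric]
        using True by (intro ennreal_mult''[symmetric]) simp
      then show ?thesis using True by simp
    qed simp
  qed
  also have "\<dots> = ennreal (u powr \<beta> / Gamma \<beta>) * ennreal (Gamma (\<beta> + real n) / u powr (\<beta> + real n))"
    by (subst nn_integral_cmult, simp, subst nn_integral_powr_exp[OF b u]) simp
  also have "\<dots> = ennreal (u powr \<beta> / Gamma \<beta> * (Gamma (\<beta> + real n) / u powr (\<beta> + real n)))"
    using c by (rule ennreal_mult'[symmetric])
  also have "u powr \<beta> / Gamma \<beta> * (Gamma (\<beta> + real n) / u powr (\<beta> + real n)) = pochhammer \<beta> n / u ^ n"
  proof -
    have "u powr (\<beta> + real n) = u powr \<beta> * u ^ n" using u by (simp add: powr_add powr_realpow)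
    moreover have "pochhammer \<beta> n = Gamma (\<beta> + real n) / Gamma \<beta>"
      using \<beta> by (intro pochhammer_Gamma) (auto elim!: nonpos_Ints_cases)
    ultimately show ?thesis using u by simp
  qed
  finally show ?thesis .
qed

lemma laguerre_mass_eq_nn_integral':
  assumes "0 < \<beta>" and "0 < u"
  shows "laguerre_mass \<beta> u = (\<integral>\<^sup>+s. gamma_density \<beta> u s
      * ennreal (indicator {..<1} s * (1 - s) powr (\<beta> - 1 / 2)) \<partial>lborel)"
  unfolding laguerre_mass_eq_nn_integral[OF assms]
proof (rule nn_integral_cong)
  fix s :: real
  have "ennreal (u powr \<beta> / Gamma \<beta> * (s powr (\<beta> - 1) * exp (- (u * s)) * (1 - s) powr (\<beta> - 1 / 2)))
    = ennreal (u powr \<beta> / Gamma \<beta> * (s powr (\<beta> - 1) * exp (- (u * s)))) * ennreal ((1 - s) powr (\<beta> - 1 / 2))"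
    by (subst ennreal_mult''[symmetric]) (simp_all add: mult_ac)
  then show "ennreal (u powr \<beta> / Gamma \<beta> * (s powr (\<beta> - 1) * exp (- (u * s)) * (1 - s) powr (\<beta> - 1 / 2))) * indicator {0<..<1} s
    = gamma_density \<beta> u s
      * ennreal (indicator {..<1} s * (1 - s) powr (\<beta> - 1 / 2))"
    by (simp add: indicator_def)
qed

lemma laguerre_mass_le_1:
  assumes \<beta>: "1 / 2 \<le> \<beta>" and u: "0 < u"
  shows "laguerre_mass \<beta> u \<le> 1"
proof -
  have b: "0 < \<beta>" using \<beta> by simp
  have "laguerre_mass \<beta> u \<le> (\<integral>\<^sup>+s. gamma_density \<beta> u s
      * ennreal (s ^ 0) \<partial>lborel)"
    unfolding laguerre_mass_eq_nn_integral'[OF b u]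
  proof (intro nn_integral_mono)
    fix s :: real
    have "indicator {..<1} s * (1 - s) powr (\<beta> - 1 / 2) \<le> s ^ 0" if "0 < s"
      using that \<beta> by (auto simp: indicator_def intro!: powr_le1)
    then have "0 < s \<Longrightarrow> ennreal (indicator {..<1} s * (1 - s) powr (\<beta> - 1 / 2)) \<le> ennreal (s ^ 0)"
      by (intro ennreal_leI)
    then show "gamma_density \<beta> u s
      * ennreal (indicator {..<1} s * (1 - s) powr (\<beta> - 1 / 2))
      \<le> gamma_density \<beta> u s * ennreal (s ^ 0)"
      by (cases "0 < s") (intro mult_left_mono, simp_all)
  qed
  also have "\<dots> = 1" by (subst nn_integral_gamma_moment[OF b u]) simp
  finally show ?thesis .
qed

text \<open>Only 0 < \<beta> < 1/2 needs an argument: there (1 - s)^(\<beta>-1/2) is unbounded at s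
  = 1, but integrable.\<close>

lemma laguerre_mass_bounded:
  assumes \<beta>: "0 \<le> \<beta>"
  obtains B where "1 \<le> B" "\<And>u. 0 < u \<Longrightarrow> laguerre_mass \<beta> u \<le> ennreal B"
proof -
  consider "\<beta> = 0" | "0 < \<beta>" "\<beta> < 1 / 2" | "1 / 2 \<le> \<beta>" using \<beta> by linarith
  then show thesis
  proof cases
    case 1
    then show thesis using that[of 1] by (simp add: laguerre_mass_0)
  next
    case 3
    then show thesis using that[of 1] by (simp add: laguerre_mass_le_1)
  next
    case 2
    \<comment> \<open>Split at s = 1/2. To the left the singular factor is at most 2 and the gamma
      law has mass 1. To the right the gamma density is at most 4 / Gamma(\<beta>), from
      s^(\<beta>-1) \<le> 2 and u^\<beta> exp (- u s) \<le> 2, and the singular factor integrates to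
      at most \<open>Beta 1 (\<beta> + 1 / 2)\<close>.\<close>
    define B where "B = 2 + 4 / Gamma \<beta> * Beta 1 (\<beta> + 1 / 2)"
    have G: "0 < Gamma \<beta>" using 2 by (simp add: Gamma_real_pos)
    have Be: "0 \<le> Beta 1 (\<beta> + 1 / 2)" using 2 by (simp add: Beta_def Gamma_real_pos less_imp_le)
    have "laguerre_mass \<beta> u \<le> ennreal B" if u: "0 < u" for u
    proof -
      let ?W = "\<lambda>s. gamma_density \<beta> u s"
      let ?V = "\<lambda>s::real. ennreal (s powr (1 - 1) * (1 - s) powr (\<beta> + 1 / 2 - 1)) * indicator {0<..<1} s"
      have "laguerre_mass \<beta> u \<le> (\<integral>\<^sup>+s. 2 * (?W s * ennreal (s ^ 0)) + ennreal (4 / Gamma \<beta>) * ?V s \<partial>lborel)"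
        unfolding laguerre_mass_eq_nn_integral'[OF 2(1) u]
      proof (intro nn_integral_mono)
        fix s :: real
        consider "s \<le> 0 \<or> 1 \<le> s" | "0 < s" "s \<le> 1 / 2" | "1 / 2 < s" "s < 1" by linarith
        then show "?W s * ennreal (indicator {..<1} s * (1 - s) powr (\<beta> - 1 / 2))
          \<le> 2 * (?W s * ennreal (s ^ 0)) + ennreal (4 / Gamma \<beta>) * ?V s"
        proof cases
          case c: 2
          have "(1 - s) powr (\<beta> - 1 / 2) \<le> (1 / 2) powr (\<beta> - 1 / 2)"
            using c 2 by (intro powr_mono2') auto
          also have "\<dots> \<le> (1 / 2) powr (- 1)" using 2 by (intro powr_mono') auto
          finally have "(1 - s) powr (\<beta> - 1 / 2) \<le> 2" by (simp add: powr_minus)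
          then have "?W s * ennreal (indicator {..<1} s * (1 - s) powr (\<beta> - 1 / 2)) \<le> ?W s * ennreal 2"
            using c by (intro mult_left_mono ennreal_leI) auto
          also have "\<dots> = 2 * (?W s * ennreal (s ^ 0))" by (simp add: mult.commute)
          finally show ?thesis by (rule order_trans) simp
        next
          case c: 3
          have "s powr (\<beta> - 1) \<le> (1 / 2) powr (\<beta> - 1)" using c 2 by (intro powr_mono2') auto
          also have "\<dots> \<le> (1 / 2) powr (- 1)" using 2 by (intro powr_mono') auto
          finally have s1: "s powr (\<beta> - 1) \<le> 2" by (simp add: powr_minus)
          \<comment> \<open>The growth of u^\<beta> is traded for exp (u/2), which exp (- u s)
            absorbs because s > 1/2.\<close>
          have "u powr \<beta> \<le> (1 + u) powr \<beta>" using u 2 by (intro powr_mono2) auto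
          also have "\<dots> \<le> (1 + u) powr 1" using u 2 by (intro powr_mono) auto
          also have "\<dots> \<le> 2 * (1 + u / 2)" using u by simp
          also have "\<dots> \<le> 2 * exp (u / 2)" by (intro mult_left_mono exp_ge_add_one_self) simp
          finally have s2: "u powr \<beta> \<le> 2 * exp (u / 2)" .
          have "u powr \<beta> * exp (- (u * s)) \<le> 2 * exp (u / 2) * exp (- (u / 2))"
            using c u s2 by (intro mult_mono) auto
          also have "\<dots> = 2" by (simp flip: exp_add)
          finally have s3: "u powr \<beta> * exp (- (u * s)) \<le> 2" .
          have "u powr \<beta> * exp (- (u * s)) * s powr (\<beta> - 1) \<le> 2 * 2"
            using s1 s3 by (intro mult_mono) auto
          then have "u powr \<beta> / Gamma \<beta> * (s powr (\<beta> - 1) * exp (- (u * s))) \<le> 4 / Gamma \<beta>"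
            using G by (simp add: divide_le_cancel mult_ac)
          then have "?W s * ennreal (indicator {..<1} s * (1 - s) powr (\<beta> - 1 / 2)) \<le> ennreal (4 / Gamma \<beta>) * ennreal ((1 - s) powr (\<beta> - 1 / 2))"
            using c by (intro mult_mono) (auto intro!: ennreal_leI)
          also have "\<dots> = ennreal (4 / Gamma \<beta>) * ?V s" using c by simp
          finally show ?thesis by (rule order_trans) simp
        qed auto
      qed
      also have "\<dots> = 2 * (\<integral>\<^sup>+s. ?W s * ennreal (s ^ 0) \<partial>lborel) + ennreal (4 / Gamma \<beta>) * (\<integral>\<^sup>+s. ?V s \<partial>lborel)"
        by (subst nn_integral_add, simp, simp, subst nn_integral_cmult, simp, subst nn_integral_cmult) simp_all
      also have "(\<integral>\<^sup>+s. ?W s * ennreal (s ^ 0) \<partial>lborel) = 1"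
        by (subst nn_integral_gamma_moment[OF 2(1) u]) simp
      also have "(\<integral>\<^sup>+s. ?V s \<partial>lborel) = ennreal (Beta 1 (\<beta> + 1 / 2))"
        using 2 by (intro nn_integral_Beta) auto
      also have "2 * 1 + ennreal (4 / Gamma \<beta>) * ennreal (Beta 1 (\<beta> + 1 / 2)) = ennreal B"
        using G Be by (simp add: B_def ennreal_plus ennreal_mult'[symmetric])
      finally show ?thesis .
    qed
    moreover have "1 \<le> B" using G Be by (simp add: B_def add_increasing2)
    ultimately show thesis using that by blast
  qed
qed

text \<open>Integrating a pointwise bound for the last factor against the gamma density gives the expansion of
  \<open>laguerre_mass \<beta> u\<close> as \<open>u\<close> tends to infinity.\<close>

lemma laguerre_mass_lower:
  assumes \<beta>: "0 < \<beta>" and u: "0 < u" and nn: "0 \<le> c" "0 \<le> d" "0 \<le> e"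
    and le: "\<And>s. 0 < s \<Longrightarrow> 1 + c * s \<le> indicator {..<1} s * (1 - s) powr (\<beta> - 1 / 2) + d * s + e * s\<^sup>2"
  shows "ennreal (1 + c * \<beta> / u) \<le> laguerre_mass \<beta> u + ennreal (d * \<beta> / u + e * (\<beta> * (\<beta> + 1)) / u\<^sup>2)"
proof -
  let ?W = "\<lambda>s. gamma_density \<beta> u s"
  let ?F = "\<lambda>s. ennreal (indicator {..<1} s * (1 - s) powr (\<beta> - 1 / 2))"
  note m = nn_integral_gamma_moment[OF \<beta> u]
  have 1: "(\<integral>\<^sup>+s. ?W s * ennreal (s ^ 1) \<partial>lborel) = ennreal (\<beta> / u)" using m[of 1] by simp
  have 2: "(\<integral>\<^sup>+s. ?W s * ennreal (s ^ 2) \<partial>lborel) = ennreal (\<beta> * (\<beta> + 1) / u\<^sup>2)"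
    using m[of 2] by (simp add: pochhammer_Suc numeral_2_eq_2)
  have "ennreal (1 + c * \<beta> / u) = ennreal (pochhammer \<beta> 0 / u ^ 0) + ennreal c * ennreal (\<beta> / u)"
    using \<beta> u nn by (simp add: ennreal_plus ennreal_mult'[symmetric])
  also have "\<dots> = (\<integral>\<^sup>+s. ?W s * ennreal (s ^ 0) \<partial>lborel) + ennreal c * (\<integral>\<^sup>+s. ?W s * ennreal (s ^ 1) \<partial>lborel)"
    unfolding m[of 0] 1 ..
  also have "\<dots> = (\<integral>\<^sup>+s. ?W s * ennreal (s ^ 0) + ennreal c * (?W s * ennreal (s ^ 1)) \<partial>lborel)"
    by (subst nn_integral_add, simp, simp, subst nn_integral_cmult) simp_all
  \<comment> \<open>The corrections d s and e s^2 are added on the larger side instead of subtracted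
    on the smaller one, since subtraction of extended nonnegative reals truncates at 0.\<close>
  also have "\<dots> \<le> (\<integral>\<^sup>+s. ?W s * ?F s + (ennreal d * (?W s * ennreal (s ^ 1)) + ennreal e * (?W s * ennreal (s ^ 2))) \<partial>lborel)"
  proof (intro nn_integral_mono)
    fix s :: real
    show "?W s * ennreal (s ^ 0) + ennreal c * (?W s * ennreal (s ^ 1))
      \<le> ?W s * ?F s + (ennreal d * (?W s * ennreal (s ^ 1)) + ennreal e * (?W s * ennreal (s ^ 2)))"
    proof (cases "0 < s")
      case True
      define w where "w = ?W s"
      have "w * ennreal (s ^ 0) + ennreal c * (w * ennreal (s ^ 1)) = w * (ennreal 1 + ennreal c * ennreal s)"
        by (simp add: distrib_left mult_ac)
      also have "ennreal 1 + ennreal c * ennreal s = ennreal (1 + c * s)"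
        using nn True by (simp add: ennreal_plus ennreal_mult'[symmetric])
      also have "w * ennreal (1 + c * s) \<le> w * ennreal (indicator {..<1} s * (1 - s) powr (\<beta> - 1 / 2) + d * s + e * s\<^sup>2)"
        using le[OF True] by (intro mult_left_mono ennreal_leI) auto
      also have "ennreal (indicator {..<1} s * (1 - s) powr (\<beta> - 1 / 2) + d * s + e * s\<^sup>2)
        = ?F s + (ennreal d * ennreal s + ennreal e * ennreal (s\<^sup>2))"
        using nn True by (simp add: ennreal_plus ennreal_mult'[symmetric] add.assoc)
      also have "w * \<dots> = w * ?F s + (ennreal d * (w * ennreal (s ^ 1)) + ennreal e * (w * ennreal (s ^ 2)))"
        by (simp add: distrib_left mult_ac)
      finally show ?thesis unfolding w_def .
    qed simp
  qed
  also have "\<dots> = (\<integral>\<^sup>+s. ?W s * ?F s \<partial>lborel) + (ennreal d * (\<integral>\<^sup>+s. ?W s * ennreal (s ^ 1) \<partial>lborel) + ennreal e * (\<integral>\<^sup>+s. ?W s * ennreal (s ^ 2) \<partial>lborel))"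
    by (subst nn_integral_add, measurable, subst nn_integral_add, measurable, subst nn_integral_cmult, measurable, subst nn_integral_cmult, measurable)
  also have "\<dots> = laguerre_mass \<beta> u + ennreal (d * \<beta> / u + e * (\<beta> * (\<beta> + 1)) / u\<^sup>2)"
    unfolding 1 2 laguerre_mass_eq_nn_integral'[OF \<beta> u]
    using nn \<beta> u by (simp add: ennreal_plus ennreal_mult'[symmetric])
  finally show ?thesis .
qed

text \<open>The gamma law concentrates at s = 0, where the factor (1 - s)^(\<beta>-1/2) is 1. A
  linear lower bound 1 - d s for the factor costs only d times the mean, that is d \<beta> /
  u.\<close>

lemma eventually_laguerre_mass_ge:
  assumes \<beta>: "0 \<le> \<beta>" and c: "c < 1"
  shows "eventually (\<lambda>u. ennreal c \<le> laguerre_mass \<beta> u) at_top"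
proof -
  consider "\<beta> = 0" | "0 < \<beta>" using \<beta> by linarith
  then show ?thesis
  proof cases
    case 1
    show ?thesis
      using eventually_gt_at_top[of 0] by eventually_elim (use c in \<open>simp add: 1 laguerre_mass_0 ennreal_le_1\<close>)
  next
    case 2
    \<comment> \<open>For s < 1/2 one has ln (1 - s) \<ge> - 2 s, which accounts for 2 (\<beta> -
      1/2). The lower limit 2 makes 1 - d s nonpositive for s \<ge> 1/2, where no lower bound for
      the factor is at hand.\<close>
    define d where "d = max 2 (2 * (\<beta> - 1 / 2))"
    have le: "1 + 0 * s \<le> indicator {..<1} s * (1 - s) powr (\<beta> - 1 / 2) + d * s + 0 * s\<^sup>2" if s: "0 < s" for s
    proof (cases "s < 1 / 2")
      case True
      have "- (2 * s) \<le> ln (1 - s)"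
      proof -
        have "s * s \<le> s * (1 / 2)" using s True by (intro mult_left_mono) auto
        moreover have "- s - 2 * s\<^sup>2 \<le> ln (1 - s)"
          using s True by (intro ln_one_minus_pos_lower_bound) auto
        ultimately show ?thesis unfolding power2_eq_square by linarith
      qed
      show ?thesis
      proof (cases "\<beta> \<ge> 1 / 2")
        case b: True
        have "1 - d * s \<le> 1 + (\<beta> - 1 / 2) * (- (2 * s))"
          using s mult_right_mono[of "2 * (\<beta> - 1 / 2)" d s] by (simp add: d_def algebra_simps)
        also have "\<dots> \<le> 1 + (\<beta> - 1 / 2) * ln (1 - s)"
          using b \<open>- (2 * s) \<le> ln (1 - s)\<close> by (intro add_left_mono mult_left_mono) auto
        also have "\<dots> \<le> exp ((\<beta> - 1 / 2) * ln (1 - s))" by (rule exp_ge_add_one_self)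
        also have "\<dots> = (1 - s) powr (\<beta> - 1 / 2)" using True by (simp add: powr_def)
        finally show ?thesis using True by simp
      next
        case False
        then have "1 \<le> (1 - s) powr (\<beta> - 1 / 2)"
          using powr_mono'[of "\<beta> - 1/2" 0 "1 - s"] True s by simp
        then show ?thesis using True s by (simp add: d_def add_increasing2)
      qed
    next
      case False
      then have "1 \<le> 2 * s" by simp
      also have "\<dots> \<le> d * s" using s by (simp add: d_def)
      finally show ?thesis by (simp add: add_increasing)
    qed
    have d: "0 \<le> d" by (simp add: d_def)
    have "((\<lambda>u. 1 - d * \<beta> / u) \<longlongrightarrow> 1) at_top"
      by (rule tendsto_eq_intros tendsto_divide_0 tendsto_const filterlim_at_top_imp_at_infinity filterlim_ident refl | simp)+
    then have "eventually (\<lambda>u. c < 1 - d * \<beta> / u) at_top" using c by (rule order_tendstoD)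
    with eventually_gt_at_top[of 0] show ?thesis
    proof eventually_elim
      case (elim u)
      have "ennreal (1 + 0 * \<beta> / u) \<le> laguerre_mass \<beta> u + ennreal (d * \<beta> / u + 0 * (\<beta> * (\<beta> + 1)) / u\<^sup>2)"
        using le by (intro laguerre_mass_lower[OF 2 elim(1)] d) auto
      then have *: "1 \<le> laguerre_mass \<beta> u + ennreal (d * \<beta> / u)" by simp
      show ?case
      proof (cases "laguerre_mass \<beta> u")
        case (real m)
        have "0 \<le> d * \<beta> / u" using d 2 elim by simp
        then have "ennreal 1 \<le> ennreal (m + d * \<beta> / u)" using * real by (simp add: ennreal_plus)
        then have "1 \<le> m + d * \<beta> / u" using real \<open>0 \<le> d * \<beta> / u\<close> by (subst (asm) ennreal_le_iff) auto
        then show ?thesis using real elim by (auto intro: ennreal_leI)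
      qed simp
    qed
  qed
qed

text \<open>With c = 1/2 - \<beta> > 0 the factor is (1 - s)^(-c) \<ge> 1 + c s, a gain of c \<beta>
  / u in the mean. Cutting off at s = 1 loses O(1/u^2). Half of the gain pays for this loss once u
  is large, hence the 2 u in the denominator.\<close>

lemma eventually_laguerre_mass_gt_1:
  assumes \<beta>: "0 < \<beta>" "\<beta> < 1 / 2"
  shows "eventually (\<lambda>u. ennreal (1 + \<beta> * (1 / 2 - \<beta>) / (2 * u)) \<le> laguerre_mass \<beta> u) at_top"
proof -
  define c where "c = 1 / 2 - \<beta>"
  have c: "0 < c" using \<beta> by (simp add: c_def)
  \<comment> \<open>The coefficient 1 + c lets the quadratic term alone dominate 1 + c s for s \<ge>
    1, where the indicator vanishes.\<close>
  have le: "1 + c * s \<le> indicator {..<1} s * (1 - s) powr (\<beta> - 1 / 2) + 0 * s + (1 + c) * s\<^sup>2" if s: "0 < s" for s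
  proof (cases "s < 1")
    case True
    have "1 + c * s \<le> 1 + (\<beta> - 1 / 2) * ln (1 - s)"
      using ln_le_minus_one[of "1 - s"] True c mult_left_mono[of s "- ln (1 - s)" c] by (simp add: c_def algebra_simps)
    also have "\<dots> \<le> exp ((\<beta> - 1 / 2) * ln (1 - s))" by (rule exp_ge_add_one_self)
    also have "\<dots> = (1 - s) powr (\<beta> - 1 / 2)" using True by (simp add: powr_def)
    finally show ?thesis using True c by (simp add: add_increasing2)
  next
    case False
    then have "1 \<le> s" by simp
    then have "1 \<le> s\<^sup>2" "s \<le> s\<^sup>2"
      using mult_left_mono[of 1 s s] one_le_power[of s 2] by (auto simp: power2_eq_square)
    then have "1 + c * s \<le> s\<^sup>2 + c * s\<^sup>2" using c by (intro add_mono mult_left_mono) auto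
    then show ?thesis using False by (simp add: algebra_simps)
  qed
  have "((\<lambda>u. c * \<beta> / 2 - (1 + c) * (\<beta> * (\<beta> + 1)) / u) \<longlongrightarrow> c * \<beta> / 2) at_top"
    by (rule tendsto_eq_intros tendsto_divide_0 tendsto_const filterlim_at_top_imp_at_infinity filterlim_ident refl | simp)+
  then have "eventually (\<lambda>u. 0 < c * \<beta> / 2 - (1 + c) * (\<beta> * (\<beta> + 1)) / u) at_top"
    by (rule order_tendstoD) (use c \<beta> in simp)
  with eventually_gt_at_top[of 0] show ?thesis
  proof eventually_elim
    case (elim u)
    let ?r = "(1 + c) * (\<beta> * (\<beta> + 1)) / u\<^sup>2"
    have "ennreal (1 + c * \<beta> / u) \<le> laguerre_mass \<beta> u + ennreal (0 * \<beta> / u + ?r)"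
      using le c by (intro laguerre_mass_lower[OF \<beta>(1) elim(1)]) auto
    then have *: "ennreal (1 + c * \<beta> / u) \<le> laguerre_mass \<beta> u + ennreal ?r" by simp
    have "0 < (c * \<beta> / 2 - (1 + c) * (\<beta> * (\<beta> + 1)) / u) / u" using elim by (intro divide_pos_pos) auto
    also have "\<dots> = c * \<beta> / u - \<beta> * c / (2 * u) - ?r"
      using elim by (simp add: field_simps power2_eq_square)
    finally have r: "0 < c * \<beta> / u - \<beta> * c / (2 * u) - ?r" .
    show ?case
    proof (cases "laguerre_mass \<beta> u")
      case (real m)
      have r0: "0 \<le> ?r" using c \<beta> by simp
      then have "ennreal (1 + c * \<beta> / u) \<le> ennreal (m + ?r)" using * real by (simp add: ennreal_plus)
      then have "1 + c * \<beta> / u \<le> m + ?r" using real r0 by (subst (asm) ennreal_le_iff) auto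
      moreover have "1 + A \<le> m + R \<Longrightarrow> 0 < A - B - R \<Longrightarrow> 1 + B \<le> m" for A B R :: real by linarith
      ultimately have "1 + \<beta> * c / (2 * u) \<le> m" using r by blast
      then show ?thesis using real by (auto simp: c_def intro: ennreal_leI)
    qed simp
  qed
qed

section \<open>Semigroup law and concentration in dimension one\<close>

text \<open>One of the series is read as an integral over counting measure, so this is monotone
  convergence.\<close>

lemma suminf_ennreal_swap:
  fixes f :: "nat \<Rightarrow> nat \<Rightarrow> ennreal"
  shows "(\<Sum>i. \<Sum>j. f i j) = (\<Sum>j. \<Sum>i. f i j)"
proof -
  have "(\<Sum>i. \<Sum>j. f i j) = (\<Sum>i. \<integral>\<^sup>+j. f i j \<partial>count_space UNIV)"
    by (simp add: nn_integral_count_space_nat)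
  also have "\<dots> = (\<integral>\<^sup>+j. (\<Sum>i. f i j) \<partial>count_space UNIV)"
    by (rule nn_integral_suminf[symmetric]) simp
  finally show ?thesis by (simp add: nn_integral_count_space_nat)
qed

lemma suminf_ennreal_shift:
  fixes f :: "nat \<Rightarrow> ennreal"
  shows "(\<Sum>j. if m \<le> j then f (j - m) else 0) = (\<Sum>j. f j)"
  by (subst suminf_offset[where i = m]) (simp_all add: summableI)

text \<open>After multiplication by Gamma(j + a + 1) the summands are binomials: k over m times j +
  a over j - m, divided by k!. Vandermonde's identity sums them to j + k + a over j. The restriction
  m \<le> k is automatic, as k over m vanishes otherwise.\<close>

lemma Gamma_Vandermonde:
  fixes a :: real
  assumes a: "- 1 < a"
  shows "(\<Sum>m\<le>j. if m \<le> k then rGamma (real m + a + 1) / (fact m * fact (j - m) * fact (k - m)) else 0)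
    = Gamma (real j + real k + a + 1) * rGamma (real j + a + 1) * rGamma (real k + a + 1) / (fact j * fact k)"
proof -
  have nz: "x \<notin> \<int>\<^sub>\<le>\<^sub>0" if "0 < x" for x :: real
    using that by (auto elim!: nonpos_Ints_cases)
  have pos: "0 < real n + a + 1" for n using a by simp
  have g1: "(real j + a) gchoose (j - m) = Gamma (real j + a + 1) * rGamma (real m + a + 1) / fact (j - m)" if "m \<le> j" for m
  proof -
    have eq: "real j + a - real (j - m) + 1 = real m + a + 1" using that by (simp add: of_nat_diff)
    show ?thesis
      using gbinomial_Gamma[OF nz[OF pos[of j]], of "j - m"] unfolding eq
      by (simp add: rGamma_inverse_Gamma divide_inverse mult_ac)
  qed
  have g2: "(real k + (real j + a)) gchoose j = Gamma (real j + real k + a + 1) * rGamma (real k + a + 1) / fact j"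
  proof -
    have eq: "real k + (real j + a) = real (k + j) + a" "real (k + j) + a - real j + 1 = real k + a + 1"
      "real (k + j) + a + 1 = real j + real k + a + 1" by simp_all
    show ?thesis
      using gbinomial_Gamma[OF nz[OF pos[of "k + j"]], of j] unfolding eq
      by (simp add: rGamma_inverse_Gamma divide_inverse mult_ac)
  qed
  have g3: "real k gchoose m = (if m \<le> k then fact k / (fact m * fact (k - m)) else 0)" for m
    by (simp add: binomial_gbinomial[symmetric] binomial_fact)
  have "Gamma (real j + a + 1) * (\<Sum>m\<le>j. if m \<le> k then rGamma (real m + a + 1) / (fact m * fact (j - m) * fact (k - m)) else 0)
    = (\<Sum>m\<le>j. (real k gchoose m) * ((real j + a) gchoose (j - m))) / fact k"
    unfolding sum_distrib_left sum_divide_distrib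
    by (intro sum.cong refl) (simp add: g1 g3)
  also have "(\<Sum>m\<le>j. (real k gchoose m) * ((real j + a) gchoose (j - m))) = (real k + (real j + a)) gchoose j"
    using gbinomial_Vandermonde[of "real k" "real j + a" j] by (simp add: atLeast0AtMost)
  also have "\<dots> / fact k = Gamma (real j + a + 1) * (Gamma (real j + real k + a + 1) * rGamma (real j + a + 1) * rGamma (real k + a + 1) / (fact j * fact k))"
    unfolding g2 using rGamma_Gamma[OF pos[of j]] by (simp add: mult_ac) 
  finally show ?thesis
    using Gamma_real_pos[OF pos[of j]] by (simp only: mult_cancel_left) (auto simp del: Gamma_real_pos)
qed

text \<open>Weber's second exponential integral. Expanding both Bessel functions, the coefficient comparison with
  the product of \<open>exp\<close> and a Bessel series is the Vandermonde convolution.\<close>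

lemma nn_integral_Weber2:
  fixes a b c q :: real
  assumes a: "- 1 < a" and b: "0 < b" and c: "0 < c" and q: "0 < q"
  shows "(\<integral>\<^sup>+y. ennreal (y * exp (- (q * y\<^sup>2)) * bessel_I a (b * y) * bessel_I a (c * y)) * indicator {0<..} y \<partial>lborel)
    = ennreal (1 / (2 * q) * exp ((b\<^sup>2 + c\<^sup>2) / (4 * q)) * bessel_I a (b * c / (2 * q)))"
proof -
  define u v D where "u = b\<^sup>2 / (4 * q)" and "v = c\<^sup>2 / (4 * q)" and "D = (b * c / (4 * q)) powr a / (2 * q)"
  have u: "0 \<le> u" and v: "0 \<le> v" and D: "0 \<le> D" using q by (auto simp: u_def v_def D_def)
  let ?t = "\<lambda>b j. (b / 2) powr (2 * real j + a) * rGamma (real j + a + 1) / fact j"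
  have t: "0 \<le> ?t b j" for b and j :: nat by (rule bessel_I_term_nonneg[OF a])
  let ?r = "\<lambda>m::nat. rGamma (real m + a + 1)"
  have r: "0 \<le> ?r m" for m using a by (intro rGamma_nonneg) simp
  \<comment> \<open>j and k index the two Bessel series under the integral. Their (j, k) integral is
    D u^j v^k times the right-hand side of \<open>Gamma_Vandermonde\<close>, whose left-hand side
    introduces m. Then m indexes the Bessel series of the result, and j - m, k - m the series of exp
    u and exp v.\<close>
  define h where "h = (\<lambda>j m k. if m \<le> j then if m \<le> k then ennreal (D * (u ^ m * v ^ m * ?r m / fact m)) * (ennreal (u ^ (j - m) / fact (j - m)) * ennreal (v ^ (k - m) / fact (k - m))) else 0 else 0)"
  have "(\<integral>\<^sup>+y. ennreal (y * exp (- (q * y\<^sup>2)) * bessel_I a (b * y) * bessel_I a (c * y)) * indicator {0<..} y \<partial>lborel)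
    = (\<integral>\<^sup>+y. (\<Sum>j. ennreal (?t b j) * (ennreal (y powr (2 * real j + a + 1) * exp (- (q * y\<^sup>2)) * bessel_I a (c * y)) * indicator {0<..} y)) \<partial>lborel)"
  proof (rule nn_integral_cong)
    fix y :: real
    show "ennreal (y * exp (- (q * y\<^sup>2)) * bessel_I a (b * y) * bessel_I a (c * y)) * indicator {0<..} y
      = (\<Sum>j. ennreal (?t b j) * (ennreal (y powr (2 * real j + a + 1) * exp (- (q * y\<^sup>2)) * bessel_I a (c * y)) * indicator {0<..} y))"
    proof (cases "0 < y")
      case True
      let ?E = "y * exp (- (q * y\<^sup>2)) * bessel_I a (c * y)"
      have E: "0 \<le> ?E" using True by (simp add: bessel_I_nonneg[OF a])
      have "y * exp (- (q * y\<^sup>2)) * bessel_I a (b * y) * bessel_I a (c * y) = ?E * bessel_I a (b * y)"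
        by (simp only: mult_ac)
      then have "ennreal (y * exp (- (q * y\<^sup>2)) * bessel_I a (b * y) * bessel_I a (c * y)) = ennreal ?E * (\<Sum>j. ennreal (?t (b * y) j))"
        by (simp only: ennreal_mult'[OF E] ennreal_bessel_I[OF a])
      also have "\<dots> = (\<Sum>j. ennreal ?E * ennreal (?t (b * y) j))" by (rule ennreal_suminf_cmult[symmetric])
      also have "\<dots> = (\<Sum>j. ennreal (?t b j) * ennreal (y powr (2 * real j + a + 1) * exp (- (q * y\<^sup>2)) * bessel_I a (c * y)))"
      proof (rule arg_cong[of _ _ suminf], rule ext)
        fix j :: nat
        have "(b * y / 2) powr (2 * real j + a) = (b / 2) powr (2 * real j + a) * y powr (2 * real j + a)"
          using b True by (simp flip: powr_mult)
        moreover have "y powr (2 * real j + a + 1) = y powr (2 * real j + a) * y"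
          using True by (simp add: powr_add)
        ultimately have "?E * ?t (b * y) j = ?t b j * (y powr (2 * real j + a + 1) * exp (- (q * y\<^sup>2)) * bessel_I a (c * y))"
          by (simp add: mult_ac)
        then show "ennreal ?E * ennreal (?t (b * y) j) = ennreal (?t b j) * ennreal (y powr (2 * real j + a + 1) * exp (- (q * y\<^sup>2)) * bessel_I a (c * y))"
          by (simp only: ennreal_mult'[OF E, symmetric] ennreal_mult'[OF t, symmetric])
      qed
      finally show ?thesis using True by simp
    qed simp
  qed
  also have "\<dots> = (\<Sum>j. \<integral>\<^sup>+y. ennreal (?t b j) * (ennreal (y powr (2 * real j + a + 1) * exp (- (q * y\<^sup>2)) * bessel_I a (c * y)) * indicator {0<..} y) \<partial>lborel)"
    by (rule nn_integral_suminf) measurable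
  also have "\<dots> = (\<Sum>j. \<Sum>k. \<Sum>m. h j m k)"
  proof (rule arg_cong[of _ _ suminf], rule ext)
    fix j :: nat
    have "(\<integral>\<^sup>+y. ennreal (?t b j) * (ennreal (y powr (2 * real j + a + 1) * exp (- (q * y\<^sup>2)) * bessel_I a (c * y)) * indicator {0<..} y) \<partial>lborel)
      = ennreal (?t b j) * (\<Sum>k. ennreal (?t c k * Gamma (real k + (2 * real j + a + 1 + a + 1) / 2) / (2 * q powr (real k + (2 * real j + a + 1 + a + 1) / 2))))"
      using a by (subst nn_integral_cmult, simp, subst nn_integral_powr_exp_bessel_I[OF a c q]) auto
    also have "\<dots> = (\<Sum>k. ennreal (?t b j) * ennreal (?t c k * Gamma (real k + (2 * real j + a + 1 + a + 1) / 2) / (2 * q powr (real k + (2 * real j + a + 1 + a + 1) / 2))))"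
      by (rule ennreal_suminf_cmult[symmetric])
    also have "\<dots> = (\<Sum>k. \<Sum>m. h j m k)"
    proof (rule arg_cong[of _ _ suminf], rule ext)
      fix k :: nat
      have e: "real k + (2 * real j + a + 1 + a + 1) / 2 = real j + real k + a + 1" by (simp add: field_simps)
      have p: "(x / 2) powr (2 * real n + a) = (x\<^sup>2 / 4) ^ n * (x / 2) powr a" if "0 < x" for x and n :: nat
        using that powr_powr[of "x / 2" 2 "real n"] by (simp add: powr_add powr_realpow power_divide)
      have pq: "q powr (real j + real k + a + 1) = q ^ j * q ^ k * q powr a * q"
        using q by (simp add: powr_add powr_realpow)
      have pD: "(b / 2) powr a * (c / 2) powr a / (2 * (q powr a * q)) = D"
        using b c q powr_mult[of "b / 2" "c / 2" a] powr_divide[of "b / 2 * (c / 2)" q a] by (simp add: D_def)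
      have pu: "(b\<^sup>2 / 4) ^ j / q ^ j = u ^ j" "(c\<^sup>2 / 4) ^ k / q ^ k = v ^ k"
        by (simp_all add: u_def v_def power_divide[symmetric])
      have "?t b j * (?t c k * Gamma (real j + real k + a + 1) / (2 * q powr (real j + real k + a + 1)))
        = ((b / 2) powr a * (c / 2) powr a / (2 * (q powr a * q))) * ((b\<^sup>2 / 4) ^ j / q ^ j) * ((c\<^sup>2 / 4) ^ k / q ^ k)
          * (Gamma (real j + real k + a + 1) * ?r j * ?r k / (fact j * fact k))"
        unfolding p[OF b] p[OF c] pq by (simp add: mult_ac)
      also have "\<dots> = D * (u ^ j * v ^ k) * (\<Sum>m\<le>j. if m \<le> k then ?r m / (fact m * fact (j - m) * fact (k - m)) else 0)"
        unfolding pD pu Gamma_Vandermonde[OF a] by simp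
      also have "\<dots> = (\<Sum>m\<le>j. if m \<le> k then D * (u ^ m * v ^ m * ?r m / fact m) * ((u ^ (j - m) / fact (j - m)) * (v ^ (k - m) / fact (k - m))) else 0)"
        unfolding sum_distrib_left
      proof (intro sum.cong refl)
        fix m assume m: "m \<in> {..j}"
        show "D * (u ^ j * v ^ k) * (if m \<le> k then ?r m / (fact m * fact (j - m) * fact (k - m)) else 0)
          = (if m \<le> k then D * (u ^ m * v ^ m * ?r m / fact m) * ((u ^ (j - m) / fact (j - m)) * (v ^ (k - m) / fact (k - m))) else 0)"
        proof (cases "m \<le> k")
          case True
          have "u ^ j = u ^ m * u ^ (j - m)" "v ^ k = v ^ m * v ^ (k - m)"
            using m True by (simp_all flip: power_add)
          then show ?thesis using True by (simp add: mult_ac)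
        qed simp
      qed
      finally have "ennreal (?t b j) * ennreal (?t c k * Gamma (real j + real k + a + 1) / (2 * q powr (real j + real k + a + 1)))
        = ennreal (\<Sum>m\<le>j. if m \<le> k then D * (u ^ m * v ^ m * ?r m / fact m) * ((u ^ (j - m) / fact (j - m)) * (v ^ (k - m) / fact (k - m))) else 0)"
        by (simp only: ennreal_mult'[OF t, symmetric])
      also have "\<dots> = (\<Sum>m\<le>j. ennreal (if m \<le> k then D * (u ^ m * v ^ m * ?r m / fact m) * ((u ^ (j - m) / fact (j - m)) * (v ^ (k - m) / fact (k - m))) else 0))"
        using D u v r by (intro sum_ennreal[symmetric]) (auto intro!: mult_nonneg_nonneg divide_nonneg_nonneg)
      also have "\<dots> = (\<Sum>m\<le>j. h j m k)"
      proof (intro sum.cong refl)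
        fix m assume m: "m \<in> {..j}"
        have 1: "0 \<le> D * (u ^ m * v ^ m * ?r m / fact m)" using D u v r by simp
        have 2: "0 \<le> u ^ (j - m) / fact (j - m)" using u by simp
        show "ennreal (if m \<le> k then D * (u ^ m * v ^ m * ?r m / fact m) * ((u ^ (j - m) / fact (j - m)) * (v ^ (k - m) / fact (k - m))) else 0) = h j m k"
          using m by (cases "m \<le> k") (simp_all only: h_def ennreal_mult'[OF 1] ennreal_mult'[OF 2] atMost_iff if_True if_False simp_thms ennreal_0)
      qed
      also have "\<dots> = (\<Sum>m. h j m k)"
        by (rule suminf_finite[symmetric]) (auto simp: h_def)
      finally show "ennreal (?t b j) * ennreal (?t c k * Gamma (real k + (2 * real j + a + 1 + a + 1) / 2) / (2 * q powr (real k + (2 * real j + a + 1 + a + 1) / 2)))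
        = (\<Sum>m. h j m k)" unfolding e .
    qed
    finally show "(\<integral>\<^sup>+y. ennreal (?t b j) * (ennreal (y powr (2 * real j + a + 1) * exp (- (q * y\<^sup>2)) * bessel_I a (c * y)) * indicator {0<..} y) \<partial>lborel)
      = (\<Sum>k. \<Sum>m. h j m k)" .
  qed
  also have "\<dots> = (\<Sum>j. \<Sum>m. \<Sum>k. h j m k)"
    by (rule arg_cong[of _ _ suminf], rule ext) (rule suminf_ennreal_swap)
  also have "\<dots> = (\<Sum>m. \<Sum>j. \<Sum>k. h j m k)"
    using suminf_ennreal_swap[of "\<lambda>j m. \<Sum>k. h j m k"] .
  finally have swap: "(\<integral>\<^sup>+y. ennreal (y * exp (- (q * y\<^sup>2)) * bessel_I a (b * y) * bessel_I a (c * y)) * indicator {0<..} y \<partial>lborel)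
    = (\<Sum>m. \<Sum>j. \<Sum>k. h j m k)" .
  \<comment> \<open>With m outermost, the sums over j \<ge> m and k \<ge> m are shifted exponential
    series and separate.\<close>
  have "(\<Sum>m. \<Sum>j. \<Sum>k. h j m k) = (\<Sum>m. ennreal (D * (u ^ m * v ^ m * ?r m / fact m)) * (ennreal (exp u) * ennreal (exp v)))"
  proof (rule arg_cong[of _ _ suminf], rule ext)
    fix m :: nat
    let ?A = "ennreal (D * (u ^ m * v ^ m * ?r m / fact m))"
    have ex: "(\<Sum>k. ennreal (w ^ k / fact k)) = ennreal (exp w)" if "0 \<le> w" for w :: real
      using suminf_ennreal_exp[of 1 w, OF zero_le_one that] by (simp only: mult_1_left)
    have "(\<Sum>k. if m \<le> k then ?A * (ennreal (u ^ (j - m) / fact (j - m)) * ennreal (v ^ (k - m) / fact (k - m))) else 0)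
      = ?A * ennreal (u ^ (j - m) / fact (j - m)) * ennreal (exp v)" for j
    proof -
      have "(\<Sum>k. if m \<le> k then ?A * (ennreal (u ^ (j - m) / fact (j - m)) * ennreal (v ^ (k - m) / fact (k - m))) else 0)
        = (\<Sum>k. ?A * ennreal (u ^ (j - m) / fact (j - m)) * ennreal (v ^ k / fact k))"
        by (subst suminf_ennreal_shift[symmetric, of _ m]) (simp only: mult.assoc)
      also have "\<dots> = ?A * ennreal (u ^ (j - m) / fact (j - m)) * ennreal (exp v)"
        by (simp only: ennreal_suminf_cmult ex[OF v])
      finally show ?thesis .
    qed
    then have "(\<Sum>j. \<Sum>k. h j m k) = (\<Sum>j. if m \<le> j then ?A * ennreal (u ^ (j - m) / fact (j - m)) * ennreal (exp v) else 0)"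
      by (intro arg_cong[of _ _ suminf] ext) (auto simp: h_def)
    also have "\<dots> = (\<Sum>j. (?A * ennreal (exp v)) * ennreal (u ^ j / fact j))"
      by (subst suminf_ennreal_shift[symmetric, of _ m]) (simp only: mult_ac)
    also have "\<dots> = ?A * (ennreal (exp u) * ennreal (exp v))"
      by (simp only: ennreal_suminf_cmult ex[OF u]) (simp only: mult_ac)
    finally show "(\<Sum>j. \<Sum>k. h j m k) = ?A * (ennreal (exp u) * ennreal (exp v))" .
  qed
  also have "\<dots> = (\<Sum>m. ennreal (1 / (2 * q) * exp ((b\<^sup>2 + c\<^sup>2) / (4 * q))) * ennreal (?t (b * c / (2 * q)) m))"
  proof (rule arg_cong[of _ _ suminf], rule ext)
    fix m :: nat
    have w: "0 < b * c / (4 * q)" using b c q by simp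
    have "(b * c / (2 * q) / 2) powr (2 * real m + a) = (u * v) ^ m * (b * c / (4 * q)) powr a"
    proof -
      have "(b * c / (4 * q)) powr (2 * real m) = ((b * c / (4 * q))\<^sup>2) ^ m"
        using w powr_realpow[of "b * c / (4 * q)" "2 * m"] by (simp add: power_mult)
      moreover have "(b * c / (4 * q))\<^sup>2 = u * v" by (simp add: u_def v_def power2_eq_square)
      moreover have "b * c / (2 * q) / 2 = b * c / (4 * q)" by simp
      ultimately show ?thesis by (simp only: powr_add)
    qed
    moreover have "exp u * exp v = exp ((b\<^sup>2 + c\<^sup>2) / (4 * q))"
      by (simp add: u_def v_def add_divide_distrib exp_add)
    ultimately have "D * (u ^ m * v ^ m * ?r m / fact m) * (exp u * exp v) = (1 / (2 * q) * exp ((b\<^sup>2 + c\<^sup>2) / (4 * q))) * ?t (b * c / (2 * q)) m"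
      by (simp add: D_def power_mult_distrib mult_ac)
    moreover have "0 \<le> 1 / (2 * q) * exp ((b\<^sup>2 + c\<^sup>2) / (4 * q))" using q by simp
    moreover have "0 \<le> D * (u ^ m * v ^ m * ?r m / fact m)" using D u v r by simp
    ultimately show "ennreal (D * (u ^ m * v ^ m * ?r m / fact m)) * (ennreal (exp u) * ennreal (exp v))
      = ennreal (1 / (2 * q) * exp ((b\<^sup>2 + c\<^sup>2) / (4 * q))) * ennreal (?t (b * c / (2 * q)) m)"
      by (simp only: ennreal_mult'[symmetric] exp_ge_zero)
  qed
  also have "\<dots> = ennreal (1 / (2 * q) * exp ((b\<^sup>2 + c\<^sup>2) / (4 * q)) * bessel_I a (b * c / (2 * q)))"
    using q by (subst ennreal_suminf_cmult, subst ennreal_mult', simp, subst ennreal_bessel_I[OF a]) simp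
  finally show ?thesis unfolding swap .
qed

text \<open>In y the product of the two kernels is y exp (- (q1 + q2) y^2) times two Bessel factors,
  so \<open>nn_integral_Weber2\<close> applies. The addition theorem gives q1 + q2 = S / (2 S1 S2),
  which produces both the prefactor 1/S and the Bessel argument x z / S.\<close>

lemma laguerre_kernel1_semigroup:
  assumes a: "- 1 < a" and s: "0 < s" and t: "0 < t" and x: "0 < x" and z: "0 < z"
  shows "(\<integral>\<^sup>+y. ennreal (laguerre_kernel1 a s x y) * ennreal (laguerre_kernel1 a t y z) * indicator {0<..} y \<partial>lborel)
    = ennreal (laguerre_kernel1 a (s + t) x z)"
proof -
  define S1 C1 S2 C2 S C where "S1 = sinh (2 * s)" and "C1 = cosh (2 * s)" and "S2 = sinh (2 * t)"
    and "C2 = cosh (2 * t)" and "S = sinh (2 * (s + t))" and "C = cosh (2 * (s + t))"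
  note defs = S1_def C1_def S2_def C2_def S_def C_def
  have pos: "0 < S1" "0 < S2" "0 < S" using s t by (auto simp: defs)
  have S: "S = S1 * C2 + C1 * S2" unfolding defs distrib_left by (rule sinh_add)
  \<comment> \<open>Reading 2t as 2(s+t) - 2s turns the coefficient (S2 - S C1) / (2 S1 S) of x^2 in
    the exponent into - C / (2 S); the next identity does the same for z^2.\<close>
  have S2': "S2 = S * C1 - C * S1"
    using sinh_diff[of "2 * (s + t)" "2 * s"] by (simp add: defs algebra_simps)
  have S1': "S1 = S * C2 - C * S2"
    using sinh_diff[of "2 * (s + t)" "2 * t"] by (simp add: defs algebra_simps)
  define q1 q2 A where "q1 = C1 / (2 * S1)" and "q2 = C2 / (2 * S2)"
    and "A = (1 / S1 * exp (- (q1 * x\<^sup>2)) * sqrt x) * (1 / S2 * exp (- (q2 * z\<^sup>2)) * sqrt z)"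
  have A: "0 \<le> A" using pos x z by (simp add: A_def)
  have q: "q1 + q2 = S / (2 * S1 * S2)" using pos by (simp add: S q1_def q2_def field_simps)
  have q0: "0 < q1 + q2" unfolding q using pos by simp
  have k: "laguerre_kernel1 a s x y * laguerre_kernel1 a t y z
    = A * (y * exp (- ((q1 + q2) * y\<^sup>2)) * bessel_I a (x / S1 * y) * bessel_I a (z / S2 * y))" if y: "0 < y" for y
  proof -
    have "y powr (1 / 2) * y powr (1 / 2) = y" using y by (simp add: powr_half_sqrt)
    moreover have "exp (- (q1 * y\<^sup>2)) * exp (- (q2 * y\<^sup>2)) = exp (- ((q1 + q2) * y\<^sup>2))"
      by (simp add: algebra_simps flip: exp_add)
    moreover have "laguerre_kernel1 a s x y * laguerre_kernel1 a t y z
      = A * ((y powr (1 / 2) * y powr (1 / 2)) * (exp (- (q1 * y\<^sup>2)) * exp (- (q2 * y\<^sup>2))) * bessel_I a (x / S1 * y) * bessel_I a (z / S2 * y))"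
    proof -
      have "laguerre_kernel1 a s x y = 1 / S1 * exp (- (q1 * x\<^sup>2)) * sqrt x * (y powr (1 / 2) * exp (- (q1 * y\<^sup>2)) * bessel_I a (x / S1 * y))"
        unfolding q1_def S1_def C1_def by (rule laguerre_kernel1_factor[OF x y])
      moreover have "laguerre_kernel1 a t y z = 1 / S2 * exp (- (q2 * z\<^sup>2)) * sqrt z * (y powr (1 / 2) * exp (- (q2 * y\<^sup>2)) * bessel_I a (z / S2 * y))"
        unfolding q2_def S2_def C2_def laguerre_kernel1_commute[of a t y z] by (rule laguerre_kernel1_factor[OF z y])
      ultimately show ?thesis by (simp only: A_def mult_ac)
    qed
    ultimately show ?thesis by simp
  qed
  have "(\<integral>\<^sup>+y. ennreal (laguerre_kernel1 a s x y) * ennreal (laguerre_kernel1 a t y z) * indicator {0<..} y \<partial>lborel)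
    = (\<integral>\<^sup>+y. ennreal A * (ennreal (y * exp (- ((q1 + q2) * y\<^sup>2)) * bessel_I a (x / S1 * y) * bessel_I a (z / S2 * y)) * indicator {0<..} y) \<partial>lborel)"
  proof (rule nn_integral_cong)
    fix y :: real
    show "ennreal (laguerre_kernel1 a s x y) * ennreal (laguerre_kernel1 a t y z) * indicator {0<..} y
      = ennreal A * (ennreal (y * exp (- ((q1 + q2) * y\<^sup>2)) * bessel_I a (x / S1 * y) * bessel_I a (z / S2 * y)) * indicator {0<..} y)"
    proof (cases "0 < y")
      case True
      have nn: "0 \<le> laguerre_kernel1 a s x y" by (rule laguerre_kernel1_nonneg) (use a s x True in auto)
      show ?thesis
        using True by (simp only: ennreal_mult'[OF A, symmetric] ennreal_mult'[OF nn, symmetric] k[OF True] mult.assoc[symmetric])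
    qed simp
  qed
  also have "\<dots> = ennreal A * ennreal (1 / (2 * (q1 + q2)) * exp (((x / S1)\<^sup>2 + (z / S2)\<^sup>2) / (4 * (q1 + q2))) * bessel_I a (x / S1 * (z / S2) / (2 * (q1 + q2))))"
    using x z pos by (subst nn_integral_cmult, measurable, subst nn_integral_Weber2[OF a _ _ q0]) auto
  also have "\<dots> = ennreal (A * (1 / (2 * (q1 + q2)) * exp (((x / S1)\<^sup>2 + (z / S2)\<^sup>2) / (4 * (q1 + q2))) * bessel_I a (x / S1 * (z / S2) / (2 * (q1 + q2)))))"
    by (rule ennreal_mult'[OF A, symmetric])
  also have "x / S1 * (z / S2) / (2 * (q1 + q2)) = x * z / S" unfolding q using pos by (simp add: field_simps)
  also have "A * (1 / (2 * (q1 + q2)) * exp (((x / S1)\<^sup>2 + (z / S2)\<^sup>2) / (4 * (q1 + q2))) * bessel_I a (x * z / S))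
    = laguerre_kernel1 a (s + t) x z"
  proof -
    have e1: "(x / S1)\<^sup>2 / (4 * (q1 + q2)) - q1 * x\<^sup>2 = - (C / (2 * S)) * x\<^sup>2"
    proof -
      have "(x / S1)\<^sup>2 / (4 * (q1 + q2)) - q1 * x\<^sup>2 = x\<^sup>2 * (S2 - S * C1) / (2 * S1 * S)"
        unfolding q unfolding q1_def using pos by (simp add: field_simps power2_eq_square)
      also have "S2 - S * C1 = - (C * S1)" using S2' by simp
      finally show ?thesis using pos by (simp add: field_simps)
    qed
    have e2: "(z / S2)\<^sup>2 / (4 * (q1 + q2)) - q2 * z\<^sup>2 = - (C / (2 * S)) * z\<^sup>2"
    proof -
      have "(z / S2)\<^sup>2 / (4 * (q1 + q2)) - q2 * z\<^sup>2 = z\<^sup>2 * (S1 - S * C2) / (2 * S2 * S)"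
        unfolding q unfolding q2_def using pos by (simp add: field_simps power2_eq_square)
      also have "S1 - S * C2 = - (C * S2)" using S1' by simp
      finally show ?thesis using pos by (simp add: field_simps)
    qed
    have "exp (- (q1 * x\<^sup>2)) * exp (- (q2 * z\<^sup>2)) * exp (((x / S1)\<^sup>2 + (z / S2)\<^sup>2) / (4 * (q1 + q2)))
      = exp (((x / S1)\<^sup>2 / (4 * (q1 + q2)) - q1 * x\<^sup>2) + ((z / S2)\<^sup>2 / (4 * (q1 + q2)) - q2 * z\<^sup>2))"
      by (simp add: add_divide_distrib algebra_simps flip: exp_add)
    also have "\<dots> = exp (- (1 / 2) * (C / S) * (x\<^sup>2 + z\<^sup>2))"
      unfolding e1 e2 by (simp add: algebra_simps)
    finally have e: "exp (- (q1 * x\<^sup>2)) * exp (- (q2 * z\<^sup>2)) * exp (((x / S1)\<^sup>2 + (z / S2)\<^sup>2) / (4 * (q1 + q2)))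
      = exp (- (1 / 2) * (C / S) * (x\<^sup>2 + z\<^sup>2))" .
    have r: "sqrt x * sqrt z = sqrt (x * z)" by (simp add: real_sqrt_mult)
    have c: "1 / S1 * (1 / S2) * (1 / (2 * (q1 + q2))) = 1 / S" unfolding q using pos by simp
    have "A * (1 / (2 * (q1 + q2)) * exp (((x / S1)\<^sup>2 + (z / S2)\<^sup>2) / (4 * (q1 + q2))) * bessel_I a (x * z / S))
      = (1 / S1 * (1 / S2) * (1 / (2 * (q1 + q2)))) * (exp (- (q1 * x\<^sup>2)) * exp (- (q2 * z\<^sup>2)) * exp (((x / S1)\<^sup>2 + (z / S2)\<^sup>2) / (4 * (q1 + q2))))
        * ((sqrt x * sqrt z) * bessel_I a (x * z / S))"
      by (simp only: A_def mult_ac)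
    also have "\<dots> = laguerre_kernel1 a (s + t) x z"
      unfolding e r c laguerre_kernel1_def S_def C_def ..
    finally show ?thesis .
  qed
  finally show ?thesis .
qed

text \<open>The operator maps the functions y^(a+1/2) exp (- l y^2) to multiples of such functions,
  and 2 l moves to (S + 2 l C) / (C + 2 l S). For l = 1/2 the parameter is fixed: this is the ground
  state, with factor exp (- t (2 a + 2)). As t tends to 0 the parameter returns to l and the factor
  to 1.\<close>

lemma nn_integral_laguerre_kernel1_gaussian:
  fixes a t x l :: real
  assumes a: "- 1 < a" and t: "0 < t" and x: "0 < x" and l: "0 \<le> l"
  defines "S \<equiv> sinh (2 * t)" and "C \<equiv> cosh (2 * t)"
  shows "(\<integral>\<^sup>+y. ennreal (laguerre_kernel1 a t x y * (y powr (a + 1 / 2) * exp (- (l * y\<^sup>2)))) * indicator {0<..} y \<partial>lborel)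
    = ennreal (x powr (a + 1 / 2) * (C + 2 * l * S) powr (- (a + 1)) * exp (- (x\<^sup>2 / 2 * ((S + 2 * l * C) / (C + 2 * l * S)))))"
proof -
  have S: "0 < S" and C: "0 < C" using t by (auto simp: S_def C_def)
  have CS: "C\<^sup>2 = S\<^sup>2 + 1" unfolding C_def S_def by (rule cosh_square_eq)
  define q b K where "q = C / (2 * S)" and "b = x / S" and "K = 1 / S * exp (- (q * x\<^sup>2)) * sqrt x"
  define R where "R = C + 2 * l * S"
  have R: "0 < R" using C S l by (simp add: R_def add_pos_nonneg)
  have b: "0 < b" and K: "0 \<le> K" using S C x by (auto simp: b_def K_def)
  have ql: "q + l = R / (2 * S)" using S by (simp add: q_def R_def field_simps)
  have ql0: "0 < q + l" unfolding ql using R S by simp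
  have "(\<integral>\<^sup>+y. ennreal (laguerre_kernel1 a t x y * (y powr (a + 1 / 2) * exp (- (l * y\<^sup>2)))) * indicator {0<..} y \<partial>lborel)
    = (\<integral>\<^sup>+y. ennreal K * (ennreal (y powr (a + 1) * exp (- ((q + l) * y\<^sup>2)) * bessel_I a (b * y)) * indicator {0<..} y) \<partial>lborel)"
  proof (rule nn_integral_cong)
    fix y :: real
    show "ennreal (laguerre_kernel1 a t x y * (y powr (a + 1 / 2) * exp (- (l * y\<^sup>2)))) * indicator {0<..} y
      = ennreal K * (ennreal (y powr (a + 1) * exp (- ((q + l) * y\<^sup>2)) * bessel_I a (b * y)) * indicator {0<..} y)"
    proof (cases "0 < y")
      case True
      have "y powr (a + 1) = y powr (1 / 2) * y powr (a + 1 / 2)" by (simp add: add.commute flip: powr_add)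
      have "exp (- ((q + l) * y\<^sup>2)) = exp (- (q * y\<^sup>2)) * exp (- (l * y\<^sup>2))"
        by (simp add: algebra_simps flip: exp_add)
      have "laguerre_kernel1 a t x y * (y powr (a + 1 / 2) * exp (- (l * y\<^sup>2)))
        = K * (y powr (a + 1) * exp (- ((q + l) * y\<^sup>2)) * bessel_I a (b * y))"
      proof -
        have "laguerre_kernel1 a t x y = 1 / S * exp (- (q * x\<^sup>2)) * sqrt x * (y powr (1 / 2) * exp (- (q * y\<^sup>2)) * bessel_I a (b * y))"
          unfolding q_def b_def S_def C_def by (rule laguerre_kernel1_factor[OF x True])
        then show ?thesis by (simp only: K_def \<open>y powr (a + 1) = _\<close> \<open>exp (- ((q + l) * y\<^sup>2)) = _\<close> mult_ac)
      qed
      then show ?thesis using True by (simp only: ennreal_mult'[OF K] mult.assoc)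
    qed simp
  qed
  also have "\<dots> = ennreal K * ennreal ((b / 2) powr a / (2 * (q + l) powr (a + 1)) * exp (b\<^sup>2 / (4 * (q + l))))"
    by (subst nn_integral_cmult, measurable, subst nn_integral_Weber[OF a b ql0]) simp
  also have "\<dots> = ennreal (K * ((b / 2) powr a / (2 * (q + l) powr (a + 1)) * exp (b\<^sup>2 / (4 * (q + l)))))"
    by (rule ennreal_mult'[OF K, symmetric])
  also have "K * ((b / 2) powr a / (2 * (q + l) powr (a + 1)) * exp (b\<^sup>2 / (4 * (q + l))))
    = x powr (a + 1 / 2) * R powr (- (a + 1)) * exp (- (x\<^sup>2 / 2 * ((S + 2 * l * C) / R)))"
  proof -
    have "- (q * x\<^sup>2) + b\<^sup>2 / (4 * (q + l)) = x\<^sup>2 * (1 - C * R) / (2 * S * R)"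
      unfolding ql unfolding q_def b_def using S R by (simp add: field_simps power2_eq_square)
    also have "1 - C * R = - (S * (S + 2 * l * C))"
      using CS by (simp add: R_def algebra_simps power2_eq_square)
    also have "x\<^sup>2 * - (S * (S + 2 * l * C)) / (2 * S * R) = - (x\<^sup>2 / 2 * ((S + 2 * l * C) / R))"
      using S R by (simp add: field_simps)
    finally have e: "exp (- (q * x\<^sup>2)) * exp (b\<^sup>2 / (4 * (q + l))) = exp (- (x\<^sup>2 / 2 * ((S + 2 * l * C) / R)))"
      by (simp flip: exp_add)
    have p1: "(b / 2) powr a = x powr a / (2 * S) powr a"
      using x S by (simp add: b_def powr_divide mult.commute)
    have p2: "(q + l) powr (a + 1) = R powr (a + 1) / ((2 * S) powr a * (2 * S))"
      using R S by (simp add: ql powr_divide powr_add)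
    have p3: "sqrt x * x powr a = x powr (a + 1 / 2)" using x by (simp add: powr_add powr_half_sqrt)
    have "1 / S * sqrt x * ((b / 2) powr a / (2 * (q + l) powr (a + 1))) = (sqrt x * x powr a) / R powr (a + 1)"
      unfolding p1 p2 using S R by (simp add: field_simps)
    also have "\<dots> = x powr (a + 1 / 2) * R powr (- (a + 1))"
      unfolding p3 by (simp only: powr_minus divide_inverse)
    finally have f: "1 / S * sqrt x * ((b / 2) powr a / (2 * (q + l) powr (a + 1))) = x powr (a + 1 / 2) * R powr (- (a + 1))" .
    have "K * ((b / 2) powr a / (2 * (q + l) powr (a + 1)) * exp (b\<^sup>2 / (4 * (q + l))))
      = (1 / S * sqrt x * ((b / 2) powr a / (2 * (q + l) powr (a + 1)))) * (exp (- (q * x\<^sup>2)) * exp (b\<^sup>2 / (4 * (q + l))))"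
      by (simp only: K_def mult_ac)
    then show ?thesis unfolding e f .
  qed
  finally show ?thesis unfolding R_def .
qed

lemma tendsto_gaussian_rhs:
  fixes a x l :: real
  shows "((\<lambda>t. x powr (a + 1 / 2) * (cosh (2 * t) + 2 * l * sinh (2 * t)) powr (- (a + 1))
      * exp (- (x\<^sup>2 / 2 * ((sinh (2 * t) + 2 * l * cosh (2 * t)) / (cosh (2 * t) + 2 * l * sinh (2 * t))))))
    \<longlongrightarrow> x powr (a + 1 / 2) * exp (- (l * x\<^sup>2))) (at_right 0)"
proof -
  have "isCont (\<lambda>t::real. x powr (a + 1 / 2) * (cosh (2 * t) + 2 * l * sinh (2 * t)) powr (- (a + 1))
      * exp (- (x\<^sup>2 / 2 * ((sinh (2 * t) + 2 * l * cosh (2 * t)) / (cosh (2 * t) + 2 * l * sinh (2 * t)))))) 0"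
    by (intro continuous_intros) auto
  then show ?thesis
    by (auto simp: isCont_def mult_ac intro: filterlim_mono[OF _ order_refl at_le])
qed

text \<open>Chebyshev's inequality for the deviation \<open>(exp (- y\<^sup>2) - exp (- x\<^sup>2))\<^sup>2\<close>: after expanding the square, all integrals
  against the weight \<open>y powr (a + 1 / 2)\<close> are explicit.\<close>

lemma laguerre_kernel1_concentration:
  fixes a x r c :: real
  assumes a: "- 1 / 2 \<le> a" and x: "0 < x" and r: "0 < r" and c: "c < 1"
  shows "eventually (\<lambda>t. ennreal c \<le> (\<integral>\<^sup>+y. ennreal (laguerre_kernel1 a t x y) * indicator ({x - r<..<x + r} \<inter> {0<..}) y \<partial>lborel)) (at_right 0)"
proof -
  have a1: "- 1 < a" using a by simp
  define h where "h = (\<lambda>y::real. y powr (a + 1 / 2))"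
  have hx: "0 < h x" using x by (simp add: h_def)
  \<comment> \<open>The explicit integrals carry the weight h, while the claim is unweighted. As a
    \<ge> - 1/2, h is nondecreasing and at most h (x + \<rho>) on the \<rho>-interval; removing it
    costs the factor h x / h (x + \<rho>), and \<rho> is shrunk until this exceeds c.\<close>
  have "isCont (\<lambda>\<rho>. h x / h (x + \<rho>)) 0" unfolding h_def using x by (intro continuous_intros) auto
  then have "((\<lambda>\<rho>. h x / h (x + \<rho>)) \<longlongrightarrow> 1) (at_right 0)"
    using hx by (auto simp: isCont_def intro: filterlim_mono[OF _ order_refl at_le])
  then have "eventually (\<lambda>\<rho>. c < h x / h (x + \<rho>)) (at_right 0)" using c by (rule order_tendstoD)
  moreover have "eventually (\<lambda>\<rho>. \<rho> < min r x) (at_right 0)" using r x by (intro order_tendstoD[OF tendsto_ident_at]) auto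
  moreover have "eventually (\<lambda>\<rho>::real. 0 < \<rho>) (at_right 0)" by (rule eventually_at_right_less)
  ultimately have "eventually (\<lambda>\<rho>. c < h x / h (x + \<rho>) \<and> \<rho> < min r x \<and> 0 < \<rho>) (at_right 0)"
    by eventually_elim auto
  then obtain \<rho> where \<rho>: "c < h x / h (x + \<rho>)" "\<rho> < r" "\<rho> < x" "0 < \<rho>"
    by (auto dest!: eventually_happens)
  define \<psi> where "\<psi> = (\<lambda>y::real. (exp (- y\<^sup>2) - exp (- x\<^sup>2))\<^sup>2)"
  \<comment> \<open>The least value of \<psi> outside the \<rho>-interval. It is attained at an
    endpoint because exp (- y^2) is monotone on y > 0.\<close>
  define \<kappa> where "\<kappa> = min ((exp (- (x - \<rho>)\<^sup>2) - exp (- x\<^sup>2))\<^sup>2) ((exp (- x\<^sup>2) - exp (- (x + \<rho>)\<^sup>2))\<^sup>2)"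
  define E where "E = exp (- x\<^sup>2)"
  have sq: "y\<^sup>2 < z\<^sup>2" if "0 \<le> y" "y < z" for y z :: real using that by (simp add: power_strict_mono)
  have \<kappa>: "0 < \<kappa>" using sq[of "x - \<rho>" x] sq[of x "x + \<rho>"] \<rho> x by (auto simp: \<kappa>_def)
  have \<psi>\<kappa>: "\<kappa> \<le> \<psi> y" if y: "0 < y" "\<not> (x - \<rho> < y \<and> y < x + \<rho>)" for y
  proof -
    consider "y \<le> x - \<rho>" | "x + \<rho> \<le> y" using y by linarith
    then show ?thesis
    proof cases
      case 1
      then have "y\<^sup>2 \<le> (x - \<rho>)\<^sup>2" "(x - \<rho>)\<^sup>2 \<le> x\<^sup>2" using y \<rho> by (auto intro!: power_mono)
      then have "(exp (- (x - \<rho>)\<^sup>2) - exp (- x\<^sup>2))\<^sup>2 \<le> \<psi> y" unfolding \<psi>_def by (intro power_mono) auto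
      then show ?thesis by (simp add: \<kappa>_def)
    next
      case 2
      then have "(x + \<rho>)\<^sup>2 \<le> y\<^sup>2" "x\<^sup>2 \<le> (x + \<rho>)\<^sup>2" using x \<rho> by (auto intro!: power_mono)
      then have "(exp (- x\<^sup>2) - exp (- (x + \<rho>)\<^sup>2))\<^sup>2 \<le> (exp (- x\<^sup>2) - exp (- y\<^sup>2))\<^sup>2" by (intro power_mono) auto
      then show ?thesis by (simp add: \<kappa>_def \<psi>_def power2_commute)
    qed
  qed
  define H where "H = (\<lambda>l t. x powr (a + 1 / 2) * (cosh (2 * t) + 2 * l * sinh (2 * t)) powr (- (a + 1))
      * exp (- (x\<^sup>2 / 2 * ((sinh (2 * t) + 2 * l * cosh (2 * t)) / (cosh (2 * t) + 2 * l * sinh (2 * t))))))"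
  have H0: "0 \<le> H l t" for l t using x by (simp add: H_def)
  have Hlim: "(H l \<longlongrightarrow> h x * exp (- (l * x\<^sup>2))) (at_right 0)" for l
    unfolding H_def h_def by (rule tendsto_gaussian_rhs)
  define P where "P = (\<lambda>t. \<integral>\<^sup>+y. ennreal (laguerre_kernel1 a t x y) * indicator ({x - r<..<x + r} \<inter> {0<..}) y \<partial>lborel)"
  \<comment> \<open>Integrate h y \<le> h (x + \<rho>) J + h y \<psi>(y) / \<kappa>, where J is the
    indicator of the interval, against the kernel. The cross term - 2 E exp (- y^2) of \<psi> is
    negative and therefore appears on the left.\<close>
  have main: "ennreal (H 0 t + 2 * E / \<kappa> * H 1 t) \<le> ennreal (h (x + \<rho>)) * P t + ennreal (H 2 t / \<kappa> + E\<^sup>2 / \<kappa> * H 0 t)"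
    if t: "0 < t" for t
  proof -
    let ?G = "\<lambda>l y. ennreal (laguerre_kernel1 a t x y * (y powr (a + 1 / 2) * exp (- (l * y\<^sup>2)))) * indicator {0<..} y"
    have G: "(\<integral>\<^sup>+y. ?G l y \<partial>lborel) = ennreal (H l t)" if "0 \<le> l" for l
      unfolding H_def by (rule nn_integral_laguerre_kernel1_gaussian[OF a1 t x that])
    have E0: "0 \<le> E" by (simp add: E_def)
    have "ennreal (H 0 t + 2 * E / \<kappa> * H 1 t) = ennreal (H 0 t) + ennreal (2 * E / \<kappa>) * ennreal (H 1 t)"
      using H0 E0 \<kappa> by (simp add: ennreal_plus ennreal_mult'[symmetric])
    also have "\<dots> = (\<integral>\<^sup>+y. ?G 0 y + ennreal (2 * E / \<kappa>) * ?G 1 y \<partial>lborel)"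
      by (subst nn_integral_add, measurable, subst nn_integral_cmult, measurable) (simp only: G zero_le_one order_refl)
    also have "\<dots> \<le> (\<integral>\<^sup>+y. ennreal (h (x + \<rho>)) * (ennreal (laguerre_kernel1 a t x y) * indicator ({x - r<..<x + r} \<inter> {0<..}) y)
        + (ennreal (1 / \<kappa>) * ?G 2 y + ennreal (E\<^sup>2 / \<kappa>) * ?G 0 y) \<partial>lborel)"
    proof (intro nn_integral_mono)
      fix y :: real
      show "?G 0 y + ennreal (2 * E / \<kappa>) * ?G 1 y \<le> ennreal (h (x + \<rho>)) * (ennreal (laguerre_kernel1 a t x y) * indicator ({x - r<..<x + r} \<inter> {0<..}) y)
        + (ennreal (1 / \<kappa>) * ?G 2 y + ennreal (E\<^sup>2 / \<kappa>) * ?G 0 y)"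
      proof (cases "0 < y")
        case True
        define k where "k = laguerre_kernel1 a t x y"
        define J where "J = (indicator {x - r<..<x + r} y :: real)"
        have k: "0 \<le> k" unfolding k_def by (rule laguerre_kernel1_nonneg) (use a1 t x True in auto)
        have hy: "0 \<le> h y" "0 \<le> h (x + \<rho>)" by (auto simp: h_def)
        have J: "0 \<le> J" by (simp add: J_def)
        have J': "ennreal J = indicator ({x - r<..<x + r} \<inter> {0<..}) y" using True by (simp add: J_def indicator_def)
        have \<psi>: "\<psi> y = exp (- (2 * y\<^sup>2)) - 2 * E * exp (- y\<^sup>2) + E\<^sup>2"
          by (simp add: \<psi>_def E_def power2_diff exp_double[symmetric] mult_ac)
        have "h y \<le> h (x + \<rho>) * J + h y * (\<psi> y / \<kappa>)"
        proof (cases "x - \<rho> < y \<and> y < x + \<rho>")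
          case T: True
          then have "h y \<le> h (x + \<rho>)" using a True by (auto simp: h_def intro!: powr_mono2)
          moreover have "J = 1" using T \<rho> by (simp add: J_def)
          moreover have "0 \<le> h y * (\<psi> y / \<kappa>)" using hy \<kappa> by (simp add: \<psi>_def)
          ultimately show ?thesis by simp
        next
          case False
          then have "1 \<le> \<psi> y / \<kappa>" using \<psi>\<kappa>[OF True] \<kappa> by simp
          then have "h y * 1 \<le> h y * (\<psi> y / \<kappa>)" using hy by (intro mult_left_mono) auto
          moreover have "0 \<le> h (x + \<rho>) * J" using hy J by simp
          ultimately show ?thesis by simp
        qed
        then have "k * (h y + 2 * E / \<kappa> * (h y * exp (- y\<^sup>2))) \<le> k * (h (x + \<rho>) * J + (1 / \<kappa> * (h y * exp (- (2 * y\<^sup>2))) + E\<^sup>2 / \<kappa> * h y))"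
          unfolding \<psi> using k by (intro mult_left_mono) (simp_all add: algebra_simps add_divide_distrib diff_divide_distrib)
        then have "k * h y + 2 * E / \<kappa> * (k * (h y * exp (- y\<^sup>2))) \<le> h (x + \<rho>) * (k * J) + (1 / \<kappa> * (k * (h y * exp (- (2 * y\<^sup>2)))) + E\<^sup>2 / \<kappa> * (k * h y))"
          by (simp add: algebra_simps)
        then have "ennreal (k * h y + 2 * E / \<kappa> * (k * (h y * exp (- y\<^sup>2)))) \<le> ennreal (h (x + \<rho>) * (k * J) + (1 / \<kappa> * (k * (h y * exp (- (2 * y\<^sup>2)))) + E\<^sup>2 / \<kappa> * (k * h y)))"
          by (rule ennreal_leI)
        also have "ennreal (k * h y + 2 * E / \<kappa> * (k * (h y * exp (- y\<^sup>2)))) = ?G 0 y + ennreal (2 * E / \<kappa>) * ?G 1 y"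
          using True k hy E0 \<kappa> by (simp add: ennreal_plus ennreal_mult'[symmetric] k_def[symmetric] h_def[symmetric] flip: fun_cong[OF h_def])
        also have "ennreal (h (x + \<rho>) * (k * J) + (1 / \<kappa> * (k * (h y * exp (- (2 * y\<^sup>2)))) + E\<^sup>2 / \<kappa> * (k * h y)))
          = ennreal (h (x + \<rho>)) * (ennreal k * ennreal J) + (ennreal (1 / \<kappa>) * ?G 2 y + ennreal (E\<^sup>2 / \<kappa>) * ?G 0 y)"
          using True k hy E0 J \<kappa> by (simp add: ennreal_plus ennreal_mult'[symmetric] k_def[symmetric] flip: fun_cong[OF h_def])
        finally show ?thesis unfolding k_def J' .
      qed simp
    qed
    also have "\<dots> = ennreal (h (x + \<rho>)) * P t + (ennreal (1 / \<kappa>) * ennreal (H 2 t) + ennreal (E\<^sup>2 / \<kappa>) * ennreal (H 0 t))"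
      unfolding P_def
      by (subst nn_integral_add, measurable, subst nn_integral_add, measurable, subst nn_integral_cmult, measurable,
          subst nn_integral_cmult, measurable, subst nn_integral_cmult, measurable) (simp only: G zero_le_numeral order_refl)
    also have "ennreal (1 / \<kappa>) * ennreal (H 2 t) + ennreal (E\<^sup>2 / \<kappa>) * ennreal (H 0 t) = ennreal (H 2 t / \<kappa> + E\<^sup>2 / \<kappa> * H 0 t)"
      using H0 \<kappa> by (simp add: ennreal_plus ennreal_mult'[symmetric])
    finally show ?thesis .
  qed
  have hp: "0 < h (x + \<rho>)" using x \<rho> by (simp add: h_def)
  \<comment> \<open>In the limit each H l is replaced by h x exp (- l x^2), and the terms with
    \<kappa> add up to a multiple of \<psi>(x) = 0. Only h x / h (x + \<rho>) is left.\<close>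
  define Q where "Q = (\<lambda>t. ((H 0 t + 2 * E / \<kappa> * H 1 t) - (H 2 t / \<kappa> + E\<^sup>2 / \<kappa> * H 0 t)) / h (x + \<rho>))"
  have "(Q \<longlongrightarrow> ((h x * exp (- (0 * x\<^sup>2)) + 2 * E / \<kappa> * (h x * exp (- (1 * x\<^sup>2)))) - (h x * exp (- (2 * x\<^sup>2)) / \<kappa> + E\<^sup>2 / \<kappa> * (h x * exp (- (0 * x\<^sup>2))))) / h (x + \<rho>)) (at_right 0)"
    unfolding Q_def using \<kappa> hp by (intro tendsto_intros Hlim) auto
  also have "((h x * exp (- (0 * x\<^sup>2)) + 2 * E / \<kappa> * (h x * exp (- (1 * x\<^sup>2)))) - (h x * exp (- (2 * x\<^sup>2)) / \<kappa> + E\<^sup>2 / \<kappa> * (h x * exp (- (0 * x\<^sup>2))))) / h (x + \<rho>) = h x / h (x + \<rho>)"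
  proof -
    have "exp (- (2 * x\<^sup>2)) = E\<^sup>2" "exp (- (1 * x\<^sup>2)) = E" by (simp_all add: E_def exp_double[symmetric])
    then show ?thesis by (simp add: power2_eq_square)
  qed
  finally have "eventually (\<lambda>t. c < Q t) (at_right 0)" using \<rho>(1) by (intro order_tendstoD) auto
  with eventually_at_right_less[of 0] have "eventually (\<lambda>t. ennreal c \<le> P t) (at_right 0)"
  proof eventually_elim
    case (elim t)
    show ?case
    proof (cases "P t")
      case (real p)
      have nn: "0 \<le> H 2 t / \<kappa> + E\<^sup>2 / \<kappa> * H 0 t" using H0 \<kappa> by simp
      have "ennreal (H 0 t + 2 * E / \<kappa> * H 1 t) \<le> ennreal (h (x + \<rho>) * p + (H 2 t / \<kappa> + E\<^sup>2 / \<kappa> * H 0 t))"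
        using main[OF elim(1)] real nn hp by (simp only: ennreal_mult'[OF less_imp_le[OF hp]] ennreal_plus[OF mult_nonneg_nonneg[OF less_imp_le[OF hp] real(1)] nn])
      then have "H 0 t + 2 * E / \<kappa> * H 1 t \<le> h (x + \<rho>) * p + (H 2 t / \<kappa> + E\<^sup>2 / \<kappa> * H 0 t)"
        using hp real nn by (subst (asm) ennreal_le_iff) auto
      then have "Q t \<le> p" unfolding Q_def using hp by (simp add: pos_divide_le_eq mult.commute)
      then show ?thesis using elim real by (auto intro!: ennreal_leI)
    qed simp
  qed
  then show ?thesis unfolding P_def .
qed

section \<open>Integral operators with a symmetric kernel\<close>

lemma one_le_ennreal_cases:
  assumes "(1::ennreal) \<le> p"
  obtains "p = \<infinity>" | r where "1 \<le> r" "p = ennreal r"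
  using assms by (cases p) (auto simp flip: ennreal_1)

lemma Lp_norm_infinity:
  "f \<in> borel_measurable M \<Longrightarrow> Lp_norm \<infinity> M f = esssup M (\<lambda>x. ennreal \<bar>f x\<bar>)"
  by (simp add: Lp_norm_def)

lemmas Lp_norm_top = Lp_norm_infinity[unfolded infinity_ennreal_def]

lemma Lp_norm_ennreal:
  assumes "f \<in> borel_measurable M" "1 \<le> r"
  shows "Lp_norm (ennreal r) M f =
    (if (\<integral>\<^sup>+x. ennreal (\<bar>f x\<bar> powr r) \<partial>M) = \<infinity> then \<infinity>
     else ennreal (enn2real (\<integral>\<^sup>+x. ennreal (\<bar>f x\<bar> powr r) \<partial>M) powr (1 / r)))"
  using assms by (simp add: Lp_norm_def)

lemma Lp_space_measurable: "f \<in> Lp_space p M \<Longrightarrow> f \<in> borel_measurable M"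
  by (simp add: Lp_space_def)

lemma Lp_space_ennreal_iff:
  assumes "1 \<le> r"
  shows "f \<in> Lp_space (ennreal r) M \<longleftrightarrow> f \<in> borel_measurable M \<and> (\<integral>\<^sup>+x. ennreal (\<bar>f x\<bar> powr r) \<partial>M) < \<infinity>"
  using assms by (auto simp: Lp_space_def Lp_norm_ennreal less_top split: if_splits)

lemma Lp_space_1_iff:
  "f \<in> Lp_space 1 M \<longleftrightarrow> f \<in> borel_measurable M \<and> (\<integral>\<^sup>+x. ennreal \<bar>f x\<bar> \<partial>M) < \<infinity>"
  using Lp_space_ennreal_iff[of 1 f M] by simp

lemma Lp_space_2_iff:
  "f \<in> Lp_space 2 M \<longleftrightarrow> f \<in> borel_measurable M \<and> (\<integral>\<^sup>+x. ennreal ((f x)\<^sup>2) \<partial>M) < \<infinity>"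
  using Lp_space_ennreal_iff[of 2 f M] by (simp add: power2_eq_square[symmetric])

lemma Lp_space_infinity_iff:
  "f \<in> Lp_space \<infinity> M \<longleftrightarrow> f \<in> borel_measurable M \<and> (\<exists>c\<ge>0. AE x in M. \<bar>f x\<bar> \<le> c)"
proof safe
  assume f: "f \<in> Lp_space \<infinity> M"
  then have m: "f \<in> borel_measurable M" and fin: "esssup M (\<lambda>x. ennreal \<bar>f x\<bar>) < \<infinity>"
    by (auto simp: Lp_space_def Lp_norm_top)
  show "f \<in> borel_measurable M" by fact
  obtain c where c: "0 \<le> c" "esssup M (\<lambda>x. ennreal \<bar>f x\<bar>) = ennreal c"
    using fin by (cases "esssup M (\<lambda>x. ennreal \<bar>f x\<bar>)") auto
  have "AE x in M. ennreal \<bar>f x\<bar> \<le> ennreal c" using esssup_AE[of "\<lambda>x. ennreal \<bar>f x\<bar>" M] by (simp add: c)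
  then have "AE x in M. \<bar>f x\<bar> \<le> c" using c(1) by (auto elim!: eventually_mono)
  then show "\<exists>c\<ge>0. AE x in M. \<bar>f x\<bar> \<le> c" using c by blast
next
  fix c :: real assume m: "f \<in> borel_measurable M" and c: "0 \<le> c" "AE x in M. \<bar>f x\<bar> \<le> c"
  have "esssup M (\<lambda>x. ennreal \<bar>f x\<bar>) \<le> ennreal c"
    using m c by (intro esssup_I) (auto elim!: eventually_mono intro: ennreal_leI)
  also have "\<dots> < \<infinity>" by simp
  finally show "f \<in> Lp_space \<infinity> M" using m by (simp add: Lp_space_def Lp_norm_top)
qed

lemmas Lp_space_top_iff = Lp_space_infinity_iff[unfolded infinity_ennreal_def]

lemma L1_plus_Linf_measurable: "f \<in> L1_plus_Linf M \<Longrightarrow> f \<in> borel_measurable M"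
  by (auto simp: L1_plus_Linf_def dest!: Lp_space_measurable intro!: borel_measurable_add)

lemma Lp_space_1_lincomb:
  assumes "f \<in> Lp_space 1 M" "g \<in> Lp_space 1 M"
  shows "(\<lambda>x. a * f x + b * g x) \<in> Lp_space 1 M"
proof -
  have [measurable]: "f \<in> borel_measurable M" "g \<in> borel_measurable M"
    using assms by (auto simp: Lp_space_1_iff)
  have "(\<integral>\<^sup>+x. ennreal \<bar>a * f x + b * g x\<bar> \<partial>M) \<le> (\<integral>\<^sup>+x. ennreal \<bar>a\<bar> * ennreal \<bar>f x\<bar> + ennreal \<bar>b\<bar> * ennreal \<bar>g x\<bar> \<partial>M)"
  proof (intro nn_integral_mono)
    fix x
    have "\<bar>a * f x + b * g x\<bar> \<le> \<bar>a\<bar> * \<bar>f x\<bar> + \<bar>b\<bar> * \<bar>g x\<bar>"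
      by (rule order_trans[OF abs_triangle_ineq]) (simp add: abs_mult)
    then show "ennreal \<bar>a * f x + b * g x\<bar> \<le> ennreal \<bar>a\<bar> * ennreal \<bar>f x\<bar> + ennreal \<bar>b\<bar> * ennreal \<bar>g x\<bar>"
      by (simp add: ennreal_mult'[symmetric] ennreal_plus[symmetric] ennreal_leI del: ennreal_plus)
  qed
  also have "\<dots> = ennreal \<bar>a\<bar> * (\<integral>\<^sup>+x. ennreal \<bar>f x\<bar> \<partial>M) + ennreal \<bar>b\<bar> * (\<integral>\<^sup>+x. ennreal \<bar>g x\<bar> \<partial>M)"
    by (subst nn_integral_add, measurable, subst nn_integral_cmult, measurable, subst nn_integral_cmult, measurable)
  also have "\<dots> < \<infinity>" using assms by (auto simp: Lp_space_1_iff ennreal_mult_less_top)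
  finally show ?thesis by (simp add: Lp_space_1_iff)
qed

lemma Lp_space_infinity_lincomb:
  assumes "f \<in> Lp_space \<infinity> M" "g \<in> Lp_space \<infinity> M"
  shows "(\<lambda>x. a * f x + b * g x) \<in> Lp_space \<infinity> M"
proof -
  have [measurable]: "f \<in> borel_measurable M" "g \<in> borel_measurable M"
    using assms by (auto simp: Lp_space_top_iff)
  obtain c d where c: "0 \<le> c" "AE x in M. \<bar>f x\<bar> \<le> c" and d: "0 \<le> d" "AE x in M. \<bar>g x\<bar> \<le> d"
    using assms by (auto simp: Lp_space_top_iff)
  have "AE x in M. \<bar>a * f x + b * g x\<bar> \<le> \<bar>a\<bar> * c + \<bar>b\<bar> * d"
    using c(2) d(2)
  proof eventually_elim
    case (elim x)
    have "\<bar>a * f x + b * g x\<bar> \<le> \<bar>a\<bar> * \<bar>f x\<bar> + \<bar>b\<bar> * \<bar>g x\<bar>"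
      by (rule order_trans[OF abs_triangle_ineq]) (simp add: abs_mult)
    also have "\<dots> \<le> \<bar>a\<bar> * c + \<bar>b\<bar> * d" using elim by (intro add_mono mult_left_mono) auto
    finally show ?case .
  qed
  moreover have "0 \<le> \<bar>a\<bar> * c + \<bar>b\<bar> * d" using c d by simp
  ultimately show ?thesis by (auto simp: Lp_space_top_iff)
qed

lemma L1_plus_Linf_lincomb:
  assumes "f \<in> L1_plus_Linf M" "g \<in> L1_plus_Linf M"
  shows "(\<lambda>x. a * f x + b * g x) \<in> L1_plus_Linf M"
proof -
  obtain f1 f2 g1 g2 where *: "f1 \<in> Lp_space 1 M" "f2 \<in> Lp_space \<infinity> M" "f = (\<lambda>x. f1 x + f2 x)"
    "g1 \<in> Lp_space 1 M" "g2 \<in> Lp_space \<infinity> M" "g = (\<lambda>x. g1 x + g2 x)"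
    using assms by (auto simp: L1_plus_Linf_def)
  have "(\<lambda>x. a * f x + b * g x) = (\<lambda>x. (a * f1 x + b * g1 x) + (a * f2 x + b * g2 x))"
    using * by (auto simp: algebra_simps)
  then show ?thesis
    using Lp_space_1_lincomb[OF *(1,4), of a b] Lp_space_infinity_lincomb[OF *(2,5), of a b]
    unfolding L1_plus_Linf_def mem_Collect_eq by (intro bexI)
qed

lemma zero_in_Lp_space_1: "(\<lambda>_. 0) \<in> Lp_space 1 M"
  by (simp add: Lp_space_1_iff)

lemma zero_in_Lp_space_infinity: "(\<lambda>_. 0) \<in> Lp_space \<infinity> M"
  by (auto simp: Lp_space_top_iff)

lemma zero_in_L1_plus_Linf: "(\<lambda>_. 0) \<in> L1_plus_Linf M"
  using Lp_space_1_iff[of "\<lambda>_. 0" M] zero_in_Lp_space_infinity[of M]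
  unfolding L1_plus_Linf_def mem_Collect_eq by (intro bexI[of _ "\<lambda>_. 0"]) auto

text \<open>Cut f at height 1: where it is larger, its modulus is at most its r-th power; the rest
  is bounded by 1.\<close>

lemma Lp_space_subset_L1_plus_Linf:
  assumes "1 \<le> p"
  shows "Lp_space p M \<subseteq> L1_plus_Linf M"
proof
  fix f assume f: "f \<in> Lp_space p M"
  show "f \<in> L1_plus_Linf M"
  proof (rule one_le_ennreal_cases[OF assms])
    assume "p = \<infinity>"
    then show ?thesis using f zero_in_Lp_space_1[of M] unfolding L1_plus_Linf_def by force
  next
    fix r assume r: "1 \<le> r" "p = ennreal r"
    have [measurable]: "f \<in> borel_measurable M" using f by (rule Lp_space_measurable)
    define g where "g = (\<lambda>x. if 1 < \<bar>f x\<bar> then f x else 0)"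
    define h where "h = (\<lambda>x. if 1 < \<bar>f x\<bar> then 0 else f x)"
    have "(\<integral>\<^sup>+x. ennreal \<bar>g x\<bar> \<partial>M) \<le> (\<integral>\<^sup>+x. ennreal (\<bar>f x\<bar> powr r) \<partial>M)"
    proof (intro nn_integral_mono ennreal_leI)
      fix x
      have "\<bar>f x\<bar> powr 1 \<le> \<bar>f x\<bar> powr r" if "1 < \<bar>f x\<bar>" using that r by (intro powr_mono) auto
      then show "\<bar>g x\<bar> \<le> \<bar>f x\<bar> powr r" by (simp add: g_def)
    qed
    also have "\<dots> < \<infinity>" using f r by (simp add: Lp_space_ennreal_iff)
    finally have "g \<in> Lp_space 1 M" unfolding Lp_space_1_iff by (simp add: g_def)
    moreover have "h \<in> Lp_space \<infinity> M"
      unfolding Lp_space_infinity_iff by (auto simp: h_def intro!: exI[of _ 1])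
    moreover have "f = (\<lambda>x. g x + h x)" by (auto simp: g_def h_def)
    ultimately show ?thesis unfolding L1_plus_Linf_def by blast
  qed
qed

section \<open>Schur's test and Fubini for symmetric kernels\<close>

definition kernel_op :: "'a measure \<Rightarrow> ('a \<Rightarrow> 'a \<Rightarrow> real) \<Rightarrow> ('a \<Rightarrow> real) \<Rightarrow> 'a \<Rightarrow> real" where
  "kernel_op M k f x = (\<integral>y. k x y * f y \<partial>M)"

text \<open>By symmetry the one mass bound controls both variables, which are the L1 and the
  sup-norm hypotheses of Schur's test. K is a parameter because the theorem needs 1, the decaying
  power of cosh, and its multiple by c. Positivity of K keeps K times an infinite norm
  infinite.\<close>

locale symmetric_kernel = sigma_finite_measure M for M :: "'a measure" +
  fixes k :: "'a \<Rightarrow> 'a \<Rightarrow> real" and K :: real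
  assumes kernel_measurable: "(\<lambda>(x, y). k x y) \<in> borel_measurable (M \<Otimes>\<^sub>M M)"
    and kernel_nonneg: "x \<in> space M \<Longrightarrow> y \<in> space M \<Longrightarrow> 0 \<le> k x y"
    and kernel_commute: "x \<in> space M \<Longrightarrow> y \<in> space M \<Longrightarrow> k x y = k y x"
    and kernel_mass: "x \<in> space M \<Longrightarrow> (\<integral>\<^sup>+y. ennreal (k x y) \<partial>M) \<le> ennreal K"
    and K_pos: "0 < K"
begin

lemma pair_sigma_finite: "pair_sigma_finite M M"
  by (intro pair_sigma_finite.intro sigma_finite_measure_axioms)

declare kernel_measurable [measurable]

lemma kernel_measurable':
  assumes "f \<in> N \<rightarrow>\<^sub>M M" "g \<in> N \<rightarrow>\<^sub>M M"
  shows "(\<lambda>z. k (f z) (g z)) \<in> borel_measurable N"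
proof -
  have "(\<lambda>z. (f z, g z)) \<in> N \<rightarrow>\<^sub>M M \<Otimes>\<^sub>M M" using assms by measurable
  from measurable_compose[OF this kernel_measurable] show ?thesis by simp
qed

lemma kernel_section_measurable [measurable]: "x \<in> space M \<Longrightarrow> k x \<in> borel_measurable M"
  by (rule kernel_measurable'[of "\<lambda>_. x" M "\<lambda>y. y"]) auto

lemma kernel_op_measurable [measurable]:
  assumes [measurable]: "f \<in> borel_measurable M"
  shows "kernel_op M k f \<in> borel_measurable M"
  unfolding kernel_op_def[abs_def] by measurable

text \<open>Holds without integrability as well, since the Bochner integral is then 0.\<close>

lemma abs_kernel_op_le:
  assumes x: "x \<in> space M" and [measurable]: "f \<in> borel_measurable M"
  shows "ennreal \<bar>kernel_op M k f x\<bar> \<le> (\<integral>\<^sup>+y. ennreal (k x y) * ennreal \<bar>f y\<bar> \<partial>M)"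
proof -
  have "ennreal \<bar>kernel_op M k f x\<bar> \<le> (\<integral>\<^sup>+y. ennreal \<bar>k x y * f y\<bar> \<partial>M)"
  proof (cases "integrable M (\<lambda>y. k x y * f y)")
    case True
    then show ?thesis using integral_norm_bound_ennreal[OF True] by (simp add: kernel_op_def)
  qed (simp add: kernel_op_def not_integrable_integral_eq)
  also have "\<dots> = (\<integral>\<^sup>+y. ennreal (k x y) * ennreal \<bar>f y\<bar> \<partial>M)"
    using x by (intro nn_integral_cong) (simp add: abs_mult kernel_nonneg ennreal_mult)
  finally show ?thesis .
qed

text \<open>The L1 endpoint of Schur's test, by Tonelli and symmetry. It is stated for arbitrary
  nonnegative g so that it can be applied to powers of the modulus of f.\<close>

lemma nn_integral_kernel_le:
  fixes g :: "'a \<Rightarrow> ennreal"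
  assumes [measurable]: "g \<in> borel_measurable M"
  shows "(\<integral>\<^sup>+x. (\<integral>\<^sup>+y. ennreal (k x y) * g y \<partial>M) \<partial>M) \<le> ennreal K * (\<integral>\<^sup>+y. g y \<partial>M)"
proof -
  have "(\<integral>\<^sup>+x. (\<integral>\<^sup>+y. ennreal (k x y) * g y \<partial>M) \<partial>M) = (\<integral>\<^sup>+y. (\<integral>\<^sup>+x. ennreal (k x y) * g y \<partial>M) \<partial>M)"
    by (rule pair_sigma_finite.Fubini'[OF pair_sigma_finite, symmetric]) measurable
  also have "\<dots> \<le> (\<integral>\<^sup>+y. ennreal K * g y \<partial>M)"
  proof (rule nn_integral_mono)
    fix y assume y: "y \<in> space M"
    have "(\<integral>\<^sup>+x. ennreal (k x y) * g y \<partial>M) = (\<integral>\<^sup>+x. ennreal (k x y) \<partial>M) * g y"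
      using y by (intro nn_integral_multc) measurable
    also have "(\<integral>\<^sup>+x. ennreal (k x y) \<partial>M) = (\<integral>\<^sup>+x. ennreal (k y x) \<partial>M)"
      using y by (intro nn_integral_cong) (simp add: kernel_commute)
    also have "\<dots> * g y \<le> ennreal K * g y" by (intro mult_right_mono kernel_mass y) simp
    finally show "(\<integral>\<^sup>+x. ennreal (k x y) * g y \<partial>M) \<le> ennreal K * g y" .
  qed
  also have "\<dots> = ennreal K * (\<integral>\<^sup>+y. g y \<partial>M)" by (rule nn_integral_cmult) measurable
  finally show ?thesis .
qed

text \<open>Hoelder's inequality for the measure \<open>k x y dy\<close>, obtained by integrating
  \<open>a \<le> \<lambda> powr (1 - r) * a powr r / r + (1 - 1 / r) * \<lambda>\<close> and optimising \<open>\<lambda>\<close>.\<close>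

lemma kernel_op_powr_le:
  assumes x: "x \<in> space M" and [measurable]: "f \<in> borel_measurable M" and r: "1 \<le> r"
  shows "ennreal (\<bar>kernel_op M k f x\<bar> powr r) \<le> ennreal (K powr (r - 1)) * (\<integral>\<^sup>+y. ennreal (k x y) * ennreal (\<bar>f y\<bar> powr r) \<partial>M)"
proof (cases "\<integral>\<^sup>+y. ennreal (k x y) * ennreal (\<bar>f y\<bar> powr r) \<partial>M")
  case top
  then show ?thesis using K_pos by (simp add: ennreal_mult_top)
next
  case (real j)
  define z where "z = \<bar>kernel_op M k f x\<bar>"
  have Kr: "0 < K powr (r - 1)" using K_pos by simp
  \<comment> \<open>The optimal parameter must be positive, but j may be 0. So j is replaced by any
    i > j, and i is sent to j at the end.\<close>
  have *: "z powr r \<le> K powr (r - 1) * i" if i: "j < i" for i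
  proof -
    have i0: "0 < i" using i real(1) by simp
    \<comment> \<open>The minimiser of l^(1-r) i / r + (1 - 1/r) l K: it makes l^(1-r) i = l K, so
      that the bound collapses to l K.\<close>
    define l where "l = (i / K) powr (1 / r)"
    have l: "0 < l" using i0 K_pos by (simp add: l_def)
    have lr: "l powr (1 - r) * i = l * K"
    proof -
      have "l powr r = i / K" using i0 K_pos r by (simp add: l_def powr_powr)
      then have "i = l powr r * K" using K_pos by simp
      moreover have "l powr (1 - r) * l powr r = l" using l by (simp flip: powr_add)
      ultimately show ?thesis by (metis mult.assoc)
    qed
    have young: "a \<le> l powr (1 - r) / r * a powr r + (1 - 1 / r) * l" if a: "0 \<le> a" for a
    proof (cases "a = 0")
      case True
      then show ?thesis using r l by simp
    next
      case False
      then have a: "0 < a" using a by simp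
      have "(l powr (1 - r) * a powr r) powr (1 / r) * l powr (1 - 1 / r) \<le> 1 / r * (l powr (1 - r) * a powr r) + (1 - 1 / r) * l"
        using r l a by (intro Youngs_inequality_0) auto
      also have "(l powr (1 - r) * a powr r) powr (1 / r) * l powr (1 - 1 / r) = a"
      proof -
        have "(l powr (1 - r) * a powr r) powr (1 / r) = l powr ((1 - r) / r) * a"
          using l a r by (simp add: powr_mult powr_powr)
        moreover have "l powr ((1 - r) / r) * l powr (1 - 1 / r) = 1"
          using l r by (simp add: diff_divide_distrib flip: powr_add)
        ultimately show ?thesis by (simp add: mult_ac)
      qed
      finally show ?thesis by (simp add: mult_ac)
    qed
    have nn: "0 \<le> l powr (1 - r) / r" "0 \<le> (1 - 1 / r) * l" using r l by auto
    have "ennreal z \<le> (\<integral>\<^sup>+y. ennreal (k x y) * ennreal \<bar>f y\<bar> \<partial>M)"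
      unfolding z_def by (rule abs_kernel_op_le[OF x]) measurable
    also have "\<dots> \<le> (\<integral>\<^sup>+y. ennreal (l powr (1 - r) / r) * (ennreal (k x y) * ennreal (\<bar>f y\<bar> powr r)) + ennreal ((1 - 1 / r) * l) * ennreal (k x y) \<partial>M)"
    proof (rule nn_integral_mono)
      fix y assume y: "y \<in> space M"
      have "ennreal \<bar>f y\<bar> \<le> ennreal (l powr (1 - r) / r * \<bar>f y\<bar> powr r + (1 - 1 / r) * l)"
        by (intro ennreal_leI young) simp
      also have "\<dots> = ennreal (l powr (1 - r) / r) * ennreal (\<bar>f y\<bar> powr r) + ennreal ((1 - 1 / r) * l)"
        using nn by (simp only: ennreal_plus mult_nonneg_nonneg powr_ge_zero ennreal_mult'[OF nn(1)])
      finally have "ennreal (k x y) * ennreal \<bar>f y\<bar> \<le> ennreal (k x y) * (ennreal (l powr (1 - r) / r) * ennreal (\<bar>f y\<bar> powr r) + ennreal ((1 - 1 / r) * l))"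
        by (intro mult_left_mono) auto
      then show "ennreal (k x y) * ennreal \<bar>f y\<bar> \<le> ennreal (l powr (1 - r) / r) * (ennreal (k x y) * ennreal (\<bar>f y\<bar> powr r)) + ennreal ((1 - 1 / r) * l) * ennreal (k x y)"
        by (simp only: distrib_left mult_ac)
    qed
    also have "\<dots> = ennreal (l powr (1 - r) / r) * ennreal j + ennreal ((1 - 1 / r) * l) * (\<integral>\<^sup>+y. ennreal (k x y) \<partial>M)"
      using x by (subst nn_integral_add, measurable, subst nn_integral_cmult, measurable, subst nn_integral_cmult, measurable) (simp only: real(2))
    also have "\<dots> \<le> ennreal (l powr (1 - r) / r) * ennreal i + ennreal ((1 - 1 / r) * l) * ennreal K"
      using i real(1) by (intro add_mono mult_left_mono ennreal_leI kernel_mass x) auto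
    also have "\<dots> = ennreal (l powr (1 - r) / r * i + (1 - 1 / r) * l * K)"
      using nn i0 K_pos by (simp only: ennreal_plus mult_nonneg_nonneg less_imp_le ennreal_mult'[OF nn(1)] ennreal_mult'[OF nn(2)])
    also have "l powr (1 - r) / r * i + (1 - 1 / r) * l * K = l * K"
      using lr r by (simp add: field_simps)
    finally have "z \<le> l * K" using l K_pos by (subst (asm) ennreal_le_iff) auto
    then have "z powr r \<le> (l * K) powr r" using r by (intro powr_mono2) (auto simp: z_def)
    also have "\<dots> = K powr (r - 1) * i"
      using i0 K_pos r l by (simp add: l_def powr_mult powr_powr powr_diff)
    finally show ?thesis .
  qed
  have "z powr r \<le> K powr (r - 1) * j"
  proof (rule field_le_epsilon)
    fix e :: real assume e: "0 < e"
    have "z powr r \<le> K powr (r - 1) * (j + e / K powr (r - 1))" using e Kr by (intro *) simp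
    also have "\<dots> = K powr (r - 1) * j + e" using Kr by (simp add: distrib_left)
    finally show "z powr r \<le> K powr (r - 1) * j + e" .
  qed
  then have "ennreal (z powr r) \<le> ennreal (K powr (r - 1) * j)" by (rule ennreal_leI)
  then show ?thesis unfolding real(2) z_def using real(1) by (simp only: ennreal_mult powr_ge_zero)
qed

lemma nn_integral_kernel_op_powr_le:
  assumes [measurable]: "f \<in> borel_measurable M" and r: "1 \<le> r"
  shows "(\<integral>\<^sup>+x. ennreal (\<bar>kernel_op M k f x\<bar> powr r) \<partial>M) \<le> ennreal (K powr r) * (\<integral>\<^sup>+x. ennreal (\<bar>f x\<bar> powr r) \<partial>M)"
proof -
  have "(\<integral>\<^sup>+x. ennreal (\<bar>kernel_op M k f x\<bar> powr r) \<partial>M)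
    \<le> (\<integral>\<^sup>+x. ennreal (K powr (r - 1)) * (\<integral>\<^sup>+y. ennreal (k x y) * ennreal (\<bar>f y\<bar> powr r) \<partial>M) \<partial>M)"
    by (intro nn_integral_mono kernel_op_powr_le r) auto
  also have "\<dots> = ennreal (K powr (r - 1)) * (\<integral>\<^sup>+x. (\<integral>\<^sup>+y. ennreal (k x y) * ennreal (\<bar>f y\<bar> powr r) \<partial>M) \<partial>M)"
    by (rule nn_integral_cmult) measurable
  also have "\<dots> \<le> ennreal (K powr (r - 1)) * (ennreal K * (\<integral>\<^sup>+y. ennreal (\<bar>f y\<bar> powr r) \<partial>M))"
    by (intro mult_left_mono nn_integral_kernel_le) auto
  also have "\<dots> = ennreal (K powr r) * (\<integral>\<^sup>+x. ennreal (\<bar>f x\<bar> powr r) \<partial>M)"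
    using K_pos by (simp add: mult.assoc[symmetric] ennreal_mult'[symmetric] powr_diff)
  finally show ?thesis .
qed

lemma Lp_norm_kernel_op_le:
  assumes f [measurable]: "f \<in> borel_measurable M" and p: "1 \<le> p"
  shows "Lp_norm p M (kernel_op M k f) \<le> ennreal K * Lp_norm p M f"
proof (rule one_le_ennreal_cases[OF p])
  assume p: "p = \<infinity>"
  show ?thesis
  proof (cases "esssup M (\<lambda>x. ennreal \<bar>f x\<bar>)")
    case top
    then show ?thesis using K_pos f by (simp add: p Lp_norm_top ennreal_mult_top)
  next
    case (real c)
    have ae: "AE y in M. ennreal \<bar>f y\<bar> \<le> ennreal c"
      using esssup_AE[of "\<lambda>x. ennreal \<bar>f x\<bar>" M] by (simp add: real)
    have "ennreal \<bar>kernel_op M k f x\<bar> \<le> ennreal K * ennreal c" if x: "x \<in> space M" for x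
    proof -
      have "ennreal \<bar>kernel_op M k f x\<bar> \<le> (\<integral>\<^sup>+y. ennreal (k x y) * ennreal \<bar>f y\<bar> \<partial>M)"
        by (rule abs_kernel_op_le[OF x]) measurable
      also have "\<dots> \<le> (\<integral>\<^sup>+y. ennreal (k x y) * ennreal c \<partial>M)"
        using ae by (intro nn_integral_mono_AE) (auto elim!: eventually_mono intro: mult_left_mono)
      also have "\<dots> = (\<integral>\<^sup>+y. ennreal (k x y) \<partial>M) * ennreal c" using x by (intro nn_integral_multc) measurable
      also have "\<dots> \<le> ennreal K * ennreal c" by (intro mult_right_mono kernel_mass x) simp
      finally show ?thesis .
    qed
    then have "esssup M (\<lambda>x. ennreal \<bar>kernel_op M k f x\<bar>) \<le> ennreal K * ennreal c"
      by (intro esssup_I) auto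
    then show ?thesis using f real by (simp add: p Lp_norm_top)
  qed
next
  fix r assume r: "1 \<le> r" "p = ennreal r"
  show ?thesis
  proof (cases "\<integral>\<^sup>+x. ennreal (\<bar>f x\<bar> powr r) \<partial>M")
    case top
    then show ?thesis using K_pos f r by (simp add: Lp_norm_ennreal ennreal_mult_top)
  next
    case (real j)
    have *: "(\<integral>\<^sup>+x. ennreal (\<bar>kernel_op M k f x\<bar> powr r) \<partial>M) \<le> ennreal (K powr r * j)"
      using nn_integral_kernel_op_powr_le[OF f r(1)] real by (simp add: ennreal_mult)
    then obtain i where i: "0 \<le> i" "(\<integral>\<^sup>+x. ennreal (\<bar>kernel_op M k f x\<bar> powr r) \<partial>M) = ennreal i" "i \<le> K powr r * j"
      using real(1) by (cases "\<integral>\<^sup>+x. ennreal (\<bar>kernel_op M k f x\<bar> powr r) \<partial>M") (auto simp: top_unique)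
    have "i powr (1 / r) \<le> (K powr r * j) powr (1 / r)" using i r by (intro powr_mono2) auto
    also have "\<dots> = K * j powr (1 / r)" using K_pos real(1) r by (simp add: powr_mult powr_powr)
    finally have "ennreal (i powr (1 / r)) \<le> ennreal K * ennreal (j powr (1 / r))"
      using K_pos by (simp add: ennreal_mult'[symmetric] ennreal_leI)
    then show ?thesis
      using i real r by (simp add: Lp_norm_ennreal)
  qed
qed

lemma Lp_opnorm_kernel_op_le:
  assumes "1 \<le> p"
  shows "Lp_opnorm p M (kernel_op M k) \<le> ennreal K"
  unfolding Lp_opnorm_def
proof (rule SUP_least)
  fix f assume f: "f \<in> {f \<in> Lp_space p M. Lp_norm p M f \<le> 1}"
  then have "Lp_norm p M (kernel_op M k f) \<le> ennreal K * Lp_norm p M f"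
    using assms by (intro Lp_norm_kernel_op_le) (auto simp: Lp_space_def)
  also have "\<dots> \<le> ennreal K * 1" using f by (intro mult_left_mono) auto
  finally show "Lp_norm p M (kernel_op M k f) \<le> ennreal K" by simp
qed

text \<open>The L1 part is finite almost everywhere because its integral is; the bounded part is
  finite at every point by the mass bound. Hence the integral formula defines the operator on the
  whole of L1 + Linf up to a null set.\<close>

lemma AE_nn_integral_kernel_finite:
  assumes "f \<in> L1_plus_Linf M"
  shows "AE x in M. (\<integral>\<^sup>+y. ennreal (k x y) * ennreal \<bar>f y\<bar> \<partial>M) < \<infinity>"
proof -
  obtain g h where gh: "g \<in> Lp_space 1 M" "h \<in> Lp_space \<infinity> M" "f = (\<lambda>x. g x + h x)"
    using assms by (auto simp: L1_plus_Linf_def)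
  have [measurable]: "g \<in> borel_measurable M" "h \<in> borel_measurable M"
    using gh by (auto simp: Lp_space_measurable)
  obtain c where c: "0 \<le> c" "AE x in M. \<bar>h x\<bar> \<le> c" using gh by (auto simp: Lp_space_top_iff)
  have "(\<integral>\<^sup>+x. (\<integral>\<^sup>+y. ennreal (k x y) * ennreal \<bar>g y\<bar> \<partial>M) \<partial>M) \<le> ennreal K * (\<integral>\<^sup>+y. ennreal \<bar>g y\<bar> \<partial>M)"
    by (rule nn_integral_kernel_le) measurable
  also have "\<dots> < \<infinity>" using gh by (auto simp: Lp_space_1_iff ennreal_mult_less_top)
  finally have "AE x in M. (\<integral>\<^sup>+y. ennreal (k x y) * ennreal \<bar>g y\<bar> \<partial>M) \<noteq> \<infinity>"
    by (intro nn_integral_PInf_AE) auto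
  then show ?thesis using AE_space
  proof eventually_elim
    case (elim x)
    have "(\<integral>\<^sup>+y. ennreal (k x y) * ennreal \<bar>f y\<bar> \<partial>M) \<le> (\<integral>\<^sup>+y. ennreal (k x y) * ennreal \<bar>g y\<bar> + ennreal (k x y) * ennreal c \<partial>M)"
      using c(2)
    proof (intro nn_integral_mono_AE, eventually_elim)
      fix y assume "\<bar>h y\<bar> \<le> c"
      then have "ennreal \<bar>f y\<bar> \<le> ennreal (\<bar>g y\<bar> + c)" by (intro ennreal_leI) (auto simp: gh)
      also have "\<dots> = ennreal \<bar>g y\<bar> + ennreal c" using c(1) by simp
      finally show "ennreal (k x y) * ennreal \<bar>f y\<bar> \<le> ennreal (k x y) * ennreal \<bar>g y\<bar> + ennreal (k x y) * ennreal c"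
        unfolding distrib_left[symmetric] by (intro mult_left_mono) auto
    qed
    also have "\<dots> = (\<integral>\<^sup>+y. ennreal (k x y) * ennreal \<bar>g y\<bar> \<partial>M) + (\<integral>\<^sup>+y. ennreal (k x y) \<partial>M) * ennreal c"
      using elim(2) nn_integral_multc[of "\<lambda>y. ennreal (k x y)" M "ennreal c"]
      by (subst nn_integral_add) auto
    also have "\<dots> < \<infinity>"
      using elim kernel_mass[OF elim(2)] by (auto simp: less_top[symmetric] ennreal_mult_eq_top_iff top_unique)
    finally show ?case .
  qed
qed

lemma kernel_integrable:
  assumes x: "x \<in> space M" and [measurable]: "f \<in> borel_measurable M"
    and "(\<integral>\<^sup>+y. ennreal (k x y) * ennreal \<bar>f y\<bar> \<partial>M) < \<infinity>"
  shows "integrable M (\<lambda>y. k x y * f y)"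
proof (rule integrableI_bounded)
  show "(\<lambda>y. k x y * f y) \<in> borel_measurable M" using x by measurable
  have "(\<integral>\<^sup>+y. ennreal (norm (k x y * f y)) \<partial>M) = (\<integral>\<^sup>+y. ennreal (k x y) * ennreal \<bar>f y\<bar> \<partial>M)"
    using x by (intro nn_integral_cong) (simp add: abs_mult kernel_nonneg ennreal_mult)
  then show "(\<integral>\<^sup>+y. ennreal (norm (k x y * f y)) \<partial>M) < \<infinity>" using assms by simp
qed

lemma AE_kernel_integrable:
  assumes f: "f \<in> L1_plus_Linf M"
  shows "AE x in M. integrable M (\<lambda>y. k x y * f y)"
  using AE_nn_integral_kernel_finite[OF f] AE_space
  by eventually_elim (use f in \<open>auto intro: kernel_integrable L1_plus_Linf_measurable\<close>)

lemma kernel_op_lincomb: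
  assumes "f \<in> L1_plus_Linf M" "g \<in> L1_plus_Linf M"
  shows "AE x in M. kernel_op M k (\<lambda>y. a * f y + b * g y) x = a * kernel_op M k f x + b * kernel_op M k g x"
  using AE_kernel_integrable[OF assms(1)] AE_kernel_integrable[OF assms(2)]
proof eventually_elim
  case (elim x)
  have "kernel_op M k (\<lambda>y. a * f y + b * g y) x = (\<integral>y. a * (k x y * f y) + b * (k x y * g y) \<partial>M)"
    by (simp add: kernel_op_def algebra_simps)
  also have "\<dots> = a * kernel_op M k f x + b * kernel_op M k g x"
    using elim by (simp add: kernel_op_def)
  finally show ?case .
qed

lemma kernel_op_nonneg:
  assumes x: "x \<in> space M" and f: "AE y in M. 0 \<le> f y"
  shows "0 \<le> kernel_op M k f x"
  unfolding kernel_op_def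
proof (rule integral_nonneg_AE)
  show "AE y in M. 0 \<le> k x y * f y"
    using f AE_space by eventually_elim (simp add: x kernel_nonneg)
qed

lemma ennreal_kernel_op:
  assumes x: "x \<in> space M" and f [measurable]: "f \<in> borel_measurable M" "\<And>y. y \<in> space M \<Longrightarrow> 0 \<le> f y" "\<And>y. y \<in> space M \<Longrightarrow> f y \<le> 1"
  shows "ennreal (kernel_op M k f x) = (\<integral>\<^sup>+y. ennreal (k x y) * ennreal (f y) \<partial>M)"
proof -
  have "(\<integral>\<^sup>+y. ennreal (k x y) * ennreal \<bar>f y\<bar> \<partial>M) \<le> (\<integral>\<^sup>+y. ennreal (k x y) * 1 \<partial>M)"
    using f by (intro nn_integral_mono mult_left_mono) (auto simp: ennreal_le_1)
  also have "\<dots> < \<infinity>" using kernel_mass[OF x] by (simp add: le_less_trans)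
  finally have "integrable M (\<lambda>y. k x y * f y)" by (intro kernel_integrable x) measurable
  then have "ennreal (kernel_op M k f x) = (\<integral>\<^sup>+y. ennreal (k x y * f y) \<partial>M)"
    unfolding kernel_op_def using x f by (intro nn_integral_eq_integral[symmetric]) (auto simp: kernel_nonneg)
  also have "\<dots> = (\<integral>\<^sup>+y. ennreal (k x y) * ennreal (f y) \<partial>M)"
    using x f by (intro nn_integral_cong) (simp add: ennreal_mult kernel_nonneg)
  finally show ?thesis .
qed

text \<open>Fubini. Absolute integrability of k x y f(y) g(x) follows from \<bar>f(y) g(x)\<bar>
  \<le> f(y)^2 + g(x)^2 and the mass bound in each variable.\<close>

lemma kernel_op_symmetric:
  assumes f: "f \<in> Lp_space 2 M" and g: "g \<in> Lp_space 2 M"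
  shows "(\<integral>x. kernel_op M k f x * g x \<partial>M) = (\<integral>x. f x * kernel_op M k g x \<partial>M)"
proof -
  have [measurable]: "f \<in> borel_measurable M" "g \<in> borel_measurable M"
    using f g by (auto simp: Lp_space_measurable)
  have "integrable (M \<Otimes>\<^sub>M M) (\<lambda>(x, y). k x y * f y * g x)"
  proof (rule integrableI_bounded)
    show "(\<lambda>(x, y). k x y * f y * g x) \<in> borel_measurable (M \<Otimes>\<^sub>M M)" by measurable
    have "(\<integral>\<^sup>+z. ennreal (norm (case z of (x, y) \<Rightarrow> k x y * f y * g x)) \<partial>(M \<Otimes>\<^sub>M M))
      = (\<integral>\<^sup>+x. \<integral>\<^sup>+y. ennreal \<bar>k x y * f y * g x\<bar> \<partial>M \<partial>M)"
      using nn_integral_fst[of "\<lambda>z. ennreal (norm (case z of (x, y) \<Rightarrow> k x y * f y * g x))" M] by simp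
    also have "\<dots> \<le> (\<integral>\<^sup>+x. (\<integral>\<^sup>+y. ennreal (k x y) * ennreal ((f y)\<^sup>2) \<partial>M) + ennreal K * ennreal ((g x)\<^sup>2) \<partial>M)"
    proof (rule nn_integral_mono)
      fix x assume x: "x \<in> space M"
      have "(\<integral>\<^sup>+y. ennreal \<bar>k x y * f y * g x\<bar> \<partial>M) \<le> (\<integral>\<^sup>+y. ennreal (k x y) * ennreal ((f y)\<^sup>2) + ennreal (k x y) * ennreal ((g x)\<^sup>2) \<partial>M)"
      proof (rule nn_integral_mono)
        fix y assume y: "y \<in> space M"
        have "\<bar>f y * g x\<bar> \<le> (f y)\<^sup>2 + (g x)\<^sup>2"
          using sum_squares_bound[of "\<bar>f y\<bar>" "\<bar>g x\<bar>"]
            mult_nonneg_nonneg[OF abs_ge_zero[of "f y"] abs_ge_zero[of "g x"]]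
          unfolding abs_mult power2_abs by linarith
        then have "\<bar>k x y * f y * g x\<bar> \<le> k x y * (f y)\<^sup>2 + k x y * (g x)\<^sup>2"
          using mult_left_mono[of "\<bar>f y * g x\<bar>" "(f y)\<^sup>2 + (g x)\<^sup>2" "k x y"] kernel_nonneg[OF x y]
          by (simp add: abs_mult algebra_simps)
        then have "ennreal \<bar>k x y * f y * g x\<bar> \<le> ennreal (k x y * (f y)\<^sup>2 + k x y * (g x)\<^sup>2)" by (rule ennreal_leI)
        also have "\<dots> = ennreal (k x y) * ennreal ((f y)\<^sup>2) + ennreal (k x y) * ennreal ((g x)\<^sup>2)"
          using kernel_nonneg[OF x y] by (subst ennreal_plus) (auto simp: ennreal_mult)
        finally show "ennreal \<bar>k x y * f y * g x\<bar> \<le> ennreal (k x y) * ennreal ((f y)\<^sup>2) + ennreal (k x y) * ennreal ((g x)\<^sup>2)" .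
      qed
      also have "\<dots> = (\<integral>\<^sup>+y. ennreal (k x y) * ennreal ((f y)\<^sup>2) \<partial>M) + (\<integral>\<^sup>+y. ennreal (k x y) \<partial>M) * ennreal ((g x)\<^sup>2)"
        using x nn_integral_multc[of "\<lambda>y. ennreal (k x y)" M "ennreal ((g x)\<^sup>2)"]
        by (subst nn_integral_add) auto
      also have "\<dots> \<le> (\<integral>\<^sup>+y. ennreal (k x y) * ennreal ((f y)\<^sup>2) \<partial>M) + ennreal K * ennreal ((g x)\<^sup>2)"
        by (intro add_left_mono mult_right_mono kernel_mass x) simp
      finally show "(\<integral>\<^sup>+y. ennreal \<bar>k x y * f y * g x\<bar> \<partial>M) \<le> (\<integral>\<^sup>+y. ennreal (k x y) * ennreal ((f y)\<^sup>2) \<partial>M) + ennreal K * ennreal ((g x)\<^sup>2)" .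
    qed
    also have "\<dots> = (\<integral>\<^sup>+x. (\<integral>\<^sup>+y. ennreal (k x y) * ennreal ((f y)\<^sup>2) \<partial>M) \<partial>M) + ennreal K * (\<integral>\<^sup>+x. ennreal ((g x)\<^sup>2) \<partial>M)"
      using nn_integral_cmult[of "\<lambda>x. ennreal ((g x)\<^sup>2)" M "ennreal K"]
      by (subst nn_integral_add) auto
    also have "\<dots> \<le> ennreal K * (\<integral>\<^sup>+x. ennreal ((f x)\<^sup>2) \<partial>M) + ennreal K * (\<integral>\<^sup>+x. ennreal ((g x)\<^sup>2) \<partial>M)"
      by (intro add_right_mono nn_integral_kernel_le) measurable
    also have "\<dots> < \<infinity>" using f g by (auto simp: Lp_space_2_iff ennreal_mult_less_top)
    finally show "(\<integral>\<^sup>+z. ennreal (norm (case z of (x, y) \<Rightarrow> k x y * f y * g x)) \<partial>(M \<Otimes>\<^sub>M M)) < \<infinity>" .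
  qed
  note pair_sigma_finite.Fubini_integral[OF pair_sigma_finite this]
  moreover have "(\<integral>x. \<integral>y. k x y * f y * g x \<partial>M \<partial>M) = (\<integral>x. kernel_op M k f x * g x \<partial>M)"
    by (simp add: kernel_op_def)
  moreover have "(\<integral>y. \<integral>x. k x y * f y * g x \<partial>M \<partial>M) = (\<integral>y. f y * kernel_op M k g y \<partial>M)"
  proof (intro Bochner_Integration.integral_cong refl)
    fix y assume y: "y \<in> space M"
    have "(\<integral>x. k x y * f y * g x \<partial>M) = (\<integral>x. f y * (k y x * g x) \<partial>M)"
      using y by (intro Bochner_Integration.integral_cong refl) (simp add: kernel_commute)
    then show "(\<integral>x. k x y * f y * g x \<partial>M) = f y * kernel_op M k g y" by (simp add: kernel_op_def)
  qed
  ultimately show ?thesis by simp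
qed

end

section \<open>Semigroups of symmetric kernels\<close>

lemma ennreal_pos_less_obtain:
  assumes "(0::ennreal) < a"
  obtains e where "0 < e" "ennreal e < a"
proof -
  obtain b where "0 < b" "b < a" using dense[OF assms] by blast
  then show thesis using that by (cases b) auto
qed

text \<open>A crude substitute for Minkowski's inequality that avoids roots; it suffices for
  finiteness and for convergence to 0.\<close>

lemma nn_integral_square_add_le:
  fixes f g :: "'a \<Rightarrow> real"
  assumes [measurable]: "f \<in> borel_measurable M" "g \<in> borel_measurable M"
  shows "(\<integral>\<^sup>+x. ennreal ((f x + g x)\<^sup>2) \<partial>M) \<le> 2 * (\<integral>\<^sup>+x. ennreal ((f x)\<^sup>2) \<partial>M) + 2 * (\<integral>\<^sup>+x. ennreal ((g x)\<^sup>2) \<partial>M)"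
proof -
  have "(\<integral>\<^sup>+x. ennreal ((f x + g x)\<^sup>2) \<partial>M) \<le> (\<integral>\<^sup>+x. 2 * ennreal ((f x)\<^sup>2) + 2 * ennreal ((g x)\<^sup>2) \<partial>M)"
  proof (rule nn_integral_mono)
    fix x
    have "(f x + g x)\<^sup>2 \<le> 2 * (f x)\<^sup>2 + 2 * (g x)\<^sup>2"
      using sum_squares_bound[of "f x" "g x"] by (simp add: power2_sum)
    then have "ennreal ((f x + g x)\<^sup>2) \<le> ennreal (2 * (f x)\<^sup>2 + 2 * (g x)\<^sup>2)" by (rule ennreal_leI)
    then show "ennreal ((f x + g x)\<^sup>2) \<le> 2 * ennreal ((f x)\<^sup>2) + 2 * ennreal ((g x)\<^sup>2)"
      by (simp add: ennreal_mult)
  qed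
  also have "\<dots> = 2 * (\<integral>\<^sup>+x. ennreal ((f x)\<^sup>2) \<partial>M) + 2 * (\<integral>\<^sup>+x. ennreal ((g x)\<^sup>2) \<partial>M)"
    by (subst nn_integral_add, measurable, subst nn_integral_cmult, measurable, subst nn_integral_cmult, measurable)
  finally show ?thesis .
qed

lemma Lp_space_2_lincomb:
  assumes "f \<in> Lp_space 2 M" "g \<in> Lp_space 2 M"
  shows "(\<lambda>x. a * f x + b * g x) \<in> Lp_space 2 M"
proof -
  have [measurable]: "f \<in> borel_measurable M" "g \<in> borel_measurable M"
    using assms by (auto simp: Lp_space_measurable)
  have "(\<integral>\<^sup>+x. ennreal ((a * f x + b * g x)\<^sup>2) \<partial>M) \<le> 2 * (\<integral>\<^sup>+x. ennreal ((a * f x)\<^sup>2) \<partial>M) + 2 * (\<integral>\<^sup>+x. ennreal ((b * g x)\<^sup>2) \<partial>M)"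
    by (rule nn_integral_square_add_le) measurable
  also have "\<dots> = 2 * (ennreal (a\<^sup>2) * (\<integral>\<^sup>+x. ennreal ((f x)\<^sup>2) \<partial>M)) + 2 * (ennreal (b\<^sup>2) * (\<integral>\<^sup>+x. ennreal ((g x)\<^sup>2) \<partial>M))"
    by (simp add: power_mult_distrib ennreal_mult nn_integral_cmult)
  also have "\<dots> < \<infinity>"
    using assms by (auto simp: Lp_space_2_iff ennreal_mult_less_top)
  finally show ?thesis by (simp add: Lp_space_2_iff)
qed

lemma indicator_Lp_space_2:
  assumes "U \<in> sets M" "emeasure M U < \<infinity>"
  shows "indicator U \<in> Lp_space 2 M"
proof -
  have "ennreal ((indicator U x :: real)\<^sup>2) = indicator U x" for x by (simp add: indicator_def)
  then show ?thesis using assms by (simp add: Lp_space_2_iff)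
qed

text \<open>\<open>approximate_identity\<close> packs outer regularity and concentration into one
  assumption, so that no topology enters: the sets U will be open, but only pointwise convergence on
  them matters. The constant 1 makes all operators contractions, so that L2-convergence extends from
  a dense set.\<close>

locale symmetric_kernel_semigroup = sigma_finite_measure M for M :: "'a measure" +
  fixes k :: "real \<Rightarrow> 'a \<Rightarrow> 'a \<Rightarrow> real"
  assumes kernel: "0 < t \<Longrightarrow> symmetric_kernel M (k t) 1"
    and kernel_compose: "0 < s \<Longrightarrow> 0 < t \<Longrightarrow> x \<in> space M \<Longrightarrow> z \<in> space M \<Longrightarrow>
      (\<integral>\<^sup>+y. ennreal (k s x y) * ennreal (k t y z) \<partial>M) = ennreal (k (s + t) x z)"
    and approximate_identity: "A \<in> sets M \<Longrightarrow> emeasure M A < \<infinity> \<Longrightarrow> 0 < e \<Longrightarrow>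
      \<exists>U\<in>sets M. A \<subseteq> U \<and> emeasure M (U - A) \<le> ennreal e \<and>
        (\<forall>x\<in>U. ((\<lambda>t. kernel_op M (k t) (indicator U) x) \<longlongrightarrow> 1) (at_right 0))"
begin

text \<open>Fubini at a fixed x. By \<open>kernel_compose\<close> the absolute double integral
  equals the integral of k (s + t) x z \<bar>f z\<bar>, so the points to discard are those where the
  kernel at time s + t is not integrable against f.\<close>

lemma kernel_op_compose:
  assumes f: "f \<in> L1_plus_Linf M" and s: "0 < s" and t: "0 < t"
  shows "AE x in M. kernel_op M (k (s + t)) f x = kernel_op M (k s) (kernel_op M (k t) f) x"
proof -
  interpret S: symmetric_kernel M "k s" 1 by (rule kernel[OF s])
  interpret T: symmetric_kernel M "k t" 1 by (rule kernel[OF t])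
  interpret ST: symmetric_kernel M "k (s + t)" 1 by (rule kernel) (use s t in simp)
  have [measurable]: "f \<in> borel_measurable M" using f by (rule L1_plus_Linf_measurable)
  show ?thesis
    using ST.AE_nn_integral_kernel_finite[OF f] AE_space
  proof eventually_elim
    case (elim x)
    note x = elim(2)
    let ?F = "\<lambda>y z. k s x y * (k t y z * f z)"
    have meas: "(\<lambda>(y, z). ?F y z) \<in> borel_measurable (M \<Otimes>\<^sub>M M)" using x by measurable
    have int: "integrable (M \<Otimes>\<^sub>M M) (\<lambda>(y, z). ?F y z)"
    proof (rule integrableI_bounded[OF meas])
      have "(\<integral>\<^sup>+p. ennreal (norm (case p of (y, z) \<Rightarrow> ?F y z)) \<partial>(M \<Otimes>\<^sub>M M)) = (\<integral>\<^sup>+y. \<integral>\<^sup>+z. ennreal \<bar>?F y z\<bar> \<partial>M \<partial>M)"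
        using nn_integral_fst[of "\<lambda>p. ennreal (norm (case p of (y, z) \<Rightarrow> ?F y z))" M] meas by simp
      also have "\<dots> = (\<integral>\<^sup>+z. \<integral>\<^sup>+y. ennreal \<bar>?F y z\<bar> \<partial>M \<partial>M)"
        by (rule pair_sigma_finite.Fubini'[OF S.pair_sigma_finite, symmetric]) (use meas in measurable)
      also have "\<dots> = (\<integral>\<^sup>+z. ennreal (k (s + t) x z) * ennreal \<bar>f z\<bar> \<partial>M)"
      proof (rule nn_integral_cong)
        fix z assume z: "z \<in> space M"
        have "(\<integral>\<^sup>+y. ennreal \<bar>?F y z\<bar> \<partial>M) = (\<integral>\<^sup>+y. ennreal (k s x y) * ennreal (k t y z) * ennreal \<bar>f z\<bar> \<partial>M)"
          using x z by (intro nn_integral_cong) (simp add: abs_mult S.kernel_nonneg T.kernel_nonneg ennreal_mult mult.assoc)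
        also have "\<dots> = (\<integral>\<^sup>+y. ennreal (k s x y) * ennreal (k t y z) \<partial>M) * ennreal \<bar>f z\<bar>"
          using x z by (intro nn_integral_multc) measurable
        finally show "(\<integral>\<^sup>+y. ennreal \<bar>?F y z\<bar> \<partial>M) = ennreal (k (s + t) x z) * ennreal \<bar>f z\<bar>"
          by (simp add: kernel_compose s t x z)
      qed
      also have "\<dots> < \<infinity>" using elim by simp
      finally show "(\<integral>\<^sup>+p. ennreal (norm (case p of (y, z) \<Rightarrow> ?F y z)) \<partial>(M \<Otimes>\<^sub>M M)) < \<infinity>" .
    qed
    have "kernel_op M (k s) (kernel_op M (k t) f) x = (\<integral>y. \<integral>z. ?F y z \<partial>M \<partial>M)"
      by (simp add: kernel_op_def)
    also have "\<dots> = (\<integral>z. \<integral>y. ?F y z \<partial>M \<partial>M)"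
      by (rule pair_sigma_finite.Fubini_integral[OF S.pair_sigma_finite int, symmetric])
    also have "\<dots> = (\<integral>z. k (s + t) x z * f z \<partial>M)"
    proof (intro Bochner_Integration.integral_cong refl)
      fix z assume z: "z \<in> space M"
      have "(\<integral>y. k s x y * k t y z \<partial>M) = enn2real (\<integral>\<^sup>+y. ennreal (k s x y * k t y z) \<partial>M)"
        using x z by (intro integral_eq_nn_integral) (auto intro!: AE_I2 mult_nonneg_nonneg S.kernel_nonneg T.kernel_nonneg)
      also have "(\<integral>\<^sup>+y. ennreal (k s x y * k t y z) \<partial>M) = (\<integral>\<^sup>+y. ennreal (k s x y) * ennreal (k t y z) \<partial>M)"
        using x z by (intro nn_integral_cong) (simp add: ennreal_mult S.kernel_nonneg T.kernel_nonneg)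
      also have "enn2real \<dots> = k (s + t) x z"
        using x z by (simp add: kernel_compose s t ST.kernel_nonneg)
      finally have "(\<integral>y. k s x y * k t y z \<partial>M) = k (s + t) x z" .
      moreover have "(\<integral>y. ?F y z \<partial>M) = (\<integral>y. (k s x y * k t y z) * f z \<partial>M)" by (simp add: mult.assoc)
      ultimately show "(\<integral>y. ?F y z \<partial>M) = k (s + t) x z * f z" by simp
    qed
    finally show ?case by (simp add: kernel_op_def)
  qed
qed

section \<open>Strong continuity on L2\<close>

definition L2_continuous :: "('a \<Rightarrow> real) \<Rightarrow> bool" where
  "L2_continuous f \<longleftrightarrow> f \<in> Lp_space 2 M \<and>
    ((\<lambda>t. \<integral>\<^sup>+x. ennreal ((kernel_op M (k t) f x - f x)\<^sup>2) \<partial>M) \<longlongrightarrow> 0) (at_right 0)"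

lemma Lp_space_2_imp_L1_plus_Linf: "f \<in> Lp_space 2 M \<Longrightarrow> f \<in> L1_plus_Linf M"
  using Lp_space_subset_L1_plus_Linf[of 2 M] by auto

lemma nn_integral_kernel_op_square_le:
  assumes "0 < t" "f \<in> borel_measurable M"
  shows "(\<integral>\<^sup>+x. ennreal ((kernel_op M (k t) f x)\<^sup>2) \<partial>M) \<le> (\<integral>\<^sup>+x. ennreal ((f x)\<^sup>2) \<partial>M)"
  using symmetric_kernel.nn_integral_kernel_op_powr_le[OF kernel[OF assms(1)] assms(2), of 2]
  by simp

lemma L2_continuous_lincomb:
  assumes f: "L2_continuous f" and g: "L2_continuous g"
  shows "L2_continuous (\<lambda>x. a * f x + b * g x)"
proof -
  let ?D = "\<lambda>f t. \<integral>\<^sup>+x. ennreal ((kernel_op M (k t) f x - f x)\<^sup>2) \<partial>M"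
  have fg: "f \<in> Lp_space 2 M" "g \<in> Lp_space 2 M" "(?D f \<longlongrightarrow> 0) (at_right 0)" "(?D g \<longlongrightarrow> 0) (at_right 0)"
    using f g by (auto simp: L2_continuous_def)
  have [measurable]: "f \<in> borel_measurable M" "g \<in> borel_measurable M"
    using fg by (auto simp: Lp_space_measurable)
  let ?u = "\<lambda>t. 2 * (ennreal (a\<^sup>2) * ?D f t) + 2 * (ennreal (b\<^sup>2) * ?D g t)"
  have "?D (\<lambda>x. a * f x + b * g x) t \<le> ?u t" if t: "0 < t" for t
  proof -
    interpret symmetric_kernel M "k t" 1 by (rule kernel[OF t])
    have "?D (\<lambda>x. a * f x + b * g x) t = (\<integral>\<^sup>+x. ennreal ((a * (kernel_op M (k t) f x - f x) + b * (kernel_op M (k t) g x - g x))\<^sup>2) \<partial>M)"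
    proof (intro nn_integral_cong_AE)
      show "AE x in M. ennreal ((kernel_op M (k t) (\<lambda>x. a * f x + b * g x) x - (a * f x + b * g x))\<^sup>2)
        = ennreal ((a * (kernel_op M (k t) f x - f x) + b * (kernel_op M (k t) g x - g x))\<^sup>2)"
        using kernel_op_lincomb[OF fg(1,2)[THEN Lp_space_2_imp_L1_plus_Linf], of a b]
        by eventually_elim (simp add: algebra_simps)
    qed
    also have "\<dots> \<le> 2 * (\<integral>\<^sup>+x. ennreal ((a * (kernel_op M (k t) f x - f x))\<^sup>2) \<partial>M) + 2 * (\<integral>\<^sup>+x. ennreal ((b * (kernel_op M (k t) g x - g x))\<^sup>2) \<partial>M)"
      by (rule nn_integral_square_add_le) measurable
    also have "\<dots> = ?u t"
      by (simp add: power_mult_distrib ennreal_mult nn_integral_cmult)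
    finally show ?thesis .
  qed
  then have ev: "eventually (\<lambda>t. ?D (\<lambda>x. a * f x + b * g x) t \<le> ?u t) (at_right 0)"
    by (rule eventually_mono[OF eventually_at_right_less])
  have lim: "(?u \<longlongrightarrow> 0) (at_right 0)"
    by (rule tendsto_eq_rhs, rule tendsto_add, (rule ennreal_tendsto_cmult, simp)+, rule fg(3),
        (rule ennreal_tendsto_cmult, simp)+, rule fg(4), simp)
  have "(?D (\<lambda>x. a * f x + b * g x) \<longlongrightarrow> 0) (at_right 0)"
    by (rule tendsto_sandwich[OF _ ev tendsto_const lim]) (rule always_eventually, simp)
  then show ?thesis using Lp_space_2_lincomb[OF fg(1,2)] by (simp add: L2_continuous_def)
qed

lemma L2_continuous_closed:
  assumes f: "f \<in> Lp_space 2 M"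
    and approx: "\<And>e. 0 < e \<Longrightarrow> \<exists>g. L2_continuous g \<and> (\<integral>\<^sup>+x. ennreal ((f x - g x)\<^sup>2) \<partial>M) \<le> ennreal e"
  shows "L2_continuous f"
proof -
  let ?D = "\<lambda>f t. \<integral>\<^sup>+x. ennreal ((kernel_op M (k t) f x - f x)\<^sup>2) \<partial>M"
  have [measurable]: "f \<in> borel_measurable M" using f by (rule Lp_space_measurable)
  have "(?D f \<longlongrightarrow> 0) (at_right 0)"
  proof (rule order_tendstoI)
    fix a :: ennreal assume "0 < a"
    then obtain e where e: "0 < e" "ennreal e < a"
      by (rule ennreal_pos_less_obtain)
    \<comment> \<open>T f - f is split into T (f - g), T g - g and g - f. Two uses of the square
      inequality weight their squared norms by 2, 4 and 4, and 10/16 < 1.\<close>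
    obtain g where g: "L2_continuous g" "(\<integral>\<^sup>+x. ennreal ((f x - g x)\<^sup>2) \<partial>M) \<le> ennreal (e / 16)"
      using approx[of "e / 16"] e by auto
    have g2: "g \<in> Lp_space 2 M" and gD: "(?D g \<longlongrightarrow> 0) (at_right 0)" using g by (auto simp: L2_continuous_def)
    have [measurable]: "g \<in> borel_measurable M" using g2 by (rule Lp_space_measurable)
    have "eventually (\<lambda>t. ?D g t < ennreal (e / 16)) (at_right 0)"
      using gD e by (intro order_tendstoD) auto
    with eventually_at_right_less[of 0] show "eventually (\<lambda>t. ?D f t < a) (at_right 0)"
    proof eventually_elim
      case (elim t)
      interpret symmetric_kernel M "k t" 1 by (rule kernel[OF elim(1)])
      let ?d = "\<lambda>x. f x - g x"
      have d: "(\<lambda>x. 1 * f x + (- 1) * g x) = ?d" by auto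
      have "AE x in M. kernel_op M (k t) ?d x = kernel_op M (k t) f x - kernel_op M (k t) g x"
        using kernel_op_lincomb[OF Lp_space_2_imp_L1_plus_Linf[OF f] Lp_space_2_imp_L1_plus_Linf[OF g2], of 1 "- 1"]
        unfolding d by simp
      then have "?D f t = (\<integral>\<^sup>+x. ennreal ((kernel_op M (k t) ?d x + ((kernel_op M (k t) g x - g x) + (g x - f x)))\<^sup>2) \<partial>M)"
        by (intro nn_integral_cong_AE) (auto elim!: eventually_mono)
      also have "\<dots> \<le> 2 * (\<integral>\<^sup>+x. ennreal ((kernel_op M (k t) ?d x)\<^sup>2) \<partial>M) + 2 * (\<integral>\<^sup>+x. ennreal (((kernel_op M (k t) g x - g x) + (g x - f x))\<^sup>2) \<partial>M)"
        by (rule nn_integral_square_add_le) measurable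
      also have "\<dots> \<le> 2 * (\<integral>\<^sup>+x. ennreal ((?d x)\<^sup>2) \<partial>M) + 2 * (2 * ?D g t + 2 * (\<integral>\<^sup>+x. ennreal ((g x - f x)\<^sup>2) \<partial>M))"
        by (intro add_mono mult_left_mono nn_integral_kernel_op_square_le nn_integral_square_add_le elim) auto
      also have "\<dots> \<le> 2 * ennreal (e / 16) + 2 * (2 * ennreal (e / 16) + 2 * ennreal (e / 16))"
        using g(2) elim(2) by (intro add_mono mult_left_mono) (auto simp: power2_commute)
      also have "\<dots> = ennreal (2 * (e / 16) + 2 * (2 * (e / 16) + 2 * (e / 16)))"
      proof -
        have w: "0 \<le> e / 16" using e(1) by simp
        show ?thesis
          by (simp only: ennreal_plus ennreal_mult ennreal_numeral w mult_nonneg_nonneg add_nonneg_nonneg zero_le_numeral)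
      qed
      also have "\<dots> \<le> ennreal e" using e(1) by (intro ennreal_leI) simp
      also have "\<dots> < a" by (rule e)
      finally show ?case .
    qed
  qed simp
  then show ?thesis using f by (simp add: L2_continuous_def)
qed

text \<open>With \<open>w\<close> the image of \<open>indicator U\<close>, one has \<open>0 \<le> w \<le> 1\<close> and \<open>\<integral>w \<le> emeasure M U\<close>, so the distance is controlled by
  \<open>1 - w\<close> on \<open>U\<close> alone, where dominated convergence applies.\<close>

lemma L2_continuous_indicator_approximable:
  assumes U: "U \<in> sets M" "emeasure M U < \<infinity>"
    and lim: "\<And>x. x \<in> U \<Longrightarrow> ((\<lambda>t. kernel_op M (k t) (indicator U) x) \<longlongrightarrow> 1) (at_right 0)"
  shows "L2_continuous (indicator U)"
proof -
  have [measurable]: "U \<in> sets M" by (rule U)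
  let ?w = "\<lambda>t x. kernel_op M (k t) (indicator U) x"
  have *: "(\<integral>\<^sup>+x. ennreal ((?w t x - indicator U x)\<^sup>2) \<partial>M) \<le> 2 * (\<integral>\<^sup>+x. ennreal (indicator U x * (1 - ?w t x)) \<partial>M)" if t: "0 < t" for t
  proof -
    interpret symmetric_kernel M "k t" 1 by (rule kernel[OF t])
    have w0: "0 \<le> ?w t x" if "x \<in> space M" for x using that by (intro kernel_op_nonneg) auto
    have ew: "ennreal (?w t x) = (\<integral>\<^sup>+y. ennreal (k t x y) * ennreal (indicator U y) \<partial>M)" if "x \<in> space M" for x
      using that by (intro ennreal_kernel_op) auto
    have w1: "?w t x \<le> 1" if x: "x \<in> space M" for x
    proof -
      have "ennreal (?w t x) \<le> (\<integral>\<^sup>+y. ennreal (k t x y) * 1 \<partial>M)"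
        unfolding ew[OF x] by (intro nn_integral_mono mult_left_mono) (auto simp: indicator_def)
      also have "\<dots> \<le> ennreal 1" using kernel_mass[OF x] by simp
      finally show ?thesis by (subst (asm) ennreal_le_iff) auto
    qed
    have "(\<integral>\<^sup>+x. ennreal (?w t x) \<partial>M) = (\<integral>\<^sup>+x. \<integral>\<^sup>+y. ennreal (k t x y) * ennreal (indicator U y) \<partial>M \<partial>M)"
      by (intro nn_integral_cong ew)
    also have "\<dots> \<le> ennreal 1 * (\<integral>\<^sup>+y. ennreal (indicator U y) \<partial>M)" by (rule nn_integral_kernel_le) measurable
    finally have wU: "(\<integral>\<^sup>+x. ennreal (?w t x) \<partial>M) \<le> emeasure M U" by (simp add: ennreal_indicator)
    \<comment> \<open>The measure of U is added on both sides so that the bound on the integral of w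
      can be cancelled against it; this is legitimate because it is finite. Pointwise the estimate
      is (1 - w)^2 \<le> 1 - w on U and w^2 \<le> w off U.\<close>
    have "(\<integral>\<^sup>+x. ennreal ((?w t x - indicator U x)\<^sup>2) \<partial>M) + emeasure M U
      = (\<integral>\<^sup>+x. ennreal ((?w t x - indicator U x)\<^sup>2) + ennreal (indicator U x) \<partial>M)"
      by (subst nn_integral_add) (auto simp: ennreal_indicator)
    also have "\<dots> \<le> (\<integral>\<^sup>+x. ennreal (?w t x) + 2 * ennreal (indicator U x * (1 - ?w t x)) \<partial>M)"
    proof (rule nn_integral_mono)
      fix x assume x: "x \<in> space M"
      have "(?w t x - indicator U x)\<^sup>2 + indicator U x \<le> ?w t x + 2 * (indicator U x * (1 - ?w t x))"
      proof (cases "x \<in> U")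
        case True
        have "(1 - ?w t x) * (1 - ?w t x) \<le> (1 - ?w t x) * 1" using w0[OF x] w1[OF x] by (intro mult_left_mono) auto
        then show ?thesis using True by (simp add: power2_eq_square algebra_simps)
      next
        case False
        have "?w t x * ?w t x \<le> ?w t x * 1" using w0[OF x] w1[OF x] by (intro mult_left_mono) auto
        then show ?thesis using False by (simp add: power2_eq_square)
      qed
      then have "ennreal ((?w t x - indicator U x)\<^sup>2 + indicator U x) \<le> ennreal (?w t x + 2 * (indicator U x * (1 - ?w t x)))"
        by (rule ennreal_leI)
      then show "ennreal ((?w t x - indicator U x)\<^sup>2) + ennreal (indicator U x) \<le> ennreal (?w t x) + 2 * ennreal (indicator U x * (1 - ?w t x))"
        using w0[OF x] w1[OF x] by (simp add: ennreal_plus ennreal_mult)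
    qed
    also have "\<dots> = (\<integral>\<^sup>+x. ennreal (?w t x) \<partial>M) + 2 * (\<integral>\<^sup>+x. ennreal (indicator U x * (1 - ?w t x)) \<partial>M)"
      by (subst nn_integral_add, measurable, subst nn_integral_cmult, measurable)
    also have "\<dots> \<le> emeasure M U + 2 * (\<integral>\<^sup>+x. ennreal (indicator U x * (1 - ?w t x)) \<partial>M)"
      by (intro add_right_mono wU)
    finally show ?thesis using U by (auto simp: add.commute ennreal_add_left_cancel_le)
  qed
  \<comment> \<open>Dominated convergence along sequences of times. Since w \<ge> 0,
    \<open>indicator U\<close> dominates, and it is integrable.\<close>
  have "((\<lambda>t. \<integral>\<^sup>+x. ennreal (indicator U x * (1 - ?w t x)) \<partial>M) \<longlongrightarrow> 0) (at_right 0)"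
    unfolding tendsto_at_iff_sequentially comp_def
  proof (intro allI impI)
    fix X :: "nat \<Rightarrow> real" assume X: "\<forall>i. X i \<in> {0<..} - {0}" "X \<longlonglongrightarrow> 0"
    have "(\<lambda>i. \<integral>\<^sup>+x. ennreal (indicator U x * (1 - ?w (X i) x)) \<partial>M) \<longlonglongrightarrow> (\<integral>\<^sup>+x. 0 \<partial>M)"
    proof (rule nn_integral_dominated_convergence[where w = "indicator U"])
      show "(\<lambda>x. ennreal (indicator U x * (1 - ?w (X i) x))) \<in> borel_measurable M" for i
      proof -
        interpret symmetric_kernel M "k (X i)" 1 using X by (intro kernel) auto
        show ?thesis by measurable
      qed
      show "AE x in M. ennreal (indicator U x * (1 - ?w (X i) x)) \<le> indicator U x" for i
      proof (rule AE_I2)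
        fix x assume x: "x \<in> space M"
        interpret symmetric_kernel M "k (X i)" 1 using X by (intro kernel) auto
        have "0 \<le> ?w (X i) x" using x by (intro kernel_op_nonneg) auto
        then show "ennreal (indicator U x * (1 - ?w (X i) x)) \<le> indicator U x"
          by (auto simp: indicator_def ennreal_le_1)
      qed
      show "AE x in M. (\<lambda>i. ennreal (indicator U x * (1 - ?w (X i) x))) \<longlonglongrightarrow> 0"
      proof (rule AE_I2)
        fix x assume x: "x \<in> space M"
        show "(\<lambda>i. ennreal (indicator U x * (1 - ?w (X i) x))) \<longlonglongrightarrow> 0"
        proof (cases "x \<in> U")
          case True
          have "(\<lambda>i. ?w (X i) x) \<longlonglongrightarrow> 1"
            using lim[OF True] X unfolding tendsto_at_iff_sequentially comp_def by blast
          then have "(\<lambda>i. ennreal (1 - ?w (X i) x)) \<longlonglongrightarrow> ennreal (1 - 1)"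
            by (intro tendsto_intros)
          then show ?thesis using True by simp
        qed simp
      qed
    qed (use U in auto)
    then show "(\<lambda>i. \<integral>\<^sup>+x. ennreal (indicator U x * (1 - ?w (X i) x)) \<partial>M) \<longlonglongrightarrow> 0" by simp
  qed
  then have "((\<lambda>t. 2 * (\<integral>\<^sup>+x. ennreal (indicator U x * (1 - ?w t x)) \<partial>M)) \<longlongrightarrow> 2 * 0) (at_right 0)"
    by (intro ennreal_tendsto_cmult) auto
  then have lim': "((\<lambda>t. 2 * (\<integral>\<^sup>+x. ennreal (indicator U x * (1 - ?w t x)) \<partial>M)) \<longlongrightarrow> 0) (at_right 0)"
    by (simp only: mult_zero_right)
  have ev: "eventually (\<lambda>t. (\<integral>\<^sup>+x. ennreal ((?w t x - indicator U x)\<^sup>2) \<partial>M) \<le> 2 * (\<integral>\<^sup>+x. ennreal (indicator U x * (1 - ?w t x)) \<partial>M)) (at_right 0)"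
    using eventually_at_right_less[of 0] by eventually_elim (rule *)
  have "((\<lambda>t. \<integral>\<^sup>+x. ennreal ((?w t x - indicator U x)\<^sup>2) \<partial>M) \<longlongrightarrow> 0) (at_right 0)"
    by (rule tendsto_sandwich[OF _ ev tendsto_const lim']) (rule always_eventually, simp)
  then show ?thesis using indicator_Lp_space_2[OF U] by (simp add: L2_continuous_def)
qed

lemma L2_continuous_indicator:
  assumes A: "A \<in> sets M" "emeasure M A < \<infinity>"
  shows "L2_continuous (indicator A)"
proof (rule L2_continuous_closed)
  show "indicator A \<in> Lp_space 2 M" by (rule indicator_Lp_space_2[OF A])
  fix e :: real assume e: "0 < e"
  obtain U where U: "U \<in> sets M" "A \<subseteq> U" "emeasure M (U - A) \<le> ennreal e"
    "\<And>x. x \<in> U \<Longrightarrow> ((\<lambda>t. kernel_op M (k t) (indicator U) x) \<longlongrightarrow> 1) (at_right 0)"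
    using approximate_identity[OF A e] by auto
  have "emeasure M U = emeasure M A + emeasure M (U - A)"
    using U A by (subst plus_emeasure) (auto simp: Un_absorb1)
  also have "\<dots> < \<infinity>" using A U(3) by (auto simp: less_top[symmetric] top_unique)
  finally have "L2_continuous (indicator U)" using U by (intro L2_continuous_indicator_approximable) auto
  moreover have "(\<integral>\<^sup>+x. ennreal ((indicator A x - indicator U x :: real)\<^sup>2) \<partial>M) = (\<integral>\<^sup>+x. indicator (U - A) x \<partial>M)"
    using U(2) by (intro nn_integral_cong) (auto simp: indicator_def)
  ultimately show "\<exists>g. L2_continuous g \<and> (\<integral>\<^sup>+x. ennreal ((indicator A x - g x)\<^sup>2) \<partial>M) \<le> ennreal e"
    using U A by (intro exI[of _ "indicator U"]) simp
qed

lemma L2_continuous_nonneg: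
  assumes "f \<in> Lp_space 2 M" and "\<And>x. 0 \<le> f x"
  shows "L2_continuous f"
proof -
  have "f \<in> borel_measurable M" using assms(1) by (rule Lp_space_measurable)
  \<comment> \<open>Membership in L2 is part of the induction claim: the building blocks inherit it
    from the function they build, being dominated by it. The exception is a multiple by c = 0, which
    is the zero function whatever u is.\<close>
  from this assms(2) have "f \<in> Lp_space 2 M \<longrightarrow> L2_continuous f"
  proof (induction rule: borel_measurable_induct_real)
    case (set A)
    have "ennreal ((indicator A x :: real)\<^sup>2) = indicator A x" for x by (simp add: indicator_def)
    then show ?case using set L2_continuous_indicator[of A] by (auto simp: Lp_space_2_iff)
  next
    case (mult u c)
    show ?case
    proof (cases "c = 0")
      case True
      then have "(\<lambda>x. c * u x) = indicator {}" by (auto simp: fun_eq_iff)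
      then show ?thesis using L2_continuous_indicator[of "{}"] by simp
    next
      case False
      show ?thesis
      proof
        assume "(\<lambda>x. c * u x) \<in> Lp_space 2 M"
        from Lp_space_2_lincomb[OF this this, of "1 / c" 0] False have "u \<in> Lp_space 2 M" by simp
        then have "L2_continuous u" using mult by simp
        from L2_continuous_lincomb[OF this this, of c 0] show "L2_continuous (\<lambda>x. c * u x)" by simp
      qed
    qed
  next
    case (add u v)
    show ?case
    proof
      assume s: "(\<lambda>x. v x + u x) \<in> Lp_space 2 M"
      have le: "w \<in> Lp_space 2 M" if "w \<in> borel_measurable M" "\<And>x. 0 \<le> w x" "\<And>x. w x \<le> v x + u x" for w
      proof -
        have "(\<integral>\<^sup>+x. ennreal ((w x)\<^sup>2) \<partial>M) \<le> (\<integral>\<^sup>+x. ennreal ((v x + u x)\<^sup>2) \<partial>M)"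
          using that by (intro nn_integral_mono ennreal_leI power_mono) auto
        then show ?thesis using s that(1) by (auto simp: Lp_space_2_iff)
      qed
      have "L2_continuous u" "L2_continuous v" using add le by auto
      from L2_continuous_lincomb[OF this(2,1), of 1 1] show "L2_continuous (\<lambda>x. v x + u x)" by simp
    qed
  next
    case (seq U)
    show ?case
    proof
      assume f: "f \<in> Lp_space 2 M"
      have [measurable]: "f \<in> borel_measurable M" "U i \<in> borel_measurable M" for i
        using f seq by (auto simp: Lp_space_measurable)
      have fin: "(\<integral>\<^sup>+x. ennreal ((f x)\<^sup>2) \<partial>M) < \<infinity>" using f by (simp add: Lp_space_2_iff)
      have Uf: "U i x \<le> f x" if "x \<in> space M" for i x
        using seq that by (intro incseq_le[OF _ seq(4)[OF that]]) (auto simp: incseq_def le_fun_def)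
      have UL: "U i \<in> Lp_space 2 M" for i
      proof -
        have "(\<integral>\<^sup>+x. ennreal ((U i x)\<^sup>2) \<partial>M) \<le> (\<integral>\<^sup>+x. ennreal ((f x)\<^sup>2) \<partial>M)"
          using seq Uf by (intro nn_integral_mono ennreal_leI power_mono) auto
        then show ?thesis using fin by (auto simp: Lp_space_2_iff)
      qed
      have "(\<lambda>i. \<integral>\<^sup>+x. ennreal ((f x - U i x)\<^sup>2) \<partial>M) \<longlonglongrightarrow> (\<integral>\<^sup>+x. 0 \<partial>M)"
      proof (rule nn_integral_dominated_convergence[where w = "\<lambda>x. ennreal ((f x)\<^sup>2)"])
        show "AE x in M. ennreal ((f x - U i x)\<^sup>2) \<le> ennreal ((f x)\<^sup>2)" for i
          using seq Uf by (intro AE_I2 ennreal_leI power_mono) auto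
        show "AE x in M. (\<lambda>i. ennreal ((f x - U i x)\<^sup>2)) \<longlonglongrightarrow> 0"
        proof (rule AE_I2)
          fix x assume x: "x \<in> space M"
          have "(\<lambda>i. ennreal ((f x - U i x)\<^sup>2)) \<longlonglongrightarrow> ennreal ((f x - f x)\<^sup>2)"
            using seq(4)[OF x] by (intro tendsto_intros)
          then show "(\<lambda>i. ennreal ((f x - U i x)\<^sup>2)) \<longlonglongrightarrow> 0" by simp
        qed
      qed (use fin in auto)
      then have lim: "(\<lambda>i. \<integral>\<^sup>+x. ennreal ((f x - U i x)\<^sup>2) \<partial>M) \<longlonglongrightarrow> 0" by simp
      show "L2_continuous f"
      proof (rule L2_continuous_closed[OF f])
        fix e :: real assume "0 < e"
        then have "eventually (\<lambda>i. (\<integral>\<^sup>+x. ennreal ((f x - U i x)\<^sup>2) \<partial>M) < ennreal e) sequentially"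
          using lim by (intro order_tendstoD) auto
        then obtain i where "(\<integral>\<^sup>+x. ennreal ((f x - U i x)\<^sup>2) \<partial>M) < ennreal e"
          by (auto simp: eventually_sequentially)
        then show "\<exists>g. L2_continuous g \<and> (\<integral>\<^sup>+x. ennreal ((f x - g x)\<^sup>2) \<partial>M) \<le> ennreal e"
          using seq(5)[of i] UL[of i] by (intro exI[of _ "U i"]) auto
      qed
    qed
  qed
  then show ?thesis using assms(1) by simp
qed

lemma L2_continuous_Lp_space_2:
  assumes f: "f \<in> Lp_space 2 M"
  shows "L2_continuous f"
proof -
  have [measurable]: "f \<in> borel_measurable M" using f by (rule Lp_space_measurable)
  have le: "g \<in> Lp_space 2 M" if "g \<in> borel_measurable M" "\<And>x. 0 \<le> g x" "\<And>x. g x \<le> \<bar>f x\<bar>" for g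
  proof -
    have "(\<integral>\<^sup>+x. ennreal ((g x)\<^sup>2) \<partial>M) \<le> (\<integral>\<^sup>+x. ennreal ((f x)\<^sup>2) \<partial>M)"
    proof (intro nn_integral_mono ennreal_leI)
      show "(g x)\<^sup>2 \<le> (f x)\<^sup>2" for x
        using power_mono[OF that(3,2), of x 2] by simp
    qed
    then show ?thesis using f that(1) by (auto simp: Lp_space_2_iff)
  qed
  have "L2_continuous (\<lambda>x. max (f x) 0)" "L2_continuous (\<lambda>x. max (- f x) 0)"
    by (intro L2_continuous_nonneg le; simp)+
  from L2_continuous_lincomb[OF this, of 1 "- 1"] have "L2_continuous (\<lambda>x. 1 * max (f x) 0 + - 1 * max (- f x) 0)" .
  also have "(\<lambda>x. 1 * max (f x) 0 + - 1 * max (- f x) 0) = f" by (auto simp: max_def)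
  finally show ?thesis .
qed

section \<open>The diffusion semigroup of a symmetric kernel semigroup\<close>

definition kernel_semigroup :: "real \<Rightarrow> ('a \<Rightarrow> real) \<Rightarrow> 'a \<Rightarrow> real" where
  "kernel_semigroup t f = (if t = 0 then f else kernel_op M (k t) f)"

lemma kernel_semigroup_strongly_continuous:
  assumes f: "f \<in> Lp_space 2 M"
  shows "((\<lambda>t. Lp_norm 2 M (\<lambda>x. kernel_semigroup t f x - f x)) \<longlongrightarrow> 0) (at_right 0)"
proof (rule order_tendstoI)
  fix a :: ennreal assume "0 < a"
  then obtain e where e: "0 < e" "ennreal e < a"
    by (rule ennreal_pos_less_obtain)
  have [measurable]: "f \<in> borel_measurable M" using f by (rule Lp_space_measurable)
  have "((\<lambda>t. \<integral>\<^sup>+x. ennreal ((kernel_op M (k t) f x - f x)\<^sup>2) \<partial>M) \<longlongrightarrow> 0) (at_right 0)"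
    using L2_continuous_Lp_space_2[OF f] by (simp add: L2_continuous_def)
  then have "eventually (\<lambda>t. (\<integral>\<^sup>+x. ennreal ((kernel_op M (k t) f x - f x)\<^sup>2) \<partial>M) < ennreal (e\<^sup>2)) (at_right 0)"
    using e by (intro order_tendstoD) auto
  with eventually_at_right_less[of 0]
  show "eventually (\<lambda>t. Lp_norm 2 M (\<lambda>x. kernel_semigroup t f x - f x) < a) (at_right 0)"
  proof eventually_elim
    case (elim t)
    interpret symmetric_kernel M "k t" 1 by (rule kernel[OF elim(1)])
    let ?d = "\<lambda>x. kernel_op M (k t) f x - f x"
    have [measurable]: "?d \<in> borel_measurable M" by measurable
    obtain j where j: "0 \<le> j" "(\<integral>\<^sup>+x. ennreal ((?d x)\<^sup>2) \<partial>M) = ennreal j" "j < e\<^sup>2"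
      using elim(2) by (cases "\<integral>\<^sup>+x. ennreal ((?d x)\<^sup>2) \<partial>M") (auto simp: ennreal_less_iff)
    have "Lp_norm 2 M ?d = ennreal (j powr (1 / 2))"
      using Lp_norm_ennreal[of ?d M 2] j by simp
    also have "j powr (1 / 2) \<le> e"
      using j e real_sqrt_le_mono[of j "e\<^sup>2"] by (simp add: powr_half_sqrt)
    finally (ord_eq_le_trans[OF _ ennreal_leI]) have "Lp_norm 2 M ?d \<le> ennreal e" .
    then show ?case using e elim(1) by (simp add: kernel_semigroup_def)
  qed
qed simp

lemma symmetric_diffusion_kernel_semigroup:
  "symmetric_diffusion_semigroup M (L1_plus_Linf M) kernel_semigroup"
  unfolding symmetric_diffusion_semigroup_def
proof (intro conjI allI impI ballI)
  show "sigma_finite_measure M" by (rule sigma_finite_measure_axioms)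
  show "L1_plus_Linf M \<subseteq> borel_measurable M" by (auto intro: L1_plus_Linf_measurable)
  show "(\<lambda>_. 0) \<in> L1_plus_Linf M" by (rule zero_in_L1_plus_Linf)
  show "(\<lambda>x. a * f x + b * g x) \<in> L1_plus_Linf M" if "f \<in> L1_plus_Linf M" "g \<in> L1_plus_Linf M" for f g a b
    using that by (rule L1_plus_Linf_lincomb)
  show "Lp_space p M \<subseteq> L1_plus_Linf M" if "1 \<le> p" for p using that by (rule Lp_space_subset_L1_plus_Linf)
  show "kernel_semigroup t f \<in> borel_measurable M" if "0 \<le> t" "f \<in> L1_plus_Linf M" for t f
    using that symmetric_kernel.kernel_op_measurable[OF kernel[of t], of f] L1_plus_Linf_measurable[of f M]
    by (auto simp: kernel_semigroup_def)
  show "AE x in M. kernel_semigroup t (\<lambda>y. a * f y + b * g y) x = a * kernel_semigroup t f x + b * kernel_semigroup t g x"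
    if "0 \<le> t" "f \<in> L1_plus_Linf M" "g \<in> L1_plus_Linf M" for t f g a b
    using that symmetric_kernel.kernel_op_lincomb[OF kernel[of t], of f g a b]
    by (auto simp: kernel_semigroup_def)
  show "AE x in M. kernel_semigroup 0 f x = f x" for f by (simp add: kernel_semigroup_def)
  show "Lp_norm p M (kernel_semigroup t f) \<le> Lp_norm p M f" if "1 \<le> p" "0 \<le> t" "f \<in> Lp_space p M" for p t f
    using that symmetric_kernel.Lp_norm_kernel_op_le[OF kernel[of t], of f p] Lp_space_measurable[of f p M]
    by (auto simp: kernel_semigroup_def)
  show "AE x in M. kernel_semigroup (s + t) f x = kernel_semigroup s (kernel_semigroup t f) x"
    if "1 \<le> p" "0 \<le> s" "0 \<le> t" "f \<in> Lp_space p M" for p s t f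
    using that kernel_op_compose[of f s t] Lp_space_subset_L1_plus_Linf[of p M]
    by (cases "s = 0"; cases "t = 0") (auto simp: kernel_semigroup_def)
  show "(\<integral>x. kernel_semigroup t f x * g x \<partial>M) = (\<integral>x. f x * kernel_semigroup t g x \<partial>M)"
    if "0 \<le> t" "f \<in> Lp_space 2 M" "g \<in> Lp_space 2 M" for t f g
    using that symmetric_kernel.kernel_op_symmetric[OF kernel[of t], of f g]
    by (auto simp: kernel_semigroup_def)
  show "((\<lambda>t. Lp_norm 2 M (\<lambda>x. kernel_semigroup t f x - f x)) \<longlongrightarrow> 0) (at_right 0)" if "f \<in> Lp_space 2 M" for f
    using that by (rule kernel_semigroup_strongly_continuous)
qed

lemma submarkovian_kernel_semigroup:
  "submarkovian_semigroup M (L1_plus_Linf M) kernel_semigroup"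
proof -
  have "AE x in M. 0 \<le> kernel_semigroup t f x" if t: "0 \<le> t" and f: "AE x in M. 0 \<le> f x" for t f
  proof (cases "t = 0")
    case False
    then interpret symmetric_kernel M "k t" 1 using t by (intro kernel) simp
    show ?thesis using False kernel_op_nonneg[OF _ f] by (intro AE_I2) (simp add: kernel_semigroup_def)
  qed (use f in \<open>simp add: kernel_semigroup_def\<close>)
  moreover have "AE x in M. kernel_semigroup t (\<lambda>_. 1) x \<le> 1" if t: "0 \<le> t" for t
  proof (cases "t = 0")
    case False
    then interpret symmetric_kernel M "k t" 1 using t by (intro kernel) simp
    have "kernel_op M (k t) (\<lambda>_. 1) x \<le> 1" if x: "x \<in> space M" for x
    proof -
      have "ennreal (kernel_op M (k t) (\<lambda>_. 1) x) \<le> ennreal 1"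
        using kernel_mass[OF x] by (subst ennreal_kernel_op[OF x]) auto
      then show ?thesis by (subst (asm) ennreal_le_iff) auto
    qed
    then show ?thesis using False by (intro AE_I2) (simp add: kernel_semigroup_def)
  qed (simp add: kernel_semigroup_def)
  ultimately show ?thesis
    using symmetric_diffusion_kernel_semigroup
    by (simp add: submarkovian_semigroup_def positive_operators_def)
qed

end

section \<open>The Laguerre semigroup\<close>

lemma open_pos_orthant: "open {x :: real ^ 'n. \<forall>i. 0 < x $ i}"
proof -
  have "{x :: real ^ 'n. \<forall>i. 0 < x $ i} = (\<Inter>i. {x. 0 < x $ i})" by auto
  moreover have "open {x :: real ^ 'n. 0 < x $ i}" for i
    by (intro open_Collect_less continuous_intros)
  ultimately show ?thesis by (auto intro!: open_INT)
qed

lemma sets_pos_orthant_borel [measurable]: "{x :: real ^ 'n. \<forall>i. 0 < x $ i} \<in> sets borel"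
  using open_pos_orthant by (rule borel_open)

lemma space_pos_orthant: "space pos_orthant = {x :: real ^ 'n. \<forall>i. 0 < x $ i}"
  by (simp add: pos_orthant_def space_restrict_space)

lemma nn_integral_pos_orthant:
  "(\<integral>\<^sup>+x. f x \<partial>pos_orthant) = (\<integral>\<^sup>+x. f x * indicator {x. \<forall>i. 0 < x $ i} x \<partial>lborel)"
  unfolding pos_orthant_def by (subst nn_integral_restrict_space) simp_all

lemma sigma_finite_pos_orthant: "sigma_finite_measure pos_orthant"
  unfolding pos_orthant_def
  by (intro sigma_finite_measure_restrict_space sigma_finite_lborel) simp

lemma sets_pos_orthant_iff: "A \<in> sets pos_orthant \<longleftrightarrow> A \<in> sets borel \<and> A \<subseteq> {x. \<forall>i. 0 < x $ i}"
  unfolding pos_orthant_def by (subst sets_restrict_space_iff) auto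

lemma emeasure_pos_orthant: "A \<subseteq> {x. \<forall>i. 0 < x $ i} \<Longrightarrow> emeasure pos_orthant A = emeasure lborel A"
  unfolding pos_orthant_def by (subst emeasure_restrict_space) auto

lemma borel_measurable_vec_nth [measurable]: "(\<lambda>x :: real ^ 'n. x $ i) \<in> borel_measurable borel"
  by (intro borel_measurable_continuous_onI continuous_intros)

lemma borel_measurable_pos_orthant_nth [measurable]: "(\<lambda>x :: real ^ 'n. x $ i) \<in> borel_measurable pos_orthant"
  unfolding pos_orthant_def by (rule measurable_restrict_space1) simp

text \<open>The indicator of the orthant is itself a product over the coordinates, so Tonelli
  factorises the integral.\<close>

lemma nn_integral_pos_orthant_prod:
  fixes F :: "'n::finite \<Rightarrow> real \<Rightarrow> ennreal"
  assumes [measurable]: "\<And>i. F i \<in> borel_measurable borel"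
  shows "(\<integral>\<^sup>+y. (\<Prod>i\<in>UNIV. F i (y $ i)) \<partial>pos_orthant) = (\<Prod>i\<in>UNIV. \<integral>\<^sup>+y. F i y * indicator {0<..} y \<partial>lborel)"
proof -
  \<comment> \<open>The product formula for Lebesgue measure runs over \<open>Basis\<close>;
    \<open>e\<close> and its inverse \<open>ix\<close> translate between basis vectors and
    indices.\<close>
  define e :: "'n \<Rightarrow> real ^ 'n" where "e = (\<lambda>i. axis i 1)"
  define ix :: "real ^ 'n \<Rightarrow> 'n" where "ix = inv e"
  have inj: "inj e" by (auto simp: e_def inj_def axis_eq_axis)
  have ix: "ix (e i) = i" for i unfolding ix_def by (rule inv_f_f[OF inj])
  have B: "(Basis :: (real ^ 'n) set) = range e" by (auto simp: Basis_vec_def e_def)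
  let ?G = "\<lambda>b y. F (ix b) y * indicator {0<..} y"
  have re: "(\<Prod>b\<in>Basis. h b) = (\<Prod>i\<in>UNIV. h (e i))" for h :: "real ^ 'n \<Rightarrow> ennreal"
    unfolding B by (subst prod.reindex[OF inj]) simp
  have "(\<Prod>i\<in>UNIV. F i (y $ i)) * indicator {x. \<forall>i. 0 < x $ i} y = (\<Prod>b\<in>Basis. ?G b (y \<bullet> b))" for y :: "real ^ 'n"
  proof -
    have "(\<Prod>b\<in>Basis. ?G b (y \<bullet> b)) = (\<Prod>i\<in>UNIV. F i (y $ i) * indicator {0<..} (y $ i))"
      unfolding re ix by (simp add: e_def cart_eq_inner_axis[symmetric])
    also have "\<dots> = (\<Prod>i\<in>UNIV. F i (y $ i)) * (\<Prod>i\<in>UNIV. indicator {0<..} (y $ i))"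
      by (rule prod.distrib)
    also have "(\<Prod>i\<in>UNIV. indicator {0<..} (y $ i) :: ennreal) = indicator {x. \<forall>i. 0 < x $ i} y"
    proof (cases "\<forall>i. 0 < y $ i")
      case False
      then obtain i where "\<not> 0 < y $ i" by auto
      then have "(\<Prod>i\<in>UNIV. indicator {0<..} (y $ i) :: ennreal) = 0"
        by (intro prod_zero bexI[of _ i]) (auto simp: indicator_def)
      then show ?thesis using False by simp
    qed simp
    finally show ?thesis by simp
  qed
  then have "(\<integral>\<^sup>+y. (\<Prod>i\<in>UNIV. F i (y $ i)) \<partial>pos_orthant) = (\<integral>\<^sup>+y. (\<Prod>b\<in>Basis. ?G b (y \<bullet> b)) \<partial>(lborel :: (real ^ 'n) measure))"
    by (simp only: nn_integral_pos_orthant)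
  also have "\<dots> = (\<Prod>b\<in>Basis. \<integral>\<^sup>+y. ?G b y \<partial>lborel)"
    by (rule nn_integral_lborel_prod) auto
  finally show ?thesis unfolding re ix .
qed

section \<open>The kernel on the orthant as a tensor product\<close>

lemma laguerre_kernel_eq_prod:
  "laguerre_kernel \<alpha> t x y = (\<Prod>i\<in>UNIV. laguerre_kernel1 (\<alpha> $ i) t (x $ i) (y $ i))"
proof -
  have n: "(norm z)\<^sup>2 = (\<Sum>i\<in>UNIV. (z $ i)\<^sup>2)" for z :: "real ^ 'a"
    unfolding power2_norm_eq_inner inner_vec_def by (simp add: power2_eq_square)
  have "exp (- (1 / 2) * (cosh (2 * t) / sinh (2 * t)) * ((norm x)\<^sup>2 + (norm y)\<^sup>2))
    = (\<Prod>i\<in>UNIV. exp (- (1 / 2) * (cosh (2 * t) / sinh (2 * t)) * ((x $ i)\<^sup>2 + (y $ i)\<^sup>2)))"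
    unfolding n sum.distrib[symmetric] sum_distrib_left by (rule exp_sum) simp
  moreover have "1 / sinh (2 * t) ^ CARD('a) = (\<Prod>i\<in>(UNIV :: 'a set). 1 / sinh (2 * t))"
    by (simp add: power_one_over)
  ultimately show ?thesis
    unfolding laguerre_kernel_def laguerre_kernel1_def prod.distrib by simp
qed

lemma laguerre_kernel_nonneg:
  assumes "\<And>i. - 1 < \<alpha> $ i" "0 < t" "x \<in> space pos_orthant" "y \<in> space pos_orthant"
  shows "0 \<le> laguerre_kernel \<alpha> t x y"
  unfolding laguerre_kernel_eq_prod using assms
  by (intro prod_nonneg ballI laguerre_kernel1_nonneg) (auto simp: space_pos_orthant less_imp_le)

lemma ennreal_laguerre_kernel:
  assumes "\<And>i. - 1 < \<alpha> $ i" "0 < t" "x \<in> space pos_orthant" "y \<in> space pos_orthant"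
  shows "ennreal (laguerre_kernel \<alpha> t x y) = (\<Prod>i\<in>UNIV. ennreal (laguerre_kernel1 (\<alpha> $ i) t (x $ i) (y $ i)))"
  unfolding laguerre_kernel_eq_prod using assms
  by (intro prod_ennreal[symmetric] laguerre_kernel1_nonneg) (auto simp: space_pos_orthant less_imp_le)

lemma laguerre_semigroup_eq_kernel_op:
  "t \<noteq> 0 \<Longrightarrow> laguerre_semigroup \<alpha> t = kernel_op pos_orthant (laguerre_kernel \<alpha> t)"
  by (intro ext) (simp add: laguerre_semigroup_def kernel_op_def)

lemma nn_integral_laguerre_kernel:
  fixes \<alpha> :: "real ^ 'n"
  assumes \<alpha>: "\<And>i. - 1 / 2 \<le> \<alpha> $ i" and t: "0 < t" and x: "x \<in> space pos_orthant"
  shows "(\<integral>\<^sup>+y. ennreal (laguerre_kernel \<alpha> t x y) \<partial>pos_orthant)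
    = (\<Prod>i\<in>UNIV. ennreal (cosh (2 * t) powr (- 1 / 2) * exp (- ((x $ i)\<^sup>2 / (2 * sinh (2 * t) * cosh (2 * t)) * (sinh (2 * t))\<^sup>2)))
        * laguerre_mass ((\<alpha> $ i + 1 / 2) / 2) ((x $ i)\<^sup>2 / (2 * sinh (2 * t) * cosh (2 * t))))"
proof -
  have a: "- 1 < \<alpha> $ i" for i using \<alpha>[of i] by simp
  have "(\<integral>\<^sup>+y. ennreal (laguerre_kernel \<alpha> t x y) \<partial>pos_orthant)
    = (\<integral>\<^sup>+y. (\<Prod>i\<in>UNIV. ennreal (laguerre_kernel1 (\<alpha> $ i) t (x $ i) (y $ i))) \<partial>pos_orthant)"
    by (intro nn_integral_cong ennreal_laguerre_kernel a t x)
  also have "\<dots> = (\<Prod>i\<in>UNIV. \<integral>\<^sup>+y. ennreal (laguerre_kernel1 (\<alpha> $ i) t (x $ i) y) * indicator {0<..} y \<partial>lborel)"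
    by (rule nn_integral_pos_orthant_prod) measurable
  also have "\<dots> = (\<Prod>i\<in>UNIV. ennreal (cosh (2 * t) powr (- 1 / 2) * exp (- ((x $ i)\<^sup>2 / (2 * sinh (2 * t) * cosh (2 * t)) * (sinh (2 * t))\<^sup>2)))
        * laguerre_mass ((\<alpha> $ i + 1 / 2) / 2) ((x $ i)\<^sup>2 / (2 * sinh (2 * t) * cosh (2 * t))))"
  proof (intro prod.cong refl)
    fix i
    have "2 * ((\<alpha> $ i + 1 / 2) / 2) - 1 / 2 = \<alpha> $ i" by (simp add: field_simps)
    moreover have "0 \<le> (\<alpha> $ i + 1 / 2) / 2" using \<alpha>[of i] by simp
    moreover have "0 < x $ i" using x by (simp add: space_pos_orthant)
    ultimately show "(\<integral>\<^sup>+y. ennreal (laguerre_kernel1 (\<alpha> $ i) t (x $ i) y) * indicator {0<..} y \<partial>lborel)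
      = ennreal (cosh (2 * t) powr (- 1 / 2) * exp (- ((x $ i)\<^sup>2 / (2 * sinh (2 * t) * cosh (2 * t)) * (sinh (2 * t))\<^sup>2)))
        * laguerre_mass ((\<alpha> $ i + 1 / 2) / 2) ((x $ i)\<^sup>2 / (2 * sinh (2 * t) * cosh (2 * t)))"
      using nn_integral_laguerre_kernel1[of "(\<alpha> $ i + 1 / 2) / 2" t "x $ i"] t by simp
  qed
  finally show ?thesis .
qed

text \<open>The damping exp (- u sinh^2) is at most 1 and is dropped; a factor cosh^(-1/2) from each
  coordinate gives the exponent - d/2.\<close>

lemma nn_integral_laguerre_kernel_le:
  fixes \<alpha> :: "real ^ 'n"
  assumes \<alpha>: "\<And>i. - 1 / 2 \<le> \<alpha> $ i" and t: "0 < t" and x: "x \<in> space pos_orthant"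
    and B: "\<And>i. 0 \<le> B i" "\<And>i u. 0 < u \<Longrightarrow> laguerre_mass ((\<alpha> $ i + 1 / 2) / 2) u \<le> ennreal (B i)"
  shows "(\<integral>\<^sup>+y. ennreal (laguerre_kernel \<alpha> t x y) \<partial>pos_orthant) \<le> ennreal ((\<Prod>i\<in>UNIV. B i) * cosh (2 * t) powr (- real CARD('n) / 2))"
proof -
  have "(\<integral>\<^sup>+y. ennreal (laguerre_kernel \<alpha> t x y) \<partial>pos_orthant) \<le> (\<Prod>i\<in>(UNIV :: 'n set). ennreal (cosh (2 * t) powr (- 1 / 2)) * ennreal (B i))"
    unfolding nn_integral_laguerre_kernel[OF \<alpha> t x]
  proof (intro prod_mono_ennreal mult_mono ennreal_leI B)
    fix i
    show "cosh (2 * t) powr (- 1 / 2) * exp (- ((x $ i)\<^sup>2 / (2 * sinh (2 * t) * cosh (2 * t)) * (sinh (2 * t))\<^sup>2)) \<le> cosh (2 * t) powr (- 1 / 2)"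
      using t by (intro mult_right_le_one_le) auto
    have "0 < x $ i" using x by (simp add: space_pos_orthant)
    then show "0 < (x $ i)\<^sup>2 / (2 * sinh (2 * t) * cosh (2 * t))" using t by simp
  qed auto
  also have "\<dots> = (\<Prod>i\<in>(UNIV :: 'n set). ennreal (cosh (2 * t) powr (- 1 / 2) * B i))"
    using B by (intro prod.cong refl) (simp add: ennreal_mult)
  also have "\<dots> = ennreal (\<Prod>i\<in>(UNIV :: 'n set). cosh (2 * t) powr (- 1 / 2) * B i)"
    using B by (intro prod_ennreal) simp
  also have "(\<Prod>i\<in>(UNIV :: 'n set). cosh (2 * t) powr (- 1 / 2) * B i) = (\<Prod>i\<in>UNIV. B i) * (cosh (2 * t) powr (- 1 / 2)) ^ CARD('n)"
    by (simp add: prod.distrib)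
  also have "(cosh (2 * t) powr (- 1 / 2)) ^ CARD('n) = cosh (2 * t) powr (- real CARD('n) / 2)"
    by (simp add: powr_realpow[symmetric] powr_powr)
  finally show ?thesis .
qed

lemma laguerre_kernel_measurable:
  "(\<lambda>(x, y). laguerre_kernel \<alpha> t x y) \<in> borel_measurable (pos_orthant \<Otimes>\<^sub>M pos_orthant)"
  unfolding laguerre_kernel_eq_prod by measurable

lemma symmetric_laguerre_kernel:
  fixes \<alpha> :: "real ^ 'n"
  assumes \<alpha>: "\<And>i. - 1 / 2 \<le> \<alpha> $ i" and t: "0 < t"
    and K: "0 < K" "\<And>x. x \<in> space pos_orthant \<Longrightarrow> (\<integral>\<^sup>+y. ennreal (laguerre_kernel \<alpha> t x y) \<partial>pos_orthant) \<le> ennreal K"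
  shows "symmetric_kernel pos_orthant (laguerre_kernel \<alpha> t) K"
proof -
  have a: "- 1 < \<alpha> $ i" for i using \<alpha>[of i] by simp
  have "laguerre_kernel \<alpha> t x y = laguerre_kernel \<alpha> t y x" for x y
    unfolding laguerre_kernel_eq_prod by (intro prod.cong refl laguerre_kernel1_commute)
  then show ?thesis
    by (intro symmetric_kernel.intro symmetric_kernel_axioms.intro sigma_finite_pos_orthant
        laguerre_kernel_measurable laguerre_kernel_nonneg a t K)
qed

lemma laguerre_kernel_compose:
  fixes \<alpha> :: "real ^ 'n"
  assumes \<alpha>: "\<And>i. - 1 < \<alpha> $ i" and s: "0 < s" and t: "0 < t"
    and x: "x \<in> space pos_orthant" and z: "z \<in> space pos_orthant"
  shows "(\<integral>\<^sup>+y. ennreal (laguerre_kernel \<alpha> s x y) * ennreal (laguerre_kernel \<alpha> t y z) \<partial>pos_orthant)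
    = ennreal (laguerre_kernel \<alpha> (s + t) x z)"
proof -
  have "(\<integral>\<^sup>+y. ennreal (laguerre_kernel \<alpha> s x y) * ennreal (laguerre_kernel \<alpha> t y z) \<partial>pos_orthant)
    = (\<integral>\<^sup>+y. (\<Prod>i\<in>UNIV. ennreal (laguerre_kernel1 (\<alpha> $ i) s (x $ i) (y $ i)) * ennreal (laguerre_kernel1 (\<alpha> $ i) t (y $ i) (z $ i))) \<partial>pos_orthant)"
    by (intro nn_integral_cong) (simp only: ennreal_laguerre_kernel[OF \<alpha> s x] ennreal_laguerre_kernel[OF \<alpha> t _ z] prod.distrib)
  also have "\<dots> = (\<Prod>i\<in>UNIV. \<integral>\<^sup>+y. ennreal (laguerre_kernel1 (\<alpha> $ i) s (x $ i) y) * ennreal (laguerre_kernel1 (\<alpha> $ i) t y (z $ i)) * indicator {0<..} y \<partial>lborel)"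
    by (rule nn_integral_pos_orthant_prod) measurable
  also have "\<dots> = (\<Prod>i\<in>UNIV. ennreal (laguerre_kernel1 (\<alpha> $ i) (s + t) (x $ i) (z $ i)))"
    using x z by (intro prod.cong refl laguerre_kernel1_semigroup \<alpha> s t) (auto simp: space_pos_orthant)
  also have "\<dots> = ennreal (laguerre_kernel \<alpha> (s + t) x z)"
    using s t by (intro ennreal_laguerre_kernel[symmetric] \<alpha> x z) simp
  finally show ?thesis .
qed

text \<open>The upper bound is the mass bound 1. For the lower bound U is replaced by a box around
  x, on which the integral is a product of one-dimensional ones.\<close>

lemma laguerre_kernel_approximate_identity:
  fixes \<alpha> :: "real ^ 'n" and x :: "real ^ 'n"
  assumes \<alpha>: "\<And>i. - 1 / 2 \<le> \<alpha> $ i" and K: "\<And>t. 0 < t \<Longrightarrow> symmetric_kernel pos_orthant (laguerre_kernel \<alpha> t) 1"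
    and U: "open U" "x \<in> U" "U \<subseteq> space pos_orthant"
  shows "((\<lambda>t. kernel_op pos_orthant (laguerre_kernel \<alpha> t) (indicator U) x) \<longlongrightarrow> 1) (at_right 0)"
proof (rule order_tendstoI)
  have a: "- 1 < \<alpha> $ i" for i using \<alpha>[of i] by simp
  have x: "x \<in> space pos_orthant" using U by auto
  have Us: "U \<in> sets pos_orthant" using U by (auto simp: sets_pos_orthant_iff space_pos_orthant)
  let ?w = "\<lambda>t. kernel_op pos_orthant (laguerre_kernel \<alpha> t) (indicator U) x"
  have w: "ennreal (?w t) = (\<integral>\<^sup>+y. ennreal (laguerre_kernel \<alpha> t x y) * ennreal (indicator U y) \<partial>pos_orthant)" if t: "0 < t" for t
    using x Us by (intro symmetric_kernel.ennreal_kernel_op[OF K[OF t]]) auto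
  fix c :: real
  {
    assume c: "1 < c"
    have "?w t < c" if t: "0 < t" for t
    proof -
      have "ennreal (?w t) \<le> (\<integral>\<^sup>+y. ennreal (laguerre_kernel \<alpha> t x y) * 1 \<partial>pos_orthant)"
        unfolding w[OF t] by (intro nn_integral_mono mult_left_mono) (auto simp: indicator_def)
      also have "\<dots> \<le> ennreal 1" using symmetric_kernel.kernel_mass[OF K[OF t] x] by simp
      finally have "?w t \<le> 1" by (subst (asm) ennreal_le_iff) auto
      then show ?thesis using c by simp
    qed
    then show "eventually (\<lambda>t. ?w t < c) (at_right 0)"
      by (rule eventually_mono[OF eventually_at_right_less])
  next
    assume c: "c < 1"
    \<comment> \<open>Concentration gives each coordinate a mass of at least any prescribed b < 1; b
      has to be so close to 1 that the product b^d still exceeds c. Its positivity serves for c <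
      0.\<close>
    have "((\<lambda>b. b ^ CARD('n)) \<longlongrightarrow> 1 ^ CARD('n)) (at_left (1::real))" by (intro tendsto_intros)
    then have "eventually (\<lambda>b. c < b ^ CARD('n)) (at_left (1::real))" using c by (intro order_tendstoD) auto
    moreover have "eventually (\<lambda>b. 0 < b) (at_left (1::real))" by (rule order_tendstoD[OF tendsto_ident_at]) simp
    moreover have "eventually (\<lambda>b. b < 1) (at_left (1::real))" by (simp add: eventually_at_filter)
    ultimately have "eventually (\<lambda>b. c < b ^ CARD('n) \<and> 0 < b \<and> b < 1) (at_left (1::real))"
      by eventually_elim auto
    then obtain b :: real where b: "c < b ^ CARD('n)" "0 < b" "b < 1" by (auto dest!: eventually_happens)
    obtain r where r: "0 < r" "ball x r \<subseteq> U" using U open_contains_ball by blast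
    \<comment> \<open>The Euclidean norm is at most the sum of the moduli of the coordinates, so a
      box of this half-width lies in the ball of radius r.\<close>
    define \<rho> where "\<rho> = r / real CARD('n)"
    have \<rho>: "0 < \<rho>" using r by (simp add: \<rho>_def)
    let ?I = "\<lambda>i. {x $ i - \<rho><..<x $ i + \<rho>} \<inter> {0<..}"
    have box: "y \<in> U" if y: "\<And>i. y $ i \<in> ?I i" for y :: "real ^ 'n"
    proof -
      have "norm (y - x) \<le> (\<Sum>i\<in>UNIV. \<bar>(y - x) $ i\<bar>)" by (rule norm_le_l1_cart)
      also have "\<dots> < (\<Sum>i\<in>(UNIV :: 'n set). \<rho>)"
      proof (rule sum_strict_mono)
        show "\<bar>(y - x) $ i\<bar> < \<rho>" for i using y[of i] by (auto simp: abs_less_iff)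
      qed auto
      also have "\<dots> = r" by (simp add: \<rho>_def)
      finally show ?thesis using r by (auto simp: dist_norm norm_minus_commute)
    qed
    have "eventually (\<lambda>t. \<forall>i. ennreal b \<le> (\<integral>\<^sup>+y. ennreal (laguerre_kernel1 (\<alpha> $ i) t (x $ i) y) * indicator (?I i) y \<partial>lborel)) (at_right 0)"
      using x b by (intro eventually_all_finite laguerre_kernel1_concentration \<alpha> \<rho>) (auto simp: space_pos_orthant)
    with eventually_at_right_less[of 0] show "eventually (\<lambda>t. c < ?w t) (at_right 0)"
    proof eventually_elim
      case (elim t)
      have "ennreal (b ^ CARD('n)) = (\<Prod>i\<in>(UNIV :: 'n set). ennreal b)" using b by (simp add: ennreal_power)
      also have "\<dots> \<le> (\<Prod>i\<in>UNIV. \<integral>\<^sup>+y. ennreal (laguerre_kernel1 (\<alpha> $ i) t (x $ i) y) * indicator (?I i) y * indicator {0<..} y \<partial>lborel)"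
      proof (intro prod_mono_ennreal)
        fix i
        have "indicator (?I i) y * indicator {0<..} y = (indicator (?I i) y :: ennreal)" for y by (auto simp: indicator_def)
        then show "ennreal b \<le> (\<integral>\<^sup>+y. ennreal (laguerre_kernel1 (\<alpha> $ i) t (x $ i) y) * indicator (?I i) y * indicator {0<..} y \<partial>lborel)"
          using elim(2) by (simp only: mult.assoc)
      qed
      also have "\<dots> = (\<integral>\<^sup>+y. (\<Prod>i\<in>UNIV. ennreal (laguerre_kernel1 (\<alpha> $ i) t (x $ i) (y $ i)) * indicator (?I i) (y $ i)) \<partial>pos_orthant)"
        by (rule nn_integral_pos_orthant_prod[symmetric]) measurable
      also have "\<dots> \<le> ennreal (?w t)"
        unfolding w[OF elim(1)]
      proof (rule nn_integral_mono)
        fix y :: "real ^ 'n" assume y: "y \<in> space pos_orthant"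
        have "(\<Prod>i\<in>UNIV. indicator (?I i) (y $ i) :: ennreal) \<le> ennreal (indicator U y)"
        proof (cases "\<forall>i. y $ i \<in> ?I i")
          case True
          then show ?thesis using box[of y] by simp
        next
          case False
          then obtain i where "y $ i \<notin> ?I i" by auto
          then have "(\<Prod>i\<in>UNIV. indicator (?I i) (y $ i) :: ennreal) = 0"
            by (intro prod_zero bexI[of _ i]) (auto simp: indicator_def)
          then show ?thesis by (rule ord_eq_le_trans) simp
        qed
        then show "(\<Prod>i\<in>UNIV. ennreal (laguerre_kernel1 (\<alpha> $ i) t (x $ i) (y $ i)) * indicator (?I i) (y $ i))
          \<le> ennreal (laguerre_kernel \<alpha> t x y) * ennreal (indicator U y)"
          unfolding ennreal_laguerre_kernel[OF a elim(1) x y] prod.distrib by (intro mult_left_mono) auto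
      qed
      finally have "ennreal (b ^ CARD('n)) \<le> ennreal (?w t)" .
      moreover have "0 < b ^ CARD('n)" using b by simp
      ultimately have "b ^ CARD('n) \<le> ?w t"
        by (metis ennreal_le_iff2 not_le)
      then show ?case using b by simp
    qed
  }
qed

text \<open>Outer regularity of Lebesgue measure supplies an open V around A; as the orthant is
  open, cutting V down to it keeps it open.\<close>

lemma symmetric_laguerre_kernel_semigroup:
  fixes \<alpha> :: "real ^ 'n"
  assumes \<alpha>: "\<And>i. - 1 / 2 \<le> \<alpha> $ i"
    and K: "\<And>t. 0 < t \<Longrightarrow> symmetric_kernel pos_orthant (laguerre_kernel \<alpha> t) 1"
  shows "symmetric_kernel_semigroup pos_orthant (laguerre_kernel \<alpha>)"
proof (intro symmetric_kernel_semigroup.intro symmetric_kernel_semigroup_axioms.intro sigma_finite_pos_orthant K)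
  have a: "- 1 < \<alpha> $ i" for i using \<alpha>[of i] by simp
  show "(\<integral>\<^sup>+y. ennreal (laguerre_kernel \<alpha> s x y) * ennreal (laguerre_kernel \<alpha> t y z) \<partial>pos_orthant) = ennreal (laguerre_kernel \<alpha> (s + t) x z)"
    if "0 < s" "0 < t" "x \<in> space pos_orthant" "z \<in> space pos_orthant" for s t x z
    using that by (intro laguerre_kernel_compose a)
  fix A :: "(real ^ 'n) set" and e :: real
  assume A: "A \<in> sets pos_orthant" and e: "0 < e"
  then have Ab: "A \<in> sets borel" and As: "A \<subseteq> space pos_orthant" by (auto simp: sets_pos_orthant_iff space_pos_orthant)
  obtain V where V: "open V" "A \<subseteq> V" "emeasure lborel (V - A) < e"
    using outer_regular_lborel[OF Ab e] .
  define U where "U = V \<inter> space pos_orthant"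
  have oU: "open U" unfolding U_def space_pos_orthant by (intro open_Int V open_pos_orthant)
  have "emeasure pos_orthant (U - A) = emeasure lborel (U - A)"
    by (rule emeasure_pos_orthant) (auto simp: U_def space_pos_orthant)
  also have "\<dots> \<le> emeasure lborel (V - A)" using V Ab by (intro emeasure_mono) (auto simp: U_def)
  also have "\<dots> \<le> ennreal e" using V by simp
  finally have le: "emeasure pos_orthant (U - A) \<le> ennreal e" .
  show "\<exists>U\<in>sets pos_orthant. A \<subseteq> U \<and> emeasure pos_orthant (U - A) \<le> ennreal e \<and>
    (\<forall>x\<in>U. ((\<lambda>t. kernel_op pos_orthant (laguerre_kernel \<alpha> t) (indicator U) x) \<longlongrightarrow> 1) (at_right 0))"
  proof (intro bexI[of _ U] conjI ballI le)
    show "A \<subseteq> U" using V As by (auto simp: U_def)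
    show "U \<in> sets pos_orthant" using oU by (auto simp: sets_pos_orthant_iff U_def space_pos_orthant)
    show "((\<lambda>t. kernel_op pos_orthant (laguerre_kernel \<alpha> t) (indicator U) x) \<longlongrightarrow> 1) (at_right 0)" if "x \<in> U" for x
      using that by (intro laguerre_kernel_approximate_identity \<alpha> K oU) (auto simp: U_def)
  qed
qed

section \<open>Open sets of positive measure and the failure of contractivity\<close>

lemma AE_pos_orthant_open:
  assumes "open Q" "Q \<subseteq> space pos_orthant" "AE x in pos_orthant. x \<notin> Q"
  shows "Q = {}"
proof -
  have Qs: "Q \<in> sets pos_orthant" using assms by (auto simp: sets_pos_orthant_iff space_pos_orthant)
  have "emeasure pos_orthant Q = 0"
    using assms(3) AE_iff_null_sets[OF Qs] by auto
  then have "emeasure lborel Q = 0" using assms by (simp add: emeasure_pos_orthant space_pos_orthant)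
  then have "Q \<in> null_sets lborel" using assms(1) by (auto simp: null_sets_def)
  then have "negligible Q" unfolding negligible_iff_null_sets by (rule null_sets_completionI)
  then show ?thesis using open_not_negligible[OF assms(1)] by auto
qed

lemma pos_orthant_nonempty: "(\<chi> i. 1) \<in> space pos_orthant"
  by (simp add: space_pos_orthant)

text \<open>The factor with order in \<open>(- 1 / 2, 1 / 2)\<close> has mass \<open>> 1 + \<epsilon>\<close> on an interval; the masses of the
  other factors can be made as close to \<open>1\<close> as desired by moving far out, after which \<open>t\<close> is chosen small.\<close>

lemma laguerre_kernel_mass_gt_1:
  fixes \<alpha> :: "real ^ 'n"
  assumes \<alpha>: "\<And>i. - 1 / 2 \<le> \<alpha> $ i" and j: "\<alpha> $ j \<in> {- 1 / 2<..<1 / 2}"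
  obtains t Q where "0 < t" "open Q" "Q \<noteq> {}" "Q \<subseteq> space pos_orthant"
    "\<And>x. x \<in> Q \<Longrightarrow> 1 < (\<integral>\<^sup>+y. ennreal (laguerre_kernel \<alpha> t x y) \<partial>pos_orthant)"
proof -
  let ?\<beta> = "\<lambda>i. (\<alpha> $ i + 1 / 2) / 2"
  have \<beta>: "0 \<le> ?\<beta> i" for i using \<alpha>[of i] by simp
  define \<gamma> where "\<gamma> = ?\<beta> j * (1 / 2 - ?\<beta> j)"
  have \<beta>j: "0 < ?\<beta> j" "?\<beta> j < 1 / 2" using j by auto
  then have \<gamma>: "0 < \<gamma>" unfolding \<gamma>_def by (intro mult_pos_pos) auto
  have "eventually (\<lambda>u. ennreal (1 + \<gamma> / (2 * u)) \<le> laguerre_mass (?\<beta> j) u \<and> 0 < u) at_top"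
    unfolding \<gamma>_def by (intro eventually_conj eventually_laguerre_mass_gt_1 \<beta>j eventually_gt_at_top)
  then obtain U where "\<forall>u\<ge>U. ennreal (1 + \<gamma> / (2 * u)) \<le> laguerre_mass (?\<beta> j) u \<and> 0 < u"
    by (auto simp: eventually_at_top_linorder)
  then have U: "0 < U" "\<And>u. U \<le> u \<Longrightarrow> ennreal (1 + \<gamma> / (2 * u)) \<le> laguerre_mass (?\<beta> j) u" by auto
  \<comment> \<open>The value of the gain \<gamma> / (2 u) at u = 2 U, so it is available for all u
    in [U, 2 U]. An interval rather than a single u is needed to obtain an open set of points
    x.\<close>
  define \<epsilon> where "\<epsilon> = \<gamma> / (4 * U)"
  have \<epsilon>: "0 < \<epsilon>" using \<gamma> U by (simp add: \<epsilon>_def)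
  have Uj: "ennreal (1 + \<epsilon>) \<le> laguerre_mass (?\<beta> j) u" if "U \<le> u" "u \<le> 2 * U" for u
  proof -
    have "\<epsilon> \<le> \<gamma> / (2 * u)" unfolding \<epsilon>_def using that U \<gamma> by (intro divide_left_mono) auto
    then have "ennreal (1 + \<epsilon>) \<le> ennreal (1 + \<gamma> / (2 * u))" by (intro ennreal_leI) simp
    also have "\<dots> \<le> laguerre_mass (?\<beta> j) u" by (rule U(2)[OF that(1)])
    finally show ?thesis .
  qed
  \<comment> \<open>In every coordinate one factor c is reserved for the damping and one for the
    mass; the surplus 1 + \<epsilon> of the coordinate j must outweigh all of them.\<close>
  have "((\<lambda>c. (c * c) ^ CARD('n) * (1 + \<epsilon>)) \<longlongrightarrow> (1 * 1) ^ CARD('n) * (1 + \<epsilon>)) (at_left (1::real))"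
    by (intro tendsto_intros)
  then have "eventually (\<lambda>c. 1 < (c * c) ^ CARD('n) * (1 + \<epsilon>)) (at_left (1::real))" using \<epsilon> by (intro order_tendstoD) auto
  moreover have "eventually (\<lambda>c. 0 < c) (at_left (1::real))" by (rule order_tendstoD[OF tendsto_ident_at]) simp
  moreover have "eventually (\<lambda>c. c < 1) (at_left (1::real))" by (simp add: eventually_at_filter)
  ultimately have "eventually (\<lambda>c. 1 < (c * c) ^ CARD('n) * (1 + \<epsilon>) \<and> 0 < c \<and> c < 1) (at_left (1::real))"
    by eventually_elim auto
  then obtain c :: real where c: "1 < (c * c) ^ CARD('n) * (1 + \<epsilon>)" "0 < c" "c < 1" by (auto dest!: eventually_happens)
  have "eventually (\<lambda>u. (\<forall>i. ennreal c \<le> laguerre_mass (?\<beta> i) u) \<and> 0 < u) at_top"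
    by (intro eventually_conj eventually_all_finite eventually_laguerre_mass_ge \<beta> c eventually_gt_at_top)
  then obtain V where "\<forall>u\<ge>V. (\<forall>i. ennreal c \<le> laguerre_mass (?\<beta> i) u) \<and> 0 < u"
    by (auto simp: eventually_at_top_linorder)
  then have V: "0 < V" "\<And>u i. V \<le> u \<Longrightarrow> ennreal c \<le> laguerre_mass (?\<beta> i) u" by auto
  define lo where "lo = (\<lambda>i. if i = j then U else V)"
  have lo: "0 < lo i" for i using U V by (simp add: lo_def)
  \<comment> \<open>A common bound for u in all coordinates. It is fixed before t, so that t can be
    chosen to make the damping exceed c uniformly.\<close>
  define W where "W = max (2 * U) (2 * V)"
  have W: "2 * lo i \<le> W" for i by (simp add: W_def lo_def)
  have "isCont (\<lambda>t::real. cosh (2 * t) powr (- 1 / 2) * exp (- (W * (sinh (2 * t))\<^sup>2))) 0"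
    by (intro continuous_intros) auto
  then have "((\<lambda>t::real. cosh (2 * t) powr (- 1 / 2) * exp (- (W * (sinh (2 * t))\<^sup>2))) \<longlongrightarrow> 1) (at_right 0)"
    by (auto simp: isCont_def intro: filterlim_mono[OF _ order_refl at_le])
  then have "eventually (\<lambda>t::real. c < cosh (2 * t) powr (- 1 / 2) * exp (- (W * (sinh (2 * t))\<^sup>2))) (at_right 0)"
    using c by (intro order_tendstoD) auto
  with eventually_at_right_less[of 0] have "eventually (\<lambda>t::real. 0 < t \<and> c < cosh (2 * t) powr (- 1 / 2) * exp (- (W * (sinh (2 * t))\<^sup>2))) (at_right 0)"
    by eventually_elim auto
  then obtain t :: real where t: "0 < t" "c < cosh (2 * t) powr (- 1 / 2) * exp (- (W * (sinh (2 * t))\<^sup>2))"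
    by (auto dest!: eventually_happens)
  \<comment> \<open>Since u = x^2 / D, the prescribed ranges of u are reached for this t by
    rescaling x.\<close>
  define D where "D = 2 * sinh (2 * t) * cosh (2 * t)"
  have D: "0 < D" using t by (simp add: D_def)
  define Q where "Q = {x :: real ^ 'n. \<forall>i. 0 < x $ i \<and> lo i < (x $ i)\<^sup>2 / D \<and> (x $ i)\<^sup>2 / D < 2 * lo i}"
  have "Q = (\<Inter>i. {x. 0 < x $ i} \<inter> {x. lo i < (x $ i)\<^sup>2 / D} \<inter> {x. (x $ i)\<^sup>2 / D < 2 * lo i})" by (auto simp: Q_def)
  moreover have "open ({x :: real ^ 'n. 0 < x $ i} \<inter> {x. lo i < (x $ i)\<^sup>2 / D} \<inter> {x. (x $ i)\<^sup>2 / D < 2 * lo i})" for i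
    using D by (intro open_Int open_Collect_less continuous_intros) auto
  ultimately have "open Q" by (auto intro!: open_INT)
  \<comment> \<open>The point where every u is the midpoint of its range from \<open>lo i\<close> to
    \<open>2 * lo i\<close>.\<close>
  moreover have "(\<chi> i. sqrt (3 / 2 * lo i * D)) \<in> Q"
    using D lo by (auto simp: Q_def less_imp_le)
  then have "Q \<noteq> {}" by auto
  moreover have Qs: "Q \<subseteq> space pos_orthant" by (auto simp: Q_def space_pos_orthant)
  moreover have "1 < (\<integral>\<^sup>+y. ennreal (laguerre_kernel \<alpha> t x y) \<partial>pos_orthant)" if x: "x \<in> Q" for x
  proof -
    let ?u = "\<lambda>i. (x $ i)\<^sup>2 / D"
    have u: "lo i < ?u i" "?u i < 2 * lo i" for i using x by (auto simp: Q_def)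
    have p: "(\<Prod>i\<in>UNIV. (c * c) * (if i = j then 1 + \<epsilon> else 1)) = (c * c) ^ CARD('n) * (1 + \<epsilon>)"
      by (simp only: prod.distrib prod_constant) (simp add: prod.delta power_mult_distrib)
    have "ennreal 1 < ennreal ((c * c) ^ CARD('n) * (1 + \<epsilon>))" using c(1) by (intro ennreal_lessI) auto
    also have "\<dots> = (\<Prod>i\<in>UNIV. ennreal (c * c * (if i = j then 1 + \<epsilon> else 1)))"
      unfolding p[symmetric] using c \<epsilon> by (intro prod_ennreal[symmetric]) auto
    also have "\<dots> \<le> (\<Prod>i\<in>UNIV. ennreal (cosh (2 * t) powr (- 1 / 2) * exp (- (?u i * (sinh (2 * t))\<^sup>2))) * laguerre_mass (?\<beta> i) (?u i))"
    proof (intro prod_mono_ennreal)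
      fix i
      have "c \<le> cosh (2 * t) powr (- 1 / 2) * exp (- (W * (sinh (2 * t))\<^sup>2))" using t by simp
      also have "\<dots> \<le> cosh (2 * t) powr (- 1 / 2) * exp (- (?u i * (sinh (2 * t))\<^sup>2))"
      proof -
        have "?u i * (sinh (2 * t))\<^sup>2 \<le> W * (sinh (2 * t))\<^sup>2"
          using u(2)[of i] W[of i] by (intro mult_right_mono) auto
        then have "exp (- (W * (sinh (2 * t))\<^sup>2)) \<le> exp (- (?u i * (sinh (2 * t))\<^sup>2))"
          by (simp only: exp_le_cancel_iff neg_le_iff_le)
        then show ?thesis by (rule mult_left_mono) simp
      qed
      finally have 1: "ennreal c \<le> ennreal (cosh (2 * t) powr (- 1 / 2) * exp (- (?u i * (sinh (2 * t))\<^sup>2)))"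
        by (rule ennreal_leI)
      have 2: "ennreal (c * (if i = j then 1 + \<epsilon> else 1)) \<le> laguerre_mass (?\<beta> i) (?u i)"
      proof (cases "i = j")
        case True
        have "c * (1 + \<epsilon>) \<le> 1 * (1 + \<epsilon>)" using c \<epsilon> by (intro mult_right_mono) auto
        then have "ennreal (c * (1 + \<epsilon>)) \<le> ennreal (1 + \<epsilon>)" by (intro ennreal_leI) simp
        also have "\<dots> \<le> laguerre_mass (?\<beta> j) (?u j)" using u[of j] by (intro Uj) (auto simp: lo_def)
        finally show ?thesis using True by simp
      next
        case False
        then show ?thesis using V(2)[of "?u i" i] u(1)[of i] by (simp add: lo_def)
      qed
      have "ennreal (c * c * (if i = j then 1 + \<epsilon> else 1)) = ennreal c * ennreal (c * (if i = j then 1 + \<epsilon> else 1))"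
        using c by (simp only: mult.assoc ennreal_mult' less_imp_le)
      also have "\<dots> \<le> ennreal (cosh (2 * t) powr (- 1 / 2) * exp (- (?u i * (sinh (2 * t))\<^sup>2))) * laguerre_mass (?\<beta> i) (?u i)"
        using 1 2 by (rule mult_mono) auto
      finally show "ennreal (c * c * (if i = j then 1 + \<epsilon> else 1))
        \<le> ennreal (cosh (2 * t) powr (- 1 / 2) * exp (- (?u i * (sinh (2 * t))\<^sup>2))) * laguerre_mass (?\<beta> i) (?u i)" .
    qed
    also have "\<dots> = (\<integral>\<^sup>+y. ennreal (laguerre_kernel \<alpha> t x y) \<partial>pos_orthant)"
      using x Qs unfolding D_def by (intro nn_integral_laguerre_kernel[symmetric] \<alpha> t) auto
    finally show ?thesis by simp
  qed
  ultimately show thesis using that t(1) by blast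
qed

text \<open>\<open>Lp_contractive\<close> tests only functions in L2, which excludes the constant 1
  at p = \<infinity>. Indicators of the bounded sets \<open>B n\<close> increase to it;
  contractivity bounds each of their images by 1, hence by monotone convergence the mass by 1 almost
  everywhere. This contradicts the mass above 1 on the open set Q.\<close>

lemma not_Lp_contractive_laguerre:
  fixes \<alpha> :: "real ^ 'n"
  assumes \<alpha>: "\<And>i. - 1 / 2 \<le> \<alpha> $ i" and j: "\<alpha> $ j \<in> {- 1 / 2<..<1 / 2}"
    and K: "\<And>t. 0 < t \<Longrightarrow> \<exists>K. symmetric_kernel pos_orthant (laguerre_kernel \<alpha> t) K"
  shows "\<not> Lp_contractive pos_orthant (laguerre_semigroup \<alpha>)"
proof
  assume contr: "Lp_contractive pos_orthant (laguerre_semigroup \<alpha>)"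
  obtain t Q where t: "0 < t" and Q: "open Q" "Q \<noteq> {}" "Q \<subseteq> space pos_orthant"
    "\<And>x. x \<in> Q \<Longrightarrow> 1 < (\<integral>\<^sup>+y. ennreal (laguerre_kernel \<alpha> t x y) \<partial>pos_orthant)"
    using laguerre_kernel_mass_gt_1[OF \<alpha> j] by blast
  obtain K where "symmetric_kernel pos_orthant (laguerre_kernel \<alpha> t) K" using K[OF t] by blast
  then interpret symmetric_kernel pos_orthant "laguerre_kernel \<alpha> t" K .
  define B :: "nat \<Rightarrow> (real ^ 'n) set" where "B = (\<lambda>n. cball 0 (real n) \<inter> space pos_orthant)"
  have B [measurable]: "B n \<in> sets pos_orthant" for n
    by (auto simp: B_def sets_pos_orthant_iff space_pos_orthant)
  have "AE x in pos_orthant. (\<integral>\<^sup>+y. ennreal (laguerre_kernel \<alpha> t x y) * indicator (B n) y \<partial>pos_orthant) \<le> 1" for n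
  proof -
    have "emeasure pos_orthant (B n) = emeasure lborel (B n)"
      by (rule emeasure_pos_orthant) (auto simp: B_def space_pos_orthant)
    also have "\<dots> \<le> emeasure lborel (cball 0 (real n) :: (real ^ 'n) set)"
      by (intro emeasure_mono) (auto simp: B_def)
    also have "\<dots> < \<infinity>" by (rule emeasure_lborel_cball_finite)
    finally have fin: "emeasure pos_orthant (B n) < \<infinity>" .
    have f2: "indicator (B n) \<in> Lp_space 2 pos_orthant" by (rule indicator_Lp_space_2[OF B fin])
    have le1: "Lp_norm \<infinity> pos_orthant (indicator (B n)) \<le> 1"
    proof (subst Lp_norm_infinity)
      show "esssup pos_orthant (\<lambda>x. ennreal \<bar>indicator (B n) x\<bar>) \<le> 1"
      proof (rule esssup_I)
        show "(\<lambda>x. ennreal \<bar>indicator (B n) x\<bar>) \<in> borel_measurable pos_orthant" by measurable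
        show "AE x in pos_orthant. ennreal \<bar>indicator (B n) x\<bar> \<le> 1"
          by (rule AE_I2) (simp split: split_indicator)
      qed
    qed measurable
    have "Lp_norm \<infinity> pos_orthant (indicator (B n)) < \<infinity>" using le1 by (rule le_less_trans) simp
    then have fi: "indicator (B n) \<in> Lp_space \<infinity> pos_orthant"
      unfolding Lp_space_def mem_Collect_eq by (intro conjI) measurable
    have "Lp_norm \<infinity> pos_orthant (laguerre_semigroup \<alpha> t (indicator (B n))) \<le> Lp_norm \<infinity> pos_orthant (indicator (B n))"
      using contr t f2 fi unfolding Lp_contractive_def by auto
    also note le1
    finally have e1: "esssup pos_orthant (\<lambda>x. ennreal \<bar>kernel_op pos_orthant (laguerre_kernel \<alpha> t) (indicator (B n)) x\<bar>) \<le> 1"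
      using t by (simp add: laguerre_semigroup_eq_kernel_op Lp_norm_top)
    have "AE x in pos_orthant. ennreal \<bar>kernel_op pos_orthant (laguerre_kernel \<alpha> t) (indicator (B n)) x\<bar> \<le> 1"
      by (rule eventually_mono[OF esssup_AE]) (erule order_trans[OF _ e1])
    then show ?thesis using AE_space
    proof eventually_elim
      case (elim x)
      have "0 \<le> kernel_op pos_orthant (laguerre_kernel \<alpha> t) (indicator (B n)) x"
        using elim by (intro kernel_op_nonneg) auto
      then have "ennreal (kernel_op pos_orthant (laguerre_kernel \<alpha> t) (indicator (B n)) x) \<le> 1" using elim by simp
      also have "ennreal (kernel_op pos_orthant (laguerre_kernel \<alpha> t) (indicator (B n)) x)
        = (\<integral>\<^sup>+y. ennreal (laguerre_kernel \<alpha> t x y) * ennreal (indicator (B n) y) \<partial>pos_orthant)"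
        using elim by (intro ennreal_kernel_op) auto
      finally show ?case by (simp add: ennreal_indicator)
    qed
  qed
  then have "AE x in pos_orthant. \<forall>n. (\<integral>\<^sup>+y. ennreal (laguerre_kernel \<alpha> t x y) * indicator (B n) y \<partial>pos_orthant) \<le> 1"
    by (simp add: AE_all_countable)
  then have "AE x in pos_orthant. x \<notin> Q" using AE_space
  proof eventually_elim
    case (elim x)
    have sup: "(SUP n. indicator (B n) y :: ennreal) = 1" if "y \<in> space pos_orthant" for y
    proof -
      obtain n where "norm y \<le> real n" using real_arch_simple by blast
      then have "(indicator (B n) y :: ennreal) = 1" using that by (simp add: B_def)
      then have "1 \<le> (SUP n. indicator (B n) y :: ennreal)" by (metis SUP_upper UNIV_I)
      moreover have "(SUP n. indicator (B n) y :: ennreal) \<le> 1" by (intro SUP_least) (simp add: indicator_def)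
      ultimately show ?thesis by (rule antisym[rotated])
    qed
    have "(\<integral>\<^sup>+y. ennreal (laguerre_kernel \<alpha> t x y) \<partial>pos_orthant)
      = (\<integral>\<^sup>+y. (SUP n. ennreal (laguerre_kernel \<alpha> t x y) * indicator (B n) y) \<partial>pos_orthant)"
      by (intro nn_integral_cong) (simp add: SUP_mult_left_ennreal[symmetric] sup)
    also have "\<dots> = (SUP n. \<integral>\<^sup>+y. ennreal (laguerre_kernel \<alpha> t x y) * indicator (B n) y \<partial>pos_orthant)"
    proof (rule nn_integral_monotone_convergence_SUP)
      show "incseq (\<lambda>n y. ennreal (laguerre_kernel \<alpha> t x y) * indicator (B n) y)"
        by (auto simp: incseq_def le_fun_def indicator_def B_def intro!: mult_left_mono)
      show "(\<lambda>y. ennreal (laguerre_kernel \<alpha> t x y) * indicator (B n) y) \<in> borel_measurable pos_orthant" for n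
        using elim by measurable
    qed
    also have "\<dots> \<le> 1" using elim by (intro SUP_least) auto
    finally show ?case using Q(4)[of x] by (auto simp: not_le[symmetric])
  qed
  then show False using AE_pos_orthant_open[OF Q(1,3)] Q(2) by simp
qed

theorem theorem4p1:
  fixes \<alpha> :: "real ^ 'n"
  assumes "\<forall>i. - 1 / 2 \<le> \<alpha> $ i"
  shows
    "((\<forall>i. \<alpha> $ i \<in> {- 1 / 2} \<union> {1 / 2..}) \<longrightarrow>
        submarkovian_semigroup pos_orthant (L1_plus_Linf pos_orthant) (laguerre_semigroup \<alpha>) \<and>
        \<not> markovian_semigroup pos_orthant (L1_plus_Linf pos_orthant) (laguerre_semigroup \<alpha>) \<and>
        (\<forall>p\<ge>1. \<forall>t>0. Lp_opnorm p pos_orthant (laguerre_semigroup \<alpha> t)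
           \<le> ennreal (cosh (2 * t) powr (- real CARD('n) / 2)))) \<and>
     ((\<exists>i. \<alpha> $ i \<in> {- 1 / 2<..<1 / 2}) \<longrightarrow>
        \<not> Lp_contractive pos_orthant (laguerre_semigroup \<alpha>) \<and>
        (\<exists>c>1. \<forall>p\<ge>1. \<forall>t>0. Lp_opnorm p pos_orthant (laguerre_semigroup \<alpha> t)
           \<le> ennreal (c * cosh (2 * t) powr (- real CARD('n) / 2))))"
proof (intro conjI impI)
  have \<alpha>: "- 1 / 2 \<le> \<alpha> $ i" for i using assms by simp
  have \<beta>: "0 \<le> (\<alpha> $ i + 1 / 2) / 2" for i using \<alpha>[of i] by simp
  let ?C = "\<lambda>t. cosh (2 * t) powr (- real CARD('n) / 2)"
  {
    assume *: "\<forall>i. \<alpha> $ i \<in> {- 1 / 2} \<union> {1 / 2..}"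
    have mass: "laguerre_mass ((\<alpha> $ i + 1 / 2) / 2) u \<le> ennreal 1" if "0 < u" for i u
    proof (cases "\<alpha> $ i = - 1 / 2")
      case True
      then have "(\<alpha> $ i + 1 / 2) / 2 = 0" by simp
      then show ?thesis using laguerre_mass_0[OF that] by simp
    next
      case False
      then have "1 / 2 \<le> (\<alpha> $ i + 1 / 2) / 2" using * spec[OF *, of i] by auto
      then show ?thesis using laguerre_mass_le_1[OF _ that] by simp
    qed
    have le: "(\<integral>\<^sup>+y. ennreal (laguerre_kernel \<alpha> t x y) \<partial>pos_orthant) \<le> ennreal (?C t)" if "0 < t" "x \<in> space pos_orthant" for t x
      using nn_integral_laguerre_kernel_le[OF \<alpha> that, of "\<lambda>_. 1"] mass by simp
    have C1: "?C t < 1" if t: "0 < t" for t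
    proof -
      have "1 < cosh (2 * t)" using cosh_real_strict_mono[of 0 "2 * t"] t by simp
      then show ?thesis using powr_less_mono[of "- real CARD('n) / 2" 0 "cosh (2 * t)"] by simp
    qed
    have ker: "symmetric_kernel pos_orthant (laguerre_kernel \<alpha> t) (?C t)" if "0 < t" for t
      using that le by (intro symmetric_laguerre_kernel \<alpha>) auto
    \<comment> \<open>The kernel is used with two constants: the decaying one for the norm bound,
      and 1 for the semigroup locale, whose constant may not depend on t.\<close>
    have ker1: "symmetric_kernel pos_orthant (laguerre_kernel \<alpha> t) 1" if "0 < t" for t
    proof (intro symmetric_laguerre_kernel \<alpha> that)
      fix x :: "real ^ 'n" assume "x \<in> space pos_orthant"
      then have "(\<integral>\<^sup>+y. ennreal (laguerre_kernel \<alpha> t x y) \<partial>pos_orthant) \<le> ennreal (?C t)" by (rule le[OF that])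
      also have "\<dots> \<le> ennreal 1" using C1[OF that] by (intro ennreal_leI) simp
      finally show "(\<integral>\<^sup>+y. ennreal (laguerre_kernel \<alpha> t x y) \<partial>pos_orthant) \<le> ennreal 1" .
    qed simp
    interpret symmetric_kernel_semigroup pos_orthant "laguerre_kernel \<alpha>"
      using \<alpha> ker1 by (rule symmetric_laguerre_kernel_semigroup)
    have eq: "kernel_semigroup = laguerre_semigroup \<alpha>"
      by (intro ext) (simp add: kernel_semigroup_def laguerre_semigroup_def kernel_op_def)
    show "submarkovian_semigroup pos_orthant (L1_plus_Linf pos_orthant) (laguerre_semigroup \<alpha>)"
      using submarkovian_kernel_semigroup unfolding eq .
    show "\<not> markovian_semigroup pos_orthant (L1_plus_Linf pos_orthant) (laguerre_semigroup \<alpha>)"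
    proof
      assume "markovian_semigroup pos_orthant (L1_plus_Linf pos_orthant) (laguerre_semigroup \<alpha>)"
      then have "AE x in pos_orthant. laguerre_semigroup \<alpha> 1 (\<lambda>_. 1) x = 1" by (simp add: markovian_semigroup_def)
      \<comment> \<open>At every point the image of the constant 1 at time 1 is at most (cosh
        2)^(-d/2) < 1, so equality to 1 could hold almost everywhere only on a null orthant.\<close>
      then have "AE x in pos_orthant. x \<notin> space (pos_orthant :: (real ^ 'n) measure)"
      proof eventually_elim
        case (elim x)
        show ?case
        proof
          assume x: "x \<in> space pos_orthant"
          have "ennreal (kernel_op pos_orthant (laguerre_kernel \<alpha> 1) (\<lambda>_. 1) x) \<le> ennreal (?C 1)"
            using le[OF zero_less_one x] by (subst symmetric_kernel.ennreal_kernel_op[OF ker1 x]) auto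
          moreover have "kernel_op pos_orthant (laguerre_kernel \<alpha> 1) (\<lambda>_. 1) x = 1"
            using elim by (simp add: laguerre_semigroup_eq_kernel_op)
          ultimately have "1 \<le> ?C 1" by (simp add: ennreal_ge_1)
          then show False using C1[of 1] by simp
        qed
      qed
      then have "space (pos_orthant :: (real ^ 'n) measure) = {}"
        using open_pos_orthant by (intro AE_pos_orthant_open) (simp_all add: space_pos_orthant)
      then show False using pos_orthant_nonempty by blast
    qed
    show "\<forall>p\<ge>1. \<forall>t>0. Lp_opnorm p pos_orthant (laguerre_semigroup \<alpha> t) \<le> ennreal (?C t)"
      using symmetric_kernel.Lp_opnorm_kernel_op_le[OF ker] by (simp add: laguerre_semigroup_eq_kernel_op)
  next
    assume "\<exists>i. \<alpha> $ i \<in> {- 1 / 2<..<1 / 2}"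
    then obtain j where j: "\<alpha> $ j \<in> {- 1 / 2<..<1 / 2}" by blast
    have "\<forall>i. \<exists>B. 1 \<le> B \<and> (\<forall>u>0. laguerre_mass ((\<alpha> $ i + 1 / 2) / 2) u \<le> ennreal B)"
      using laguerre_mass_bounded[OF \<beta>] by metis
    then obtain B where B: "\<And>i. 1 \<le> B i" "\<And>i u. 0 < u \<Longrightarrow> laguerre_mass ((\<alpha> $ i + 1 / 2) / 2) u \<le> ennreal (B i)"
      by metis
    have B0: "0 \<le> B i" for i using B(1)[of i] by simp
    \<comment> \<open>The product of the coordinate bounds is only known to be \<ge> 1; adding 1
      gives the strict inequality c > 1.\<close>
    define c where "c = (\<Prod>i\<in>UNIV. B i) + 1"
    have "1 \<le> (\<Prod>i\<in>UNIV. B i)" using B(1) by (intro prod_ge_1) auto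
    then have c: "1 < c" by (simp add: c_def)
    have ker: "symmetric_kernel pos_orthant (laguerre_kernel \<alpha> t) (c * ?C t)" if t: "0 < t" for t
    proof (intro symmetric_laguerre_kernel \<alpha> t)
      show "0 < c * ?C t" using c by (intro mult_pos_pos) auto
      fix x :: "real ^ 'n" assume x: "x \<in> space pos_orthant"
      have "(\<integral>\<^sup>+y. ennreal (laguerre_kernel \<alpha> t x y) \<partial>pos_orthant) \<le> ennreal ((\<Prod>i\<in>UNIV. B i) * ?C t)"
        by (rule nn_integral_laguerre_kernel_le[OF \<alpha> t x B0 B(2)])
      also have "\<dots> \<le> ennreal (c * ?C t)" by (intro ennreal_leI mult_right_mono) (auto simp: c_def)
      finally show "(\<integral>\<^sup>+y. ennreal (laguerre_kernel \<alpha> t x y) \<partial>pos_orthant) \<le> ennreal (c * ?C t)" .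
    qed
    show "\<not> Lp_contractive pos_orthant (laguerre_semigroup \<alpha>)"
      using not_Lp_contractive_laguerre[OF \<alpha> j] ker by blast
    show "\<exists>c>1. \<forall>p\<ge>1. \<forall>t>0. Lp_opnorm p pos_orthant (laguerre_semigroup \<alpha> t) \<le> ennreal (c * ?C t)"
      using c symmetric_kernel.Lp_opnorm_kernel_op_le[OF ker]
      by (intro exI[of _ c]) (simp add: laguerre_semigroup_eq_kernel_op)
  }
qed

end
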